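(* Let $p$ be a prime and let $\mathbb{F}$ be a topological subfield of the field $\mathbb{Q}_p$ of $p$-adic numbers. (1) $\mathrm{SL}(n,\mathbb{F})$ and $\mathrm{PSL}(n,\mathbb{F})$ are totally minimal for every positive integer $n$ which is coprime to $p-1$ (e.g., for arbitrary $n$ when $p=2$). (2) If $p-1$ is not a power of $2$, then $\mathrm{SL}(p-1,\mathbb{Q})$ is not minimal, where $\mathbb{Q}$ carries the $p$-adic topology inherited from $\mathbb{Q}_p$.
   Context: $\mathrm{SL}(n,\mathbb{F})$ is the group of $n\times n$ matrices over $\mathbb{F}$ of determinant $1$ with the pointwise topology inherited from $\mathbb{F}^{n^2}$; $\mathrm{PSL}(n,\mathbb{F})=\mathrm{SL}(n,\mathbb{F})/Z(\mathrm{SL}(n,\mathbb{F}))$, where $Z$ denotes the center, has the quotient topology. Powers of $2$ include $2^0=1$. All topological groups are Hausdorff. A topological group is minimal if it admits no strictly coarser Hausdorff group topology; $G$ is totally minimal if every Hausdorff quotient group $G/N$ ($N$ a closed normal subgroup) is minimal. *)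

theory Defs
  imports
    "HOL-Analysis.Analysis"
    "HOL-Algebra.Coset"
    "Jordan_Normal_Form.Determinant"
    "Berlekamp_Zassenhaus.Finite_Field"
begin

hide_const (open) Determinants.det

section \<open>The \<open>p\<close>-adic absolute value on the rationals\<close>

definition rat_padic_val :: "nat \<Rightarrow> rat \<Rightarrow> int" where
  "rat_padic_val p q =
     int (multiplicity (int p) (fst (quotient_of q))) -
     int (multiplicity (int p) (snd (quotient_of q)))"

definition rat_padic_abs :: "nat \<Rightarrow> rat \<Rightarrow> real" where
  "rat_padic_abs p q = (if q = 0 then 0 else real p powi (- rat_padic_val p q))"

lemma rat_padic_val_divide:
  assumes p: "prime p" and "a \<noteq> 0" "b \<noteq> 0"
  shows "rat_padic_val p (of_int a / of_int b) =
           int (multiplicity (int p) a) - int (multiplicity (int p) b)"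
proof -
  obtain c d where cd: "quotient_of (of_int a / of_int b :: rat) = (c, d)"
    by (cases "quotient_of (of_int a / of_int b :: rat)") auto
  have d: "d > 0" using quotient_of_denom_pos[OF cd] .
  have eq: "(of_int a / of_int b :: rat) = of_int c / of_int d"
    using quotient_of_div[OF cd] .
  have c: "c \<noteq> 0" using eq assms d by auto
  have "(of_int (a * d) :: rat) = of_int (c * b)"
    using eq assms d by (simp add: field_simps)
  hence "a * d = c * b" by (simp only: of_int_eq_iff)
  moreover have "prime_elem (int p)" using p by simp
  ultimately have "multiplicity (int p) a + multiplicity (int p) d
      = multiplicity (int p) c + multiplicity (int p) b"
    using assms c d by (metis prime_elem_multiplicity_mult_distrib less_irrefl)
  thus ?thesis by (simp add: rat_padic_val_def cd)
qed

lemma rat_padic_abs_zero [simp]: "rat_padic_abs p 0 = 0"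
  by (simp add: rat_padic_abs_def)

lemma rat_padic_abs_nonneg [simp]: "rat_padic_abs p q \<ge> 0"
  by (simp add: rat_padic_abs_def)

lemma rat_padic_abs_eq_0_iff [simp]: "prime p \<Longrightarrow> rat_padic_abs p q = 0 \<longleftrightarrow> q = 0"
  using prime_gt_0_nat by (auto simp: rat_padic_abs_def)

lemma rat_fracE:
  obtains a b :: int where "b \<noteq> 0" "(q::rat) = of_int a / of_int b"
  by (metis quotient_of_div quotient_of_denom_pos less_irrefl surj_pair)

lemma rat_padic_abs_mult:
  assumes p: "prime p"
  shows "rat_padic_abs p (q * r) = rat_padic_abs p q * rat_padic_abs p r"
proof (cases "q = 0 \<or> r = 0")
  case False
  obtain a b :: int where ab: "b \<noteq> 0" "q = of_int a / of_int b" by (rule rat_fracE)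
  obtain c d :: int where cd: "d \<noteq> 0" "r = of_int c / of_int d" by (rule rat_fracE)
  have nz: "a \<noteq> 0" "c \<noteq> 0" using False ab cd by auto
  have qr: "q * r = of_int (a * c) / of_int (b * d)" using ab cd by simp
  have "prime_elem (int p)" using p by simp
  hence "rat_padic_val p (q * r) = rat_padic_val p q + rat_padic_val p r"
    unfolding qr using nz ab cd p
    by (subst rat_padic_val_divide) 
       (auto simp: rat_padic_val_divide prime_elem_multiplicity_mult_distrib)
  thus ?thesis using False prime_gt_0_nat[OF p]
    by (simp add: rat_padic_abs_def flip: power_int_add)
qed auto

lemma rat_padic_abs_ultra:
  assumes p: "prime p"
  shows "rat_padic_abs p (q + r) \<le> max (rat_padic_abs p q) (rat_padic_abs p r)"
proof (cases "q = 0 \<or> r = 0 \<or> q + r = 0")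
  case False
  obtain a b :: int where ab: "b \<noteq> 0" "q = of_int a / of_int b" by (rule rat_fracE)
  obtain c d :: int where cd: "d \<noteq> 0" "r = of_int c / of_int d" by (rule rat_fracE)
  define A where "A = a * d"
  define C where "C = c * b"
  define B where "B = b * d"
  have B: "B \<noteq> 0" using ab cd by (simp add: B_def)
  have q: "q = of_int A / of_int B" using ab cd by (simp add: A_def B_def)
  have r: "r = of_int C / of_int B" using ab cd by (simp add: C_def B_def)
  have qr: "q + r = of_int (A + C) / of_int B" by (simp add: q r add_divide_distrib)
  have nz: "A \<noteq> 0" "C \<noteq> 0" "A + C \<noteq> 0" using False q r qr by auto
  have np: "\<not> is_unit (int p)" using p by (metis prime_def not_prime_unit prime_nat_int_transfer)
  let ?m = "min (multiplicity (int p) A) (multiplicity (int p) C)"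
  have "int p ^ ?m dvd A" "int p ^ ?m dvd C"
    by (auto intro: multiplicity_dvd')
  hence "int p ^ ?m dvd A + C" by simp
  hence "?m \<le> multiplicity (int p) (A + C)"
    using nz np by (intro multiplicity_geI) auto
  hence "min (rat_padic_val p q) (rat_padic_val p r) \<le> rat_padic_val p (q + r)"
    using rat_padic_val_divide[OF p nz(1) B, folded q] rat_padic_val_divide[OF p nz(2) B, folded r]
      rat_padic_val_divide[OF p nz(3) B, folded qr]
    by linarith
  hence "rat_padic_val p q \<le> rat_padic_val p (q + r) \<or> rat_padic_val p r \<le> rat_padic_val p (q + r)"
    by (auto simp: min_def split: if_splits)
  moreover have "real p \<ge> 1" using prime_ge_1_nat[OF p] by simp
  ultimately show ?thesis using False
    by (auto simp: rat_padic_abs_def le_max_iff_disj intro!: power_int_increasing)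
qed (auto simp: max_def)

lemma rat_padic_abs_one [simp]: "rat_padic_abs p 1 = 1"
  by (simp add: rat_padic_abs_def rat_padic_val_def)

lemma rat_padic_abs_minus [simp]: "rat_padic_abs p (- q) = rat_padic_abs p q"
proof -
  have "multiplicity (int p) (- a) = multiplicity (int p) a" for a
    unfolding multiplicity_def by simp
  thus ?thesis
    by (simp add: rat_padic_abs_def rat_padic_val_def rat_uminus_code Let_def case_prod_beta)
qed

lemma rat_padic_abs_minus_commute: "rat_padic_abs p (q - r) = rat_padic_abs p (r - q)"
  using rat_padic_abs_minus[of p "q - r"] by simp

lemma rat_padic_abs_triangle:
  "prime p \<Longrightarrow> rat_padic_abs p (q + r) \<le> rat_padic_abs p q + rat_padic_abs p r"
  using rat_padic_abs_ultra[of p q r] rat_padic_abs_nonneg[of p q] rat_padic_abs_nonneg[of p r]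
  by linarith

lemma rat_padic_abs_diff:
  assumes "prime p"
  shows "\<bar>rat_padic_abs p q - rat_padic_abs p r\<bar> \<le> rat_padic_abs p (q - r)"
  using rat_padic_abs_triangle[OF assms, of "q - r" r]
    rat_padic_abs_triangle[OF assms, of "r - q" q] rat_padic_abs_minus_commute[of p q r]
  by simp

lemma rat_padic_abs_inverse:
  assumes "prime p"
  shows "rat_padic_abs p (inverse q) = inverse (rat_padic_abs p q)"
proof (cases "q = 0")
  case False
  hence "rat_padic_abs p (inverse q) * rat_padic_abs p q = 1"
    using rat_padic_abs_mult[OF assms, of "inverse q" q] by simp
  thus ?thesis by (metis inverse_unique mult.commute)
qed auto


section \<open>The field of \<open>p\<close>-adic numbers as the completion of the rationals\<close>

definition padic_cauchy :: "nat \<Rightarrow> (nat \<Rightarrow> rat) \<Rightarrow> bool" where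
  "padic_cauchy p X \<longleftrightarrow>
     (\<forall>e>0. \<exists>N. \<forall>m\<ge>N. \<forall>n\<ge>N. rat_padic_abs p (X m - X n) < e)"

definition padic_null :: "nat \<Rightarrow> (nat \<Rightarrow> rat) \<Rightarrow> bool" where
  "padic_null p X \<longleftrightarrow> (\<lambda>n. rat_padic_abs p (X n)) \<longlonglongrightarrow> 0"

lemma padic_null_le:
  assumes "\<And>n. rat_padic_abs p (X n) \<le> f n" "f \<longlonglongrightarrow> 0"
  shows "padic_null p X"
  unfolding padic_null_def
  by (rule tendsto_sandwich[OF _ _ tendsto_const assms(2)]) (auto simp: assms(1))

lemma padic_null_const [simp]: "prime p \<Longrightarrow> padic_null p (\<lambda>n. c) \<longleftrightarrow> c = 0"
  by (simp add: padic_null_def LIMSEQ_const_iff)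

lemma padic_null_minus: "padic_null p X \<Longrightarrow> padic_null p (\<lambda>n. - X n)"
  by (simp add: padic_null_def)

lemma padic_null_add:
  assumes "prime p" "padic_null p X" "padic_null p Y"
  shows "padic_null p (\<lambda>n. X n + Y n)"
  using tendsto_add[OF assms(2,3)[unfolded padic_null_def]]
  by (intro padic_null_le[OF rat_padic_abs_triangle[OF assms(1)]]) simp

lemma padic_null_diff:
  assumes "prime p" "padic_null p X" "padic_null p Y"
  shows "padic_null p (\<lambda>n. X n - Y n)"
  using padic_null_add[OF assms(1,2) padic_null_minus[OF assms(3)]] by simp

lemma padic_cauchy_const [simp]: "padic_cauchy p (\<lambda>n. c)"
  by (simp add: padic_cauchy_def)

lemma padic_cauchyD:
  "padic_cauchy p X \<Longrightarrow> e > 0 \<Longrightarrow> \<exists>N. \<forall>m\<ge>N. \<forall>n\<ge>N. rat_padic_abs p (X m - X n) < e"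
  by (simp add: padic_cauchy_def)

lemma padic_cauchy_minus: "padic_cauchy p X \<Longrightarrow> padic_cauchy p (\<lambda>n. - X n)"
  by (simp add: padic_cauchy_def rat_padic_abs_minus_commute)

lemma padic_cauchy_convergent:
  assumes p: "prime p" and X: "padic_cauchy p X"
  shows "convergent (\<lambda>n. rat_padic_abs p (X n))"
proof -
  have "Cauchy (\<lambda>n. rat_padic_abs p (X n))"
    unfolding Cauchy_def dist_real_def
    using X rat_padic_abs_diff[OF p] unfolding padic_cauchy_def by (meson order_le_less_trans)
  thus ?thesis by (simp add: Cauchy_convergent_iff)
qed

lemma padic_cauchy_bounded:
  assumes p: "prime p" and X: "padic_cauchy p X"
  obtains b where "b > 0" "\<And>n. rat_padic_abs p (X n) \<le> b"
proof -
  have "Bseq (\<lambda>n. rat_padic_abs p (X n))"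
    using padic_cauchy_convergent[OF p X] by (rule convergent_imp_Bseq)
  thus ?thesis using that by (auto elim!: BseqE)
qed

lemma padic_cauchy_add:
  assumes p: "prime p" and X: "padic_cauchy p X" and Y: "padic_cauchy p Y"
  shows "padic_cauchy p (\<lambda>n. X n + Y n)"
  unfolding padic_cauchy_def
proof (intro allI impI)
  fix e :: real assume e: "e > 0"
  obtain M N where M: "\<And>m n. m \<ge> M \<Longrightarrow> n \<ge> M \<Longrightarrow> rat_padic_abs p (X m - X n) < e"
    and N: "\<And>m n. m \<ge> N \<Longrightarrow> n \<ge> N \<Longrightarrow> rat_padic_abs p (Y m - Y n) < e"
    using padic_cauchyD[OF X e] padic_cauchyD[OF Y e] by blast
  have "rat_padic_abs p (X m + Y m - (X n + Y n)) < e" if "m \<ge> max M N" "n \<ge> max M N" for m n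
    using rat_padic_abs_ultra[OF p, of "X m - X n" "Y m - Y n"] M[of m n] N[of m n] that
    by (simp add: add_diff_add)
  thus "\<exists>N. \<forall>m\<ge>N. \<forall>n\<ge>N. rat_padic_abs p (X m + Y m - (X n + Y n)) < e" by blast
qed

lemma padic_cauchy_mult:
  assumes p: "prime p" and X: "padic_cauchy p X" and Y: "padic_cauchy p Y"
  shows "padic_cauchy p (\<lambda>n. X n * Y n)"
  unfolding padic_cauchy_def
proof (intro allI impI)
  fix e :: real assume e: "e > 0"
  obtain a where a: "a > 0" "\<And>n. rat_padic_abs p (X n) \<le> a"
    using padic_cauchy_bounded[OF p X] by blast
  obtain b where b: "b > 0" "\<And>n. rat_padic_abs p (Y n) \<le> b"
    using padic_cauchy_bounded[OF p Y] by blast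
  have "e / b > 0" "e / a > 0" using e a b by auto
  then obtain M N where M: "\<And>m n. m \<ge> M \<Longrightarrow> n \<ge> M \<Longrightarrow> rat_padic_abs p (X m - X n) < e / b"
    and N: "\<And>m n. m \<ge> N \<Longrightarrow> n \<ge> N \<Longrightarrow> rat_padic_abs p (Y m - Y n) < e / a"
    using padic_cauchyD[OF X] padic_cauchyD[OF Y] by metis
  have "rat_padic_abs p (X m * Y m - X n * Y n) < e" if mn: "m \<ge> max M N" "n \<ge> max M N" for m n
  proof -
    have "rat_padic_abs p (X m) * rat_padic_abs p (Y m - Y n) \<le> a * rat_padic_abs p (Y m - Y n)"
      using a by (intro mult_right_mono) auto
    also have "\<dots> < a * (e / a)"
      using a N[of m n] mn by (intro mult_strict_left_mono) auto
    finally have 1: "rat_padic_abs p (X m * (Y m - Y n)) < e"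
      using a by (simp add: rat_padic_abs_mult[OF p])
    have "rat_padic_abs p (X m - X n) * rat_padic_abs p (Y n) \<le> rat_padic_abs p (X m - X n) * b"
      using b by (intro mult_left_mono) auto
    also have "\<dots> < e / b * b"
      using b M[of m n] mn by (intro mult_strict_right_mono) auto
    finally have 2: "rat_padic_abs p ((X m - X n) * Y n) < e"
      using b by (simp add: rat_padic_abs_mult[OF p])
    show ?thesis
      using 1 2 rat_padic_abs_ultra[OF p, of "X m * (Y m - Y n)" "(X m - X n) * Y n"]
      by (simp add: mult_diff_mult)
  qed
  thus "\<exists>N. \<forall>m\<ge>N. \<forall>n\<ge>N. rat_padic_abs p (X m * Y m - X n * Y n) < e" by blast
qed

lemma padic_null_mult_cauchy:
  assumes p: "prime p" and X: "padic_cauchy p X" and Y: "padic_null p Y"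
  shows "padic_null p (\<lambda>n. X n * Y n)"
proof -
  obtain a where a: "a > 0" "\<And>n. rat_padic_abs p (X n) \<le> a"
    using padic_cauchy_bounded[OF p X] by blast
  have "(\<lambda>n. a * rat_padic_abs p (Y n)) \<longlonglongrightarrow> 0"
    using tendsto_mult_right_zero[OF Y[unfolded padic_null_def]] by blast
  moreover have "rat_padic_abs p (X n * Y n) \<le> a * rat_padic_abs p (Y n)" for n
    unfolding rat_padic_abs_mult[OF p] by (intro mult_right_mono a) simp
  ultimately show ?thesis by (intro padic_null_le)
qed

lemma padic_cauchy_not_null:
  assumes p: "prime p" and X: "padic_cauchy p X" and nz: "\<not> padic_null p X"
  obtains b N where "b > 0" "\<And>n. n \<ge> N \<Longrightarrow> b < rat_padic_abs p (X n)"
proof -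
  obtain l where l: "(\<lambda>n. rat_padic_abs p (X n)) \<longlonglongrightarrow> l"
    using padic_cauchy_convergent[OF p X] by (auto simp: convergent_def)
  have "l \<ge> 0" by (rule LIMSEQ_le_const[OF l]) auto
  moreover have "l \<noteq> 0" using nz l by (auto simp: padic_null_def)
  ultimately have "l / 2 > 0" "l / 2 < l" by auto
  thus ?thesis
    using that[of "l / 2"] order_tendstoD(1)[OF l, of "l / 2"]
    by (auto simp: eventually_sequentially)
qed

lemma padic_cauchy_inverse:
  assumes p: "prime p" and X: "padic_cauchy p X" and nz: "\<not> padic_null p X"
  shows "padic_cauchy p (\<lambda>n. inverse (X n))"
  unfolding padic_cauchy_def
proof (intro allI impI)
  fix e :: real assume e: "e > 0"
  obtain b M where b: "b > 0" "\<And>n. n \<ge> M \<Longrightarrow> b < rat_padic_abs p (X n)"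
    using padic_cauchy_not_null[OF p X nz] by blast
  have "b * e * b > 0" using b e by simp
  then obtain N where N: "\<And>m n. m \<ge> N \<Longrightarrow> n \<ge> N \<Longrightarrow> rat_padic_abs p (X m - X n) < b * e * b"
    using padic_cauchyD[OF X] by metis
  have "rat_padic_abs p (inverse (X m) - inverse (X n)) < e"
    if mn: "m \<ge> max M N" "n \<ge> max M N" for m n
  proof -
    have bm: "b < rat_padic_abs p (X m)" and bn: "b < rat_padic_abs p (X n)"
      using b mn by auto
    have nz: "X m \<noteq> 0" "X n \<noteq> 0" using bm bn b(1) by auto
    have "rat_padic_abs p (inverse (X m) - inverse (X n)) =
        inverse (rat_padic_abs p (X m)) * rat_padic_abs p (X m - X n) * inverse (rat_padic_abs p (X n))"
      using nz by (simp add: inverse_diff_inverse rat_padic_abs_mult[OF p] rat_padic_abs_inverse[OF p])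
    also have "\<dots> < inverse b * (b * e * b) * inverse b"
      using b(1) bm bn N[of m n] mn e
      by (intro mult_strict_mono less_imp_inverse_less) auto
    also have "\<dots> = e" using b(1) by simp
    finally show ?thesis .
  qed
  thus "\<exists>N. \<forall>m\<ge>N. \<forall>n\<ge>N. rat_padic_abs p (inverse (X m) - inverse (X n)) < e" by blast
qed

lemma padic_null_cong_rel:
  assumes p: "prime p" and XY: "padic_null p (\<lambda>n. X n - Y n)"
  shows "padic_null p X \<longleftrightarrow> padic_null p Y"
  using padic_null_diff[OF p _ XY, of X] padic_null_add[OF p _ XY, of Y] by auto

lemma padic_null_inverse_mult:
  assumes p: "prime p" and X: "padic_cauchy p X" and nz: "\<not> padic_null p X"
  shows "padic_null p (\<lambda>n. inverse (X n) * X n - 1)"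
proof -
  obtain b M where b: "b > 0" "\<And>n. n \<ge> M \<Longrightarrow> b < rat_padic_abs p (X n)"
    using padic_cauchy_not_null[OF p X nz] by blast
  have "rat_padic_abs p (inverse (X n) * X n - 1) = 0" if "n \<ge> M" for n
  proof -
    have "X n \<noteq> 0" using b(1) b(2)[OF that] by auto
    thus ?thesis by simp
  qed
  thus ?thesis unfolding padic_null_def
    by (intro tendsto_eventually) (auto simp: eventually_sequentially)
qed

lemma padic_null_inverse_diff:
  assumes p: "prime p" and X: "padic_cauchy p X" "\<not> padic_null p X"
    and Y: "padic_cauchy p Y" "\<not> padic_null p Y"
    and XY: "padic_null p (\<lambda>n. X n - Y n)"
  shows "padic_null p (\<lambda>n. inverse (X n) - inverse (Y n))"
proof -
  let ?D = "\<lambda>n. - (inverse (X n) * inverse (Y n)) * (X n - Y n)"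
  have "padic_null p ?D"
    by (intro padic_null_mult_cauchy padic_cauchy_minus padic_cauchy_mult padic_cauchy_inverse
        p X Y XY)
  moreover have "padic_null p (\<lambda>n. ?D n - (inverse (X n) - inverse (Y n)))"
  proof -
    obtain a M where a: "a > 0" "\<And>n. n \<ge> M \<Longrightarrow> a < rat_padic_abs p (X n)"
      using padic_cauchy_not_null[OF p X] by blast
    obtain b N where b: "b > 0" "\<And>n. n \<ge> N \<Longrightarrow> b < rat_padic_abs p (Y n)"
      using padic_cauchy_not_null[OF p Y] by blast
    have "rat_padic_abs p (?D n - (inverse (X n) - inverse (Y n))) = 0" if "n \<ge> max M N" for n
    proof -
      have "X n \<noteq> 0" "Y n \<noteq> 0" using that a(1) b(1) a(2)[of n] b(2)[of n] by auto
      thus ?thesis by (simp add: inverse_diff_inverse p)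
    qed
    thus ?thesis unfolding padic_null_def
      by (intro tendsto_eventually) (unfold eventually_sequentially, blast)
  qed
  ultimately show ?thesis using padic_null_diff[OF p, of ?D] by fastforce
qed

text \<open>
  The prime \<open>p\<close> enters as the cardinality of an index type \<open>'p\<close> of class \<^class>\<open>prime_card\<close>:
  the type \<open>'p padic\<close> is the field of \<open>p\<close>-adic numbers for \<open>p = CARD('p)\<close>, namely the ring of
  \<open>p\<close>-adic Cauchy sequences of rationals modulo the ideal of null sequences.
\<close>

typedef (overloaded) 'p padic_seq = "{X. padic_cauchy CARD('p::prime_card) X}"
  by (rule exI[of _ "\<lambda>_. 0"]) simp

setup_lifting type_definition_padic_seq

instantiation padic_seq :: (prime_card) comm_ring
begin

lift_definition zero_padic_seq :: "'a padic_seq" is "\<lambda>_. 0" by simp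

lift_definition plus_padic_seq :: "'a padic_seq \<Rightarrow> 'a padic_seq \<Rightarrow> 'a padic_seq"
  is "\<lambda>X Y n. X n + Y n"
  by (rule padic_cauchy_add[OF prime_card])

lift_definition uminus_padic_seq :: "'a padic_seq \<Rightarrow> 'a padic_seq" is "\<lambda>X n. - X n"
  by (rule padic_cauchy_minus)

lift_definition minus_padic_seq :: "'a padic_seq \<Rightarrow> 'a padic_seq \<Rightarrow> 'a padic_seq"
  is "\<lambda>X Y n. X n - Y n"
  using padic_cauchy_add[OF prime_card _ padic_cauchy_minus] by fastforce

lift_definition times_padic_seq :: "'a padic_seq \<Rightarrow> 'a padic_seq \<Rightarrow> 'a padic_seq"
  is "\<lambda>X Y n. X n * Y n"
  by (rule padic_cauchy_mult[OF prime_card])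

instance
  by standard (transfer; simp add: algebra_simps)+

end

lift_definition null_padic_seq :: "'p::prime_card padic_seq \<Rightarrow> bool" is "padic_null CARD('p)" .

lift_definition const_padic_seq :: "rat \<Rightarrow> 'p::prime_card padic_seq" is "\<lambda>q _. q" by simp

lift_definition inverse_padic_seq :: "'p::prime_card padic_seq \<Rightarrow> 'p padic_seq"
  is "\<lambda>X. if padic_null CARD('p) X then (\<lambda>_. 0) else (\<lambda>n. inverse (X n))"
  by (auto intro: padic_cauchy_inverse[OF prime_card])

lift_definition lim_abs_padic_seq :: "'p::prime_card padic_seq \<Rightarrow> real"
  is "\<lambda>X. lim (\<lambda>n. rat_padic_abs CARD('p) (X n))" .

lemma lim_abs_padic_seq_LIMSEQ:
  "(\<lambda>n. rat_padic_abs CARD('p) (Rep_padic_seq X n)) \<longlonglongrightarrow> lim_abs_padic_seq (X :: 'p::prime_card padic_seq)"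
  unfolding lim_abs_padic_seq.rep_eq
  using padic_cauchy_convergent[OF prime_card, of "Rep_padic_seq X"] Rep_padic_seq[of X]
  by (simp add: convergent_LIMSEQ_iff)

lemma null_padic_seq_iff: "null_padic_seq X \<longleftrightarrow> lim_abs_padic_seq X = 0"
  unfolding null_padic_seq.rep_eq padic_null_def
  using lim_abs_padic_seq_LIMSEQ[of X] LIMSEQ_unique by auto

lemma lim_abs_padic_seq_diff_null:
  assumes "null_padic_seq (X - Y :: 'p::prime_card padic_seq)"
  shows "lim_abs_padic_seq X = lim_abs_padic_seq Y"
proof -
  let ?a = "\<lambda>X n. rat_padic_abs CARD('p) (Rep_padic_seq X n)"
  have "(\<lambda>n. \<bar>?a X n - ?a Y n\<bar>) \<longlonglongrightarrow> 0"
  proof (rule tendsto_sandwich[OF _ _ tendsto_const])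
    show "(\<lambda>n. rat_padic_abs CARD('p) (Rep_padic_seq X n - Rep_padic_seq Y n)) \<longlonglongrightarrow> 0"
      using assms by (simp add: null_padic_seq.rep_eq padic_null_def minus_padic_seq.rep_eq)
  qed (auto intro!: always_eventually rat_padic_abs_diff[OF prime_card])
  moreover have "(\<lambda>n. \<bar>?a X n - ?a Y n\<bar>) \<longlonglongrightarrow> \<bar>lim_abs_padic_seq X - lim_abs_padic_seq Y\<bar>"
    by (intro tendsto_intros lim_abs_padic_seq_LIMSEQ)
  ultimately show ?thesis using LIMSEQ_unique by fastforce
qed

lemma null_padic_seq_add: "null_padic_seq X \<Longrightarrow> null_padic_seq Y \<Longrightarrow> null_padic_seq (X + Y)"
  by transfer (rule padic_null_add[OF prime_card])

lemma null_padic_seq_minus: "null_padic_seq X \<Longrightarrow> null_padic_seq (- X)"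
  by transfer (rule padic_null_minus)

lemma null_padic_seq_mult: "null_padic_seq Y \<Longrightarrow> null_padic_seq (X * Y)"
  by transfer (rule padic_null_mult_cauchy[OF prime_card])

lemma null_padic_seq_mult_left: "null_padic_seq X \<Longrightarrow> null_padic_seq (X * Y)"
  using null_padic_seq_mult[of X Y] by (simp add: mult.commute)

lemma null_padic_seq_zero [simp]: "null_padic_seq 0"
  by transfer (simp add: prime_card)

definition padic_rel :: "'p::prime_card padic_seq \<Rightarrow> 'p padic_seq \<Rightarrow> bool" where
  "padic_rel X Y \<longleftrightarrow> null_padic_seq (X - Y)"

lemma equivp_padic_rel: "equivp (padic_rel :: 'p::prime_card padic_seq \<Rightarrow> _)"
proof (rule equivpI)
  show "reflp (padic_rel :: 'p padic_seq \<Rightarrow> _)"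
    by (rule reflpI) (simp add: padic_rel_def)
  show "symp (padic_rel :: 'p padic_seq \<Rightarrow> _)"
  proof (rule sympI)
    fix X Y :: "'p padic_seq" assume "padic_rel X Y"
    thus "padic_rel Y X" using null_padic_seq_minus[of "X - Y"] by (simp add: padic_rel_def)
  qed
  show "transp (padic_rel :: 'p padic_seq \<Rightarrow> _)"
  proof (rule transpI)
    fix X Y Z :: "'p padic_seq" assume "padic_rel X Y" "padic_rel Y Z"
    thus "padic_rel X Z" using null_padic_seq_add[of "X - Y" "Y - Z"] by (simp add: padic_rel_def)
  qed
qed

quotient_type (overloaded) 'p padic = "'p::prime_card padic_seq" / padic_rel
  by (rule equivp_padic_rel)

instantiation padic :: (prime_card) field
begin

lift_definition zero_padic :: "'a padic" is "0" .

lift_definition one_padic :: "'a padic" is "const_padic_seq 1" .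

lift_definition plus_padic :: "'a padic \<Rightarrow> 'a padic \<Rightarrow> 'a padic" is "(+)"
  unfolding padic_rel_def add_diff_add by (rule null_padic_seq_add)

lift_definition uminus_padic :: "'a padic \<Rightarrow> 'a padic" is "uminus"
  unfolding padic_rel_def minus_diff_minus by (rule null_padic_seq_minus)

lift_definition times_padic :: "'a padic \<Rightarrow> 'a padic \<Rightarrow> 'a padic" is "(*)"
  unfolding padic_rel_def mult_diff_mult
  by (rule null_padic_seq_add[OF null_padic_seq_mult null_padic_seq_mult_left])

lift_definition inverse_padic :: "'a padic \<Rightarrow> 'a padic" is "inverse_padic_seq"
  unfolding padic_rel_def
proof transfer
  fix X Y assume *: "padic_cauchy CARD('a) X" "padic_cauchy CARD('a) Y"
    "padic_null CARD('a) (\<lambda>n. X n - Y n)"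
  show "padic_null CARD('a)
         (\<lambda>n. (if padic_null CARD('a) X then \<lambda>_. 0 else (\<lambda>n. inverse (X n))) n -
              (if padic_null CARD('a) Y then \<lambda>_. 0 else (\<lambda>n. inverse (Y n))) n)"
    using padic_null_cong_rel[OF prime_card *(3)] padic_null_inverse_diff[OF prime_card *(1) _ *(2) _ *(3)]
    by (auto simp: prime_card)
qed

definition "x - y = x + - y" for x y :: "'a padic"

definition "x div y = x * inverse y" for x y :: "'a padic"

instance
proof
  fix a b c :: "'a padic"
  show "a + b = b + a" "(a + b) + c = a + (b + c)" "0 + a = a" "- a + a = 0"
    "(a * b) * c = a * (b * c)" "a * b = b * a" "(a + b) * c = a * c + b * c"
    by (transfer; simp add: padic_rel_def algebra_simps)+
  show "1 * a = a"
  proof transfer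
    fix X :: "'a padic_seq"
    have "const_padic_seq 1 * X = X" by transfer simp
    thus "padic_rel (const_padic_seq 1 * X) X" by (simp add: padic_rel_def)
  qed
  show "(0::'a padic) \<noteq> 1"
    unfolding zero_padic_def one_padic_def padic.abs_eq_iff padic_rel_def
    by transfer (simp add: prime_card)
  show "a \<noteq> 0 \<Longrightarrow> inverse a * a = 1"
  proof transfer
    fix X :: "'a padic_seq" assume "\<not> padic_rel X 0"
    thus "padic_rel (inverse_padic_seq X * X) (const_padic_seq 1)"
      unfolding padic_rel_def diff_0_right
      by transfer (simp add: padic_null_inverse_mult prime_card)
  qed
  show "inverse (0::'a padic) = 0"
  proof transfer
    have "inverse_padic_seq 0 = (0 :: 'a padic_seq)" by transfer (simp add: prime_card)
    thus "padic_rel (inverse_padic_seq 0) (0 :: 'a padic_seq)" by (simp add: padic_rel_def)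
  qed
qed (fact minus_padic_def divide_padic_def)+

end


subsection \<open>The \<open>p\<close>-adic absolute value and the \<open>p\<close>-adic topology\<close>

lift_definition padic_abs :: "'p::prime_card padic \<Rightarrow> real" is "lim_abs_padic_seq"
  unfolding padic_rel_def by (rule lim_abs_padic_seq_diff_null)

lemma padic_abs_nonneg [simp]: "padic_abs x \<ge> 0"
  by transfer (rule LIMSEQ_le_const[OF lim_abs_padic_seq_LIMSEQ], auto)

lemma padic_abs_eq_0_iff [simp]: "padic_abs x = 0 \<longleftrightarrow> x = 0"
  by transfer (simp add: padic_rel_def null_padic_seq_iff)

lemma padic_abs_mult: "padic_abs (x * y) = padic_abs x * padic_abs y"
proof transfer
  fix X Y :: "'a padic_seq"
  have "(\<lambda>n. rat_padic_abs CARD('a) (Rep_padic_seq (X * Y) n)) \<longlonglongrightarrow>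
          lim_abs_padic_seq X * lim_abs_padic_seq Y"
    unfolding times_padic_seq.rep_eq rat_padic_abs_mult[OF prime_card]
    by (intro tendsto_mult lim_abs_padic_seq_LIMSEQ)
  thus "lim_abs_padic_seq (X * Y) = lim_abs_padic_seq X * lim_abs_padic_seq Y"
    using LIMSEQ_unique lim_abs_padic_seq_LIMSEQ by blast
qed

lemma padic_abs_ultra: "padic_abs (x + y) \<le> max (padic_abs x) (padic_abs y)"
proof transfer
  fix X Y :: "'a padic_seq"
  show "lim_abs_padic_seq (X + Y) \<le> max (lim_abs_padic_seq X) (lim_abs_padic_seq Y)"
    by (rule LIMSEQ_le[OF lim_abs_padic_seq_LIMSEQ
          tendsto_max[OF lim_abs_padic_seq_LIMSEQ lim_abs_padic_seq_LIMSEQ]])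
       (auto simp: plus_padic_seq.rep_eq intro: rat_padic_abs_ultra[OF prime_card])
qed

lemma padic_abs_minus [simp]: "padic_abs (- x) = padic_abs x"
  by transfer (simp add: lim_abs_padic_seq.rep_eq uminus_padic_seq.rep_eq)

instantiation padic :: (prime_card) metric_space
begin

definition dist_padic :: "'a padic \<Rightarrow> 'a padic \<Rightarrow> real" where
  "dist_padic x y = padic_abs (x - y)"

definition uniformity_padic :: "('a padic \<times> 'a padic) filter" where
  "uniformity_padic = (INF e\<in>{0 <..}. principal {(x, y). dist x y < e})"

definition open_padic :: "'a padic set \<Rightarrow> bool" where
  "open_padic U \<longleftrightarrow> (\<forall>x\<in>U. eventually (\<lambda>(x', y). x' = x \<longrightarrow> y \<in> U) uniformity)"

instance
proof
  fix x y z :: "'a padic"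
  show "dist x y = 0 \<longleftrightarrow> x = y" by (simp add: dist_padic_def)
  have "dist x y \<le> max (padic_abs (x - z)) (padic_abs (z - y))"
    using padic_abs_ultra[of "x - z" "z - y"] by (simp add: dist_padic_def)
  also have "padic_abs (z - y) = padic_abs (y - z)"
    using padic_abs_minus[of "y - z"] by simp
  also have "max (padic_abs (x - z)) (padic_abs (y - z)) \<le> padic_abs (x - z) + padic_abs (y - z)"
    using padic_abs_nonneg[of "x - z"] padic_abs_nonneg[of "y - z"] by simp
  finally show "dist x y \<le> dist x z + dist y z"
    by (simp add: dist_padic_def)
qed (fact uniformity_padic_def open_padic_def)+

end

lemma padic_of_nat: "of_nat n = abs_padic (const_padic_seq (of_nat n))"
proof (induction n)
  case 0
  have "const_padic_seq 0 = (0 :: 'a padic_seq)" by transfer simp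
  thus ?case by (simp add: zero_padic_def)
next
  case (Suc n)
  have "const_padic_seq 1 + const_padic_seq (of_nat n) = (const_padic_seq (1 + of_nat n) :: 'a padic_seq)"
    by transfer simp
  thus ?case using Suc by (simp add: one_padic_def plus_padic.abs_eq)
qed

instance padic :: (prime_card) field_char_0
proof
  show "inj (of_nat :: nat \<Rightarrow> 'a padic)"
  proof (rule injI)
    fix m n assume "of_nat m = (of_nat n :: 'a padic)"
    hence "null_padic_seq (const_padic_seq (of_nat m) - const_padic_seq (of_nat n) :: 'a padic_seq)"
      by (simp add: padic_of_nat padic.abs_eq_iff padic_rel_def)
    hence "(of_nat m - of_nat n :: rat) = 0"
      by transfer (simp add: prime_card)
    thus "m = n" by simp
  qed
qed

lemma padic_abs_of_rat: "padic_abs (of_rat q :: 'p::prime_card padic) = rat_padic_abs CARD('p) q"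
proof -
  have int: "(of_int k :: 'p padic) = abs_padic (const_padic_seq (of_int k))" for k
  proof (cases k)
    case (nonneg n)
    thus ?thesis by (simp add: padic_of_nat)
  next
    case (neg n)
    have "- const_padic_seq (of_nat (Suc n)) = (const_padic_seq (- of_nat (Suc n)) :: 'p padic_seq)"
      by transfer simp
    thus ?thesis using neg by (simp add: padic_of_nat uminus_padic.abs_eq del: of_nat_Suc)
  qed
  obtain a b :: int where ab: "b \<noteq> 0" "q = of_int a / of_int b" by (rule rat_fracE)
  have abs_int: "padic_abs (of_int k :: 'p padic) = rat_padic_abs CARD('p) (of_int k)" for k
    by (simp add: int padic_abs.abs_eq lim_abs_padic_seq.rep_eq const_padic_seq.rep_eq)
  have "padic_abs (of_rat q * of_int b :: 'p padic) = rat_padic_abs CARD('p) (q * of_int b)"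
    using ab abs_int[of a] by (simp add: of_rat_divide)
  hence "padic_abs (of_rat q :: 'p padic) * rat_padic_abs CARD('p) (of_int b) =
      rat_padic_abs CARD('p) q * rat_padic_abs CARD('p) (of_int b)"
    by (simp add: padic_abs_mult abs_int rat_padic_abs_mult[OF prime_card])
  thus ?thesis using ab by (simp add: prime_card)
qed


section \<open>Minimal topological groups\<close>

definition hausdorff_topological_group :: "('a, 'b) monoid_scheme \<Rightarrow> 'a topology \<Rightarrow> bool" where
  "hausdorff_topological_group G T \<longleftrightarrow>
     group G \<and> topspace T = carrier G \<and> Hausdorff_space T \<and>
     continuous_map (prod_topology T T) T (\<lambda>(x, y). x \<otimes>\<^bsub>G\<^esub> y) \<and>
     continuous_map T T (\<lambda>x. inv\<^bsub>G\<^esub> x)"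

definition minimal_topological_group :: "('a, 'b) monoid_scheme \<Rightarrow> 'a topology \<Rightarrow> bool" where
  "minimal_topological_group G T \<longleftrightarrow>
     hausdorff_topological_group G T \<and>
     \<not> (\<exists>T'. hausdorff_topological_group G T' \<and> T' \<noteq> T \<and> (\<forall>U. openin T' U \<longrightarrow> openin T U))"

definition quotient_topology :: "'a topology \<Rightarrow> ('a \<Rightarrow> 'b) \<Rightarrow> 'b topology" where
  "quotient_topology T f =
     topology (\<lambda>U. U \<subseteq> f ` topspace T \<and> openin T {x \<in> topspace T. f x \<in> U})"

lemma openin_quotient_topology:
  "openin (quotient_topology T f) U \<longleftrightarrow>
     U \<subseteq> f ` topspace T \<and> openin T {x \<in> topspace T. f x \<in> U}"
proof -
  have "istopology (\<lambda>U. U \<subseteq> f ` topspace T \<and> openin T {x \<in> topspace T. f x \<in> U})"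
    unfolding istopology_def
  proof (intro conjI allI impI)
    fix U V assume *: "U \<subseteq> f ` topspace T \<and> openin T {x \<in> topspace T. f x \<in> U}"
      "V \<subseteq> f ` topspace T \<and> openin T {x \<in> topspace T. f x \<in> V}"
    have "{x \<in> topspace T. f x \<in> U \<inter> V} =
        {x \<in> topspace T. f x \<in> U} \<inter> {x \<in> topspace T. f x \<in> V}" by blast
    thus "openin T {x \<in> topspace T. f x \<in> U \<inter> V}" using * by (simp add: openin_Int)
    show "U \<inter> V \<subseteq> f ` topspace T" using * by blast
  next
    fix K assume *: "\<forall>U\<in>K. U \<subseteq> f ` topspace T \<and> openin T {x \<in> topspace T. f x \<in> U}"
    have "{x \<in> topspace T. f x \<in> \<Union>K} = (\<Union>U\<in>K. {x \<in> topspace T. f x \<in> U})" by blast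
    moreover have "openin T (\<Union>U\<in>K. {x \<in> topspace T. f x \<in> U})"
      using * by (intro openin_Union) blast
    ultimately show "openin T {x \<in> topspace T. f x \<in> \<Union>K}" by simp
    show "\<Union>K \<subseteq> f ` topspace T" using * by blast
  qed
  thus ?thesis by (simp add: quotient_topology_def topology_inverse')
qed

lemma quotient_map_quotient_topology: "quotient_map T (quotient_topology T f) f"
proof -
  have "topspace (quotient_topology T f) = f ` topspace T"
  proof
    have "{x \<in> topspace T. f x \<in> f ` topspace T} = topspace T" by auto
    hence "openin (quotient_topology T f) (f ` topspace T)"
      by (simp add: openin_quotient_topology)
    thus "f ` topspace T \<subseteq> topspace (quotient_topology T f)" by (rule openin_subset)
    show "topspace (quotient_topology T f) \<subseteq> f ` topspace T"
      using openin_topspace[of "quotient_topology T f"]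
      by (rule openin_quotient_topology[THEN iffD1, THEN conjunct1])
  qed
  thus ?thesis by (simp add: quotient_map_def openin_quotient_topology)
qed

abbreviation coset_topology :: "('a, 'b) monoid_scheme \<Rightarrow> 'a topology \<Rightarrow> 'a set \<Rightarrow> 'a set topology"
  where "coset_topology G T N \<equiv> quotient_topology T (\<lambda>x. N #>\<^bsub>G\<^esub> x)"

definition totally_minimal_topological_group :: "('a, 'b) monoid_scheme \<Rightarrow> 'a topology \<Rightarrow> bool" where
  "totally_minimal_topological_group G T \<longleftrightarrow>
     hausdorff_topological_group G T \<and>
     (\<forall>N. N \<lhd> G \<and> closedin T N \<longrightarrow> minimal_topological_group (G Mod N) (coset_topology G T N))"


section \<open>Special linear groups over subfields\<close>

definition is_subfield :: "'a::field set \<Rightarrow> bool" where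
  "is_subfield F \<longleftrightarrow>
     0 \<in> F \<and> 1 \<in> F \<and>
     (\<forall>x\<in>F. \<forall>y\<in>F. x + y \<in> F \<and> x * y \<in> F) \<and>
     (\<forall>x\<in>F. - x \<in> F \<and> inverse x \<in> F)"

definition SL :: "nat \<Rightarrow> 'a::field set \<Rightarrow> 'a mat monoid" where
  "SL n F =
     \<lparr>carrier = {A \<in> carrier_mat n n. (\<forall>i<n. \<forall>j<n. A $$ (i, j) \<in> F) \<and> det A = 1},
      mult = (*),
      one = 1\<^sub>m n\<rparr>"

text \<open>
  The topology on \<open>SL n F\<close> is the one induced by the embedding \<open>A \<mapsto> (A\<^sub>i\<^sub>j)\<close> into the product
  \<open>F\<^bsup>n \<times> n\<^esup>\<close>, where \<open>F\<close> carries the subspace topology.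
\<close>

definition SL_topology :: "nat \<Rightarrow> 'a::{field, topological_space} set \<Rightarrow> 'a mat topology" where
  "SL_topology n F =
     pullback_topology (carrier (SL n F))
       (\<lambda>A. restrict (\<lambda>ij. A $$ ij) ({..<n} \<times> {..<n}))
       (product_topology (\<lambda>_. top_of_set F) ({..<n} \<times> {..<n}))"

definition group_center :: "('a, 'b) monoid_scheme \<Rightarrow> 'a set" where
  "group_center G = {z \<in> carrier G. \<forall>g\<in>carrier G. z \<otimes>\<^bsub>G\<^esub> g = g \<otimes>\<^bsub>G\<^esub> z}"

definition PSL :: "nat \<Rightarrow> 'a::field set \<Rightarrow> 'a mat set monoid" where
  "PSL n F = SL n F Mod group_center (SL n F)"

definition PSL_topology :: "nat \<Rightarrow> 'a::{field, topological_space} set \<Rightarrow> 'a mat set topology" where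
  "PSL_topology n F = coset_topology (SL n F) (SL_topology n F) (group_center (SL n F))"

end

(*
  Let T' be a coarser Hausdorff group topology on a quotient G/N of G = SL(n,F), and V a filter base
  of T'-neighbourhoods of the identity, pulled back to G. Let M be the intersection of the closures
  of the members of V in SL(n,Q_p). Since F is dense in Q_p, M is a closed normal subgroup of
  SL(n,Q_p), and it meets G in N. By Iwasawa's argument M consists of scalars unless N = G; these
  scalars are n-th roots of unity, hence +-1 when n is coprime to p - 1, so they lie in G and M = N.
  Some member of V is bounded: a very large g conjugates a unipotent of size one close to the
  identity, so otherwise compactness would put into M a limit of unipotents of size one, which is
  not a scalar. Compactness applied to a bounded member of V now shows that any neighbourhood of N
  contains a member of V, that is, T' is the quotient topology.

  If p - 1 has an odd divisor q > 1, then Q_p contains a nontrivial q-th root of unity z. Since q is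
  odd, no scalar z^j other than 1 is rational, so SL(p-1,Q) embeds into SL(p-1,Q_p)/<z>. By density
  there are rational matrices close to the scalar z, so the topology inherited from this quotient is
  strictly coarser.
*)
theory Submission
  imports Defs "HOL-Number_Theory.Number_Theory"
begin

section \<open>The field of p-adic numbers\<close>

text \<open>\<open>F\<close> need not be complete, so \<open>SL n F\<close> has no compactness to
  exploit. Cluster points exist only over Q_p, and the crux is to bring them back into
  \<open>SL n F\<close>. This is the reason for coprimality: a scalar c of determinant 1 satisfies
  c^n = 1, and roots of unity other than 1 and -1 could lie outside \<open>F\<close>. The coarser
  topology is not extended to SL(n,Q_p): only the subgroup of limit points is formed, and density
  enters because conjugation is controlled for elements over \<open>F\<close> alone. The unipotents
  u are chosen with u - 1 of norm one and of square zero. By the ultrametric inequality a scalar c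
  close to such a u would satisfy |c - 1| = 1 and |(c - 1)^2| < 1 at once; the size of u - 1 alone
  would not exclude scalars. All quotients, including those of PSL, are handled by one statement
  about neighbourhood bases in SL.\<close>

lemma padic_abs_zero [simp]: "padic_abs (0 :: 'p::prime_card padic) = 0"
  by simp

lemma padic_abs_one [simp]: "padic_abs (1 :: 'p::prime_card padic) = 1"
  using padic_abs_of_rat[where 'p='p, of 1] by simp

lemma padic_abs_of_int: "padic_abs (of_int k :: 'p::prime_card padic) = rat_padic_abs CARD('p) (of_int k)"
  using padic_abs_of_rat[where 'p='p, of "of_int k"] by simp

lemma padic_abs_of_nat: "padic_abs (of_nat k :: 'p::prime_card padic) = rat_padic_abs CARD('p) (of_nat k)"
  using padic_abs_of_rat[where 'p='p, of "of_nat k"] by simp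

lemma padic_abs_power: "padic_abs (x ^ n :: 'p::prime_card padic) = padic_abs x ^ n"
  by (induction n) (simp_all add: padic_abs_mult)

lemma padic_abs_inverse: "padic_abs (inverse x :: 'p::prime_card padic) = inverse (padic_abs x)"
proof (cases "x = 0")
  case False
  hence "padic_abs (inverse x) * padic_abs x = 1"
    by (simp flip: padic_abs_mult)
  thus ?thesis by (metis inverse_unique mult.commute)
qed simp

lemma padic_abs_divide: "padic_abs (x / y :: 'p::prime_card padic) = padic_abs x / padic_abs y"
  by (simp add: divide_inverse padic_abs_mult padic_abs_inverse)

lemma padic_abs_minus_commute: "padic_abs (x - y :: 'p::prime_card padic) = padic_abs (y - x)"
  using padic_abs_minus[of "x - y"] by simp

lemma padic_abs_diff_ultra: "padic_abs (x - y :: 'p::prime_card padic) \<le> max (padic_abs x) (padic_abs y)"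
  using padic_abs_ultra[of x "- y"] by simp

lemma padic_abs_triangle: "padic_abs (x + y :: 'p::prime_card padic) \<le> padic_abs x + padic_abs y"
  using padic_abs_ultra[of x y] padic_abs_nonneg[of x] padic_abs_nonneg[of y] by linarith

text \<open>The isosceles principle: in an ultrametric triangle the two longest sides are equal.
  Here and for matrices it often takes the place of continuity estimates.\<close>

lemma padic_abs_eqI:
  assumes "padic_abs (x - y :: 'p::prime_card padic) < padic_abs x"
  shows "padic_abs y = padic_abs x"
  using assms padic_abs_ultra[of "x - y" y] padic_abs_ultra[of x "y - x"]
    padic_abs_minus_commute[of x y] by (simp add: max_def split: if_splits)

lemma padic_abs_sum_le:
  assumes "\<And>i. i \<in> I \<Longrightarrow> padic_abs (f i :: 'p::prime_card padic) \<le> c" "0 \<le> c"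
  shows "padic_abs (sum f I) \<le> c"
  using assms(1)
proof (induction I rule: infinite_finite_induct)
  case (insert i I)
  have "padic_abs (f i + sum f I) \<le> max (padic_abs (f i)) (padic_abs (sum f I))"
    by (rule padic_abs_ultra)
  also have "\<dots> \<le> c" using insert by simp
  finally show ?case using insert by simp
qed (use assms(2) in auto)

lemma padic_abs_sum_less:
  assumes "\<And>i. i \<in> I \<Longrightarrow> padic_abs (f i :: 'p::prime_card padic) < c" "0 < c"
  shows "padic_abs (sum f I) < c"
  using assms(1)
proof (induction I rule: infinite_finite_induct)
  case (insert i I)
  have "padic_abs (f i + sum f I) \<le> max (padic_abs (f i)) (padic_abs (sum f I))"
    by (rule padic_abs_ultra)
  also have "\<dots> < c" using insert by simp
  finally show ?case using insert by simp
qed (use assms(2) in auto)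

lemma padic_abs_prod: "padic_abs (prod f I :: 'p::prime_card padic) = (\<Prod>i\<in>I. padic_abs (f i))"
  by (induction I rule: infinite_finite_induct) (simp_all add: padic_abs_mult)

lemma card_prime_ge_2: "real CARD('p::prime_card) \<ge> 2"
  using prime_ge_2_nat[OF prime_card[where 'a='p]] by linarith

lemma rat_padic_abs_of_int:
  assumes "prime p" "k \<noteq> 0"
  shows "rat_padic_abs p (of_int k) = inverse (real p ^ multiplicity (int p) k)"
proof -
  have "rat_padic_val p (of_int k) = int (multiplicity (int p) k)"
    using rat_padic_val_divide[OF assms(1), of k 1] assms(2) by simp
  thus ?thesis using assms(2) by (simp add: rat_padic_abs_def power_int_minus)
qed

lemma padic_abs_of_int_le_1: "padic_abs (of_int k :: 'p::prime_card padic) \<le> 1"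
proof (cases "k = 0")
  case False
  have "1 \<le> real CARD('p) ^ multiplicity (int CARD('p)) k"
    using card_prime_ge_2[where 'p='p] by simp
  thus ?thesis using False
    by (simp add: padic_abs_of_int rat_padic_abs_of_int prime_card inverse_le_1_iff)
qed simp

lemma padic_abs_of_nat_le_1: "padic_abs (of_nat k :: 'p::prime_card padic) \<le> 1"
  using padic_abs_of_int_le_1[of "int k", where 'p='p] by simp

lemma padic_abs_of_int_dvd:
  assumes "int CARD('p) ^ m dvd k"
  shows "padic_abs (of_int k :: 'p::prime_card padic) \<le> inverse (real CARD('p) ^ m)"
proof -
  obtain l where l: "k = int CARD('p) ^ m * l" using assms by (auto elim: dvdE)
  have "multiplicity (int CARD('p)) (int CARD('p)) = 1"
    using prime_card[where 'a='p] by (intro multiplicity_self) (auto simp: prime_int_iff)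
  hence "padic_abs (of_int (int CARD('p)) :: 'p padic) = inverse (real CARD('p))"
    using prime_card[where 'a='p] unfolding padic_abs_of_int
    by (subst rat_padic_abs_of_int) auto
  hence "padic_abs (of_int k :: 'p padic) = inverse (real CARD('p)) ^ m * padic_abs (of_int l :: 'p padic)"
    by (simp add: l padic_abs_mult padic_abs_power)
  also have "\<dots> \<le> inverse (real CARD('p)) ^ m * 1"
    by (intro mult_left_mono padic_abs_of_int_le_1) simp
  finally show ?thesis by (simp add: power_inverse)
qed

lemma padic_abs_of_nat_self: "padic_abs (of_nat CARD('p) :: 'p::prime_card padic) = inverse (real CARD('p))"
proof -
  have "multiplicity (int CARD('p)) (int CARD('p)) = 1"
    using prime_card[where 'a='p] by (intro multiplicity_self) (auto simp: prime_int_iff)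
  thus ?thesis
    using prime_card[where 'a='p] rat_padic_abs_of_int[of "CARD('p)" "int CARD('p)"]
    unfolding padic_abs_of_nat by auto
qed

lemma padic_abs_of_int_not_dvd:
  assumes "\<not> int CARD('p) dvd k"
  shows "padic_abs (of_int k :: 'p::prime_card padic) = 1"
proof -
  have "k \<noteq> 0" using assms by auto
  thus ?thesis using assms
    by (simp add: padic_abs_of_int rat_padic_abs_of_int prime_card not_dvd_imp_multiplicity_0)
qed

text \<open>The power of p dividing k is at most k. This crude comparison of p-adic and real size
  feeds the binomial estimate below.\<close>

lemma padic_abs_of_nat_ge:
  assumes "k > 0"
  shows "padic_abs (of_nat k :: 'p::prime_card padic) \<ge> inverse (real k)"
proof -
  let ?m = "multiplicity (int CARD('p)) (int k)"
  have "int CARD('p) ^ ?m \<le> int k"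
    using assms by (intro zdvd_imp_le multiplicity_dvd) simp
  hence "real_of_int (int CARD('p) ^ ?m) \<le> real_of_int (int k)" by (simp only: of_int_le_iff)
  hence "real CARD('p) ^ ?m \<le> real k" by simp
  moreover have "0 < real CARD('p) ^ ?m" using card_prime_ge_2[where 'p='p] by simp
  ultimately have "inverse (real k) \<le> inverse (real CARD('p) ^ ?m)" by (rule le_imp_inverse_le)
  thus ?thesis using assms rat_padic_abs_of_int[OF prime_card[where 'a='p], of "int k"]
    by (simp add: padic_abs_of_nat)
qed

section \<open>Density of the rationals, completeness, and compactness of balls\<close>

lemma abs_padic_diff: "abs_padic X - abs_padic Y = abs_padic (X - Y)"
  by (simp add: minus_padic_def uminus_padic.abs_eq plus_padic.abs_eq)

lemma padic_of_rat: "of_rat q = (abs_padic (const_padic_seq q) :: 'p::prime_card padic)"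
proof -
  have int: "(of_int k :: 'p padic) = abs_padic (const_padic_seq (of_int k))" for k
  proof (cases k)
    case (nonneg n)
    thus ?thesis by (simp add: padic_of_nat)
  next
    case (neg n)
    have "- const_padic_seq (of_nat (Suc n)) = (const_padic_seq (- of_nat (Suc n)) :: 'p padic_seq)"
      by transfer simp
    thus ?thesis using neg by (simp add: padic_of_nat uminus_padic.abs_eq del: of_nat_Suc)
  qed
  obtain a b :: int where ab: "b \<noteq> 0" "q = of_int a / of_int b" by (rule rat_fracE)
  have "const_padic_seq q * const_padic_seq (of_int b) = (const_padic_seq (of_int a) :: 'p padic_seq)"
    using ab by transfer simp
  hence "abs_padic (const_padic_seq q) * of_int b = (of_int a :: 'p padic)"
    by (simp add: int times_padic.abs_eq)
  thus ?thesis using ab by (simp add: of_rat_divide divide_eq_eq)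
qed

lemma padic_abs_abs_padic_le:
  assumes "\<And>n. n \<ge> N \<Longrightarrow> rat_padic_abs CARD('p) (Rep_padic_seq X n) \<le> e"
  shows "padic_abs (abs_padic X :: 'p::prime_card padic) \<le> e"
  unfolding padic_abs.abs_eq
  by (rule LIMSEQ_le_const2[OF lim_abs_padic_seq_LIMSEQ]) (use assms in blast)

text \<open>A late member of a Cauchy sequence representing x serves as q. The Cauchy bound is taken
  at \<open>e / 2\<close> because the limit only preserves a weak inequality.\<close>

lemma padic_approx_rat:
  fixes x :: "'p::prime_card padic"
  assumes "e > 0"
  obtains q where "padic_abs (x - of_rat q) < e"
proof -
  obtain X where X: "x = abs_padic X" by (induction x rule: padic.abs_induct) blast
  have "padic_cauchy CARD('p) (Rep_padic_seq X)" using Rep_padic_seq[of X] by simp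
  then obtain N where N: "\<And>m n. m \<ge> N \<Longrightarrow> n \<ge> N \<Longrightarrow>
      rat_padic_abs CARD('p) (Rep_padic_seq X m - Rep_padic_seq X n) < e / 2"
    using padic_cauchyD[of "CARD('p)" _ "e / 2"] assms by (metis half_gt_zero)
  have "padic_abs (x - of_rat (Rep_padic_seq X N)) \<le> e / 2"
    unfolding X padic_of_rat abs_padic_diff
    by (rule padic_abs_abs_padic_le[where N=N])
       (use N in \<open>auto simp: minus_padic_seq.rep_eq const_padic_seq.rep_eq intro: less_imp_le\<close>)
  thus ?thesis using that assms by (metis field_sum_of_halves less_add_same_cancel1 half_gt_zero order_le_less_trans)
qed

text \<open>The residues 0, ..., p^k - 1 form a finite net in the unit ball, the source of its
  compactness. An approximating fraction u/v in lowest terms is p-integral, so p does not divide v,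
  and a is u times an inverse of v modulo p^k.\<close>

lemma padic_int_approx:
  fixes x :: "'p::prime_card padic"
  assumes "padic_abs x \<le> 1"
  obtains a where "a < CARD('p) ^ k" "padic_abs (x - of_nat a) \<le> inverse (real CARD('p) ^ k)"
proof -
  let ?p = "int CARD('p)"
  have p0: "inverse (real CARD('p) ^ k) > 0" "?p > 0" by auto
  obtain q where q: "padic_abs (x - of_rat q) < inverse (real CARD('p) ^ k)"
    using padic_approx_rat p0(1) by metis
  have k1: "inverse (real CARD('p) ^ k) \<le> 1"
    using card_prime_ge_2[where 'p='p] by (simp add: inverse_le_1_iff)
  have q1: "padic_abs (of_rat q :: 'p padic) \<le> 1"
    using padic_abs_diff_ultra[of x "x - of_rat q"] assms q k1 by simp
  obtain u v where uv: "quotient_of q = (u, v)" by (cases "quotient_of q")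
  have v: "v > 0" "coprime u v" and quv: "q = of_int u / of_int v"
    using quotient_of_denom_pos[OF uv] quotient_of_coprime[OF uv] quotient_of_div[OF uv] by auto
  have prime: "prime ?p" using prime_card[where 'a='p] by simp
  have "\<not> ?p dvd v"
  proof
    assume dv: "?p dvd v"
    hence "\<not> ?p dvd u" using v(2) prime by (meson coprime_common_divisor not_prime_unit)
    hence "padic_abs (of_int u :: 'p padic) = 1" by (rule padic_abs_of_int_not_dvd)
    moreover have "padic_abs (of_int v :: 'p padic) \<le> inverse (real CARD('p))"
      using padic_abs_of_int_dvd[where 'p='p and m=1] dv by simp
    moreover have "padic_abs (of_int u :: 'p padic) = padic_abs (of_rat q :: 'p padic) * padic_abs (of_int v :: 'p padic)"
      using v(1) by (simp add: quv of_rat_divide flip: padic_abs_mult)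
    ultimately have "1 \<le> padic_abs (of_rat q :: 'p padic) * inverse (real CARD('p))"
      by (metis mult_left_mono padic_abs_nonneg)
    also have "\<dots> \<le> 1 * inverse (real CARD('p))" using q1 by (intro mult_right_mono) auto
    also have "\<dots> < 1" using card_prime_ge_2[where 'p='p] by (simp add: inverse_less_1_iff)
    finally show False by simp
  qed
  hence v1: "padic_abs (of_int v :: 'p padic) = 1" by (rule padic_abs_of_int_not_dvd)
  have "coprime ?p v" using prime \<open>\<not> ?p dvd v\<close> by (rule prime_imp_coprime)
  hence cop: "coprime v (?p ^ k)" by (simp add: coprime_commute)
  obtain w where w: "[v * w = 1] (mod ?p ^ k)" using cop cong_solve_coprime_int by blast
  define a where "a = (u * w) mod ?p ^ k"
  have a: "0 \<le> a" "a < ?p ^ k" using p0 by (auto simp: a_def)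
  have "[v * a = v * (u * w)] (mod ?p ^ k)" by (auto simp: a_def cong_def mod_mult_right_eq)
  also have "v * (u * w) = u * (v * w)" by simp
  also have "[u * (v * w) = u * 1] (mod ?p ^ k)" by (intro cong_mult w cong_refl)
  finally have "?p ^ k dvd u - v * a" by (simp add: cong_iff_dvd_diff dvd_diff_commute)
  hence *: "padic_abs (of_int (u - v * a) :: 'p padic) \<le> inverse (real CARD('p) ^ k)"
    by (rule padic_abs_of_int_dvd)
  have "of_rat q - of_int a = of_int (u - v * a) / (of_int v :: 'p padic)"
    using v(1) by (simp add: quv of_rat_divide field_simps)
  hence "padic_abs (of_rat q - of_int a :: 'p padic) \<le> inverse (real CARD('p) ^ k)"
    using * v1 by (simp only: padic_abs_divide div_by_1)
  hence "padic_abs (x - of_int a) \<le> inverse (real CARD('p) ^ k)"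
    using padic_abs_ultra[of "x - of_rat q" "of_rat q - of_int a"] q by simp
  moreover have "of_nat (nat a) = (of_int a :: 'p padic)"
    using a(1) by (metis int_nat_eq of_int_of_nat_eq)
  moreover have "nat a < CARD('p) ^ k"
    using a by (metis nat_less_iff of_nat_power)
  ultimately show ?thesis using that[of "nat a"] by metis
qed

text \<open>Each \<open>f n\<close> is replaced by a rational within 1/(n + 1) of it. These
  rationals form a p-adic Cauchy sequence, and its class is the limit of \<open>f\<close>.\<close>

lemma complete_padic: "complete (UNIV :: 'p::prime_card padic set)"
proof (rule completeI)
  fix f :: "nat \<Rightarrow> 'p padic" assume "Cauchy f"
  have "\<exists>q. padic_abs (f n - of_rat q) < inverse (real (Suc n))" for n
    by (rule padic_approx_rat[of "inverse (real (Suc n))" "f n"]) auto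
  then obtain q where q: "\<And>n. padic_abs (f n - of_rat (q n)) < inverse (real (Suc n))" by metis
  have small: "\<exists>N. \<forall>n\<ge>N. padic_abs (f n - of_rat (q n)) < e" if "e > 0" for e
  proof -
    obtain N where N: "inverse (real (Suc N)) < e" using reals_Archimedean \<open>e > 0\<close> by blast
    have "padic_abs (f n - of_rat (q n)) < e" if "n \<ge> N" for n
      using N q[of n] that le_imp_inverse_le[of "real (Suc N)" "real (Suc n)"] by linarith
    thus ?thesis by blast
  qed
  have cauchy: "padic_cauchy CARD('p) q"
    unfolding padic_cauchy_def
  proof (intro allI impI)
    fix e :: real assume e: "e > 0"
    obtain M where M: "\<And>m n. m \<ge> M \<Longrightarrow> n \<ge> M \<Longrightarrow> padic_abs (f m - f n) < e"
      using \<open>Cauchy f\<close> e unfolding Cauchy_def dist_padic_def by blast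
    obtain N where N: "\<And>n. n \<ge> N \<Longrightarrow> padic_abs (f n - of_rat (q n)) < e" using small e by blast
    have "rat_padic_abs CARD('p) (q m - q n) < e" if "m \<ge> max M N" "n \<ge> max M N" for m n
    proof -
      have "of_rat (q m - q n) = (of_rat (q m) - f m) + ((f m - f n) + (f n - of_rat (q n)))"
        by (simp add: of_rat_diff)
      hence "padic_abs (of_rat (q m - q n) :: 'p padic) \<le>
          max (padic_abs (of_rat (q m) - f m)) (max (padic_abs (f m - f n)) (padic_abs (f n - of_rat (q n))))"
        using padic_abs_ultra[of "of_rat (q m) - f m" "(f m - f n) + (f n - of_rat (q n))"]
          padic_abs_ultra[of "f m - f n" "f n - of_rat (q n)"]
        by (auto simp: le_max_iff_disj)
      also have "\<dots> < e" using M[of m n] N[of m] N[of n] that by (simp add: padic_abs_minus_commute)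
      finally show ?thesis by (simp add: padic_abs_of_rat)
    qed
    thus "\<exists>N. \<forall>m\<ge>N. \<forall>n\<ge>N. rat_padic_abs CARD('p) (q m - q n) < e" by blast
  qed
  define l where "l = (abs_padic (Abs_padic_seq q) :: 'p padic)"
  have rep: "Rep_padic_seq (Abs_padic_seq q :: 'p padic_seq) = q"
    using cauchy by (simp add: Abs_padic_seq_inverse)
  have "f \<longlonglongrightarrow> l"
    unfolding lim_sequentially dist_padic_def
  proof (intro allI impI)
    fix e :: real assume e: "e > 0"
    obtain M where M: "\<And>m n. m \<ge> M \<Longrightarrow> n \<ge> M \<Longrightarrow> rat_padic_abs CARD('p) (q m - q n) < e / 2"
      using padic_cauchyD[OF cauchy, of "e / 2"] e by (metis half_gt_zero)
    obtain N where N: "\<And>n. n \<ge> N \<Longrightarrow> padic_abs (f n - of_rat (q n)) < e" using small e by blast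
    have "padic_abs (f n - l) < e" if n: "n \<ge> max M N" for n
    proof -
      have "padic_abs (l - of_rat (q n)) \<le> e / 2"
        unfolding l_def padic_of_rat abs_padic_diff
        by (rule padic_abs_abs_padic_le[where N=M])
           (use M n in \<open>auto simp: minus_padic_seq.rep_eq const_padic_seq.rep_eq rep intro: less_imp_le\<close>)
      hence "padic_abs (of_rat (q n) - l) < e" using e by (simp add: padic_abs_minus_commute)
      thus ?thesis using padic_abs_ultra[of "f n - of_rat (q n)" "of_rat (q n) - l"] N[of n] n by simp
    qed
    thus "\<exists>N. \<forall>n\<ge>N. padic_abs (f n - l) < e" by blast
  qed
  thus "\<exists>l\<in>UNIV. f \<longlonglongrightarrow> l" by blast
qed

instance padic :: (prime_card) topological_ab_group_add
proof
  fix a b :: "'a padic"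
  show "LIM x (nhds a \<times>\<^sub>F nhds b). fst x + snd x :> nhds (a + b)"
  proof (rule tendstoI)
    fix e :: real assume e: "e > 0"
    have "eventually (\<lambda>x. dist x a < e) (nhds a)" "eventually (\<lambda>x. dist x b < e) (nhds b)"
      using e by (auto simp: eventually_nhds_metric)
    hence "eventually (\<lambda>x. dist (fst x) a < e \<and> dist (snd x) b < e) (nhds a \<times>\<^sub>F nhds b)"
      unfolding eventually_prod_filter by auto
    thus "eventually (\<lambda>x. dist (fst x + snd x) (a + b) < e) (nhds a \<times>\<^sub>F nhds b)"
    proof (rule eventually_mono)
      fix x assume "dist (fst x) a < e \<and> dist (snd x) b < e"
      thus "dist (fst x + snd x) (a + b) < e"
        using padic_abs_ultra[of "fst x - a" "snd x - b"]
        by (simp add: dist_padic_def add_diff_add) (meson max_less_iff_conj order_le_less_trans)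
    qed
  qed
  show "(uminus \<longlongrightarrow> - a) (nhds a)"
  proof (rule tendstoI)
    fix e :: real assume e: "e > 0"
    have "dist (- x) (- a) = dist x a" for x
      using padic_abs_minus[of "x - a"] by (simp add: dist_padic_def)
    thus "eventually (\<lambda>x. dist (- x) (- a) < e) (nhds a)"
      using e by (auto simp: eventually_nhds_metric)
  qed
qed

instance padic :: (prime_card) topological_comm_monoid_mult
proof
  fix a b :: "'a padic"
  show "LIM x (nhds a \<times>\<^sub>F nhds b). fst x * snd x :> nhds (a * b)"
  proof (rule tendstoI)
    fix e :: real assume e: "e > 0"
    \<comment> \<open>Chosen so that the three error terms u v, a v and u b add up to less than d (1
      + |a| + |b|) \<le> e; the bound d \<le> 1 takes care of u v.\<close>
    define d where "d = min 1 (e / (1 + padic_abs a + padic_abs b))"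
    have pos: "1 + padic_abs a + padic_abs b > 0"
      using padic_abs_nonneg[of a] padic_abs_nonneg[of b] by linarith
    have d: "d > 0" "d \<le> 1" using e pos by (auto simp: d_def)
    have "d * (1 + padic_abs a + padic_abs b) \<le> e / (1 + padic_abs a + padic_abs b) * (1 + padic_abs a + padic_abs b)"
      using pos by (intro mult_right_mono) (auto simp: d_def)
    hence de: "d * (1 + padic_abs a + padic_abs b) \<le> e" using pos by simp
    have "eventually (\<lambda>x. dist x a < d) (nhds a)" "eventually (\<lambda>x. dist x b < d) (nhds b)"
      using d by (auto simp: eventually_nhds_metric)
    hence "eventually (\<lambda>x. dist (fst x) a < d \<and> dist (snd x) b < d) (nhds a \<times>\<^sub>F nhds b)"
      unfolding eventually_prod_filter by auto
    thus "eventually (\<lambda>x. dist (fst x * snd x) (a * b) < e) (nhds a \<times>\<^sub>F nhds b)"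
    proof (rule eventually_mono)
      fix x assume x: "dist (fst x) a < d \<and> dist (snd x) b < d"
      let ?u = "fst x - a" and ?v = "snd x - b"
      have u: "padic_abs ?u < d" and v: "padic_abs ?v < d" using x by (auto simp: dist_padic_def)
      have "fst x * snd x - a * b = ?u * ?v + (a * ?v + ?u * b)" by (simp add: algebra_simps)
      hence "dist (fst x * snd x) (a * b) \<le> padic_abs (?u * ?v) + (padic_abs (a * ?v) + padic_abs (?u * b))"
        using padic_abs_triangle[of "?u * ?v" "a * ?v + ?u * b"] padic_abs_triangle[of "a * ?v" "?u * b"]
        by (simp add: dist_padic_def)
      also have "\<dots> = padic_abs ?u * padic_abs ?v + (padic_abs a * padic_abs ?v + padic_abs ?u * padic_abs b)"
        by (simp add: padic_abs_mult)
      also have "\<dots> < d * 1 + (padic_abs a * d + d * padic_abs b)"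
        using u v d by (intro add_less_le_mono mult_strict_mono' add_mono mult_left_mono mult_right_mono) auto
      also have "\<dots> = d * (1 + padic_abs a + padic_abs b)" by (simp add: algebra_simps)
      finally show "dist (fst x * snd x) (a * b) < e" using de by simp
    qed
  qed
qed

text \<open>By the isosceles principle \<open>padic_abs\<close> is locally constant away from
  0.\<close>

lemma closed_padic_cball: "closed {x :: 'p::prime_card padic. padic_abs x \<le> R}"
  unfolding closed_sequential_limits
proof safe
  fix x :: "nat \<Rightarrow> 'p padic" and l
  assume x: "\<forall>n. x n \<in> {x. padic_abs x \<le> R}" and l: "x \<longlonglongrightarrow> l"
  show "padic_abs l \<le> R"
  proof (cases "l = 0")
    case True
    thus ?thesis using x padic_abs_nonneg[of "x 0"] by (metis mem_Collect_eq order_trans padic_abs_zero)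
  next
    case False
    hence "padic_abs l > 0" by (simp add: less_le)
    then obtain n where "padic_abs (x n - l) < padic_abs l" using l by (force simp: lim_sequentially dist_padic_def)
    hence "padic_abs (x n) = padic_abs l" by (metis padic_abs_eqI padic_abs_minus_commute)
    thus ?thesis using x by (metis mem_Collect_eq)
  qed
qed

lemma compact_padic_ball: "compact {x :: 'p::prime_card padic. padic_abs x \<le> 1}"
  unfolding compact_eq_totally_bounded
proof (intro conjI allI impI)
  show "complete {x :: 'p padic. padic_abs x \<le> 1}"
    using complete_Int_closed[OF complete_padic closed_padic_cball] by simp
  fix e :: real assume e: "e > 0"
  have "inverse (real CARD('p)) < 1" using card_prime_ge_2[where 'p='p] by (simp add: inverse_less_1_iff)
  then obtain k where k: "inverse (real CARD('p)) ^ k < e"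
    using real_arch_pow_inv[OF e] by blast
  show "\<exists>k. finite k \<and> {x :: 'p padic. padic_abs x \<le> 1} \<subseteq> (\<Union>x\<in>k. ball x e)"
  proof (intro exI conjI subsetI)
    show "finite ((of_nat :: nat \<Rightarrow> 'p padic) ` {..<CARD('p) ^ k})" by simp
    fix x :: "'p padic" assume "x \<in> {x. padic_abs x \<le> 1}"
    then obtain a where "a < CARD('p) ^ k" "padic_abs (x - of_nat a) \<le> inverse (real CARD('p) ^ k)"
      using padic_int_approx by blast
    thus "x \<in> (\<Union>x\<in>(of_nat :: nat \<Rightarrow> 'p padic) ` {..<CARD('p) ^ k}. ball x e)"
      using k by (force simp: dist_padic_def power_inverse padic_abs_minus_commute[of _ x])
  qed
qed

text \<open>Multiplication by p^(-k), where p^k > R, maps the unit ball to a compact set that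
  contains the given closed ball.\<close>

lemma compact_padic_cball: "compact {x :: 'p::prime_card padic. padic_abs x \<le> R}"
proof -
  have "real CARD('p) > 1" using card_prime_ge_2[where 'p='p] by linarith
  then obtain k where k: "R < real CARD('p) ^ k" using real_arch_pow by blast
  define c where "c = (of_nat CARD('p) ^ k :: 'p padic)"
  have c: "padic_abs c = inverse (real CARD('p) ^ k)"
    by (simp only: c_def padic_abs_power padic_abs_of_nat_self power_inverse)
  have c0: "c \<noteq> 0" by (simp add: c_def)
  have "continuous_on UNIV (\<lambda>x. inverse c * x)"
    unfolding continuous_on_def by (auto intro!: tendsto_intros)
  hence "compact ((\<lambda>x. inverse c * x) ` {x. padic_abs x \<le> 1})"
    by (rule compact_continuous_image[OF continuous_on_subset compact_padic_ball]) simp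
  moreover have sub: "{x :: 'p padic. padic_abs x \<le> R} \<subseteq> (\<lambda>x. inverse c * x) ` {x. padic_abs x \<le> 1}"
  proof
    fix x :: "'p padic" assume "x \<in> {x. padic_abs x \<le> R}"
    hence "padic_abs x \<le> real CARD('p) ^ k" using k by simp
    hence "padic_abs (c * x) \<le> inverse (real CARD('p) ^ k) * real CARD('p) ^ k"
      unfolding padic_abs_mult c by (intro mult_left_mono) auto
    also have "\<dots> = 1" by simp
    finally show "x \<in> (\<lambda>x. inverse c * x) ` {x. padic_abs x \<le> 1}"
      using c0 by (intro image_eqI[of _ _ "c * x"]) auto
  qed
  ultimately show ?thesis
    using compact_Int_closed[OF _ closed_padic_cball, of _ R] inf.absorb2[OF sub] by metis
qed

subsection \<open>Roots of unity\<close>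

text \<open>The origin of the constant 1/3 below: with 2 in place of 3 the case k = 2 would be an
  equality. Elements at distance 1/2 from 1, which occur for p = 2, therefore escape the
  estimate.\<close>

lemma of_nat_less_power_3: "2 \<le> k \<Longrightarrow> real k < 3 ^ (k - 1)"
proof (induction k rule: dec_induct)
  case (step k)
  thus ?case by (cases k) auto
qed simp

text \<open>From k C(n,k) = n C(n-1,k-1), with |k| bounded below by 1/k. The real factor k is
  harmless because it is later set against 3^(k-1).\<close>

lemma padic_abs_binomial_le:
  assumes "0 < k"
  shows "padic_abs (of_nat (n choose k) :: 'p::prime_card padic) \<le> real k * padic_abs (of_nat n :: 'p padic)"
proof -
  let ?abs = "\<lambda>m. padic_abs (of_nat m :: 'p padic)"
  have "?abs k * ?abs (n choose k) = ?abs n * ?abs ((n - 1) choose (k - 1))"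
    using times_binomial_minus1_eq[OF assms, of n] by (simp only: padic_abs_mult[symmetric] of_nat_mult[symmetric])
  also have "\<dots> \<le> ?abs n * 1" by (intro mult_left_mono padic_abs_of_nat_le_1) auto
  finally have *: "?abs k * ?abs (n choose k) \<le> ?abs n" by simp
  have "inverse (real k) * ?abs (n choose k) \<le> ?abs k * ?abs (n choose k)"
    using assms by (intro mult_right_mono padic_abs_of_nat_ge) auto
  hence "inverse (real k) * ?abs (n choose k) \<le> ?abs n" using * by simp
  thus ?thesis using assms by (simp add: field_simps)
qed

text \<open>The linear term n x strictly dominates every later term of the binomial expansion, so
  the isosceles principle gives the size of the whole. As |n| is nonzero, 1 + x can be a root of
  unity only for x = 0.\<close>

lemma padic_abs_one_plus_power:
  fixes x :: "'p::prime_card padic"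
  assumes x: "padic_abs x \<le> 1 / 3" and n: "n > 0"
  shows "padic_abs ((1 + x) ^ n - 1) = padic_abs (of_nat n :: 'p padic) * padic_abs x"
proof (cases "x = 0")
  case False
  define c where "c = padic_abs (of_nat n * x)"
  have c: "c > 0" using n False padic_abs_nonneg[of "of_nat n * x"] padic_abs_eq_0_iff[of "of_nat n * x"]
    unfolding c_def by (metis mult_eq_0_iff of_nat_eq_0_iff order_le_less not_gr_zero)
  have "(1 + x) ^ n = (\<Sum>k\<le>n. of_nat (n choose k) * x ^ k)"
    using binomial_ring[of x 1 n] by (simp add: add.commute)
  also have "{..n} = insert 0 (insert 1 {2..n})" using n by auto
  finally have "(1 + x) ^ n - 1 = of_nat n * x + (\<Sum>k\<in>{2..n}. of_nat (n choose k) * x ^ k)"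
    by simp
  hence "of_nat n * x - ((1 + x) ^ n - 1) = - (\<Sum>k\<in>{2..n}. of_nat (n choose k) * x ^ k)" by simp
  moreover have "padic_abs (\<Sum>k\<in>{2..n}. of_nat (n choose k) * x ^ k) < c"
  proof (rule padic_abs_sum_less)
    fix k assume k: "k \<in> {2..n}"
    obtain j where j: "k = Suc j" using k by (cases k) auto
    have "padic_abs (of_nat (n choose k) * x ^ k) =
        padic_abs (of_nat (n choose k) :: 'p padic) * padic_abs x * padic_abs x ^ j"
      by (simp add: j padic_abs_mult padic_abs_power)
    also have "\<dots> \<le> (real k * padic_abs (of_nat n :: 'p padic)) * padic_abs x * (1 / 3) ^ j"
      using k x by (intro mult_mono padic_abs_binomial_le power_mono) auto
    also have "\<dots> = real k * (1 / 3) ^ j * c" by (simp add: c_def padic_abs_mult)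
    also have "real k * (1 / 3) ^ j < 1"
      using of_nat_less_power_3[of k] k j by (simp add: power_one_over)
    hence "real k * (1 / 3) ^ j * c < 1 * c" using c by (intro mult_strict_right_mono) auto
    finally show "padic_abs (of_nat (n choose k) * x ^ k) < c" by simp
  qed (use c in auto)
  ultimately have "padic_abs (of_nat n * x - ((1 + x) ^ n - 1)) < padic_abs (of_nat n * x)"
    by (simp add: c_def)
  hence "padic_abs ((1 + x) ^ n - 1) = padic_abs (of_nat n * x)" by (rule padic_abs_eqI)
  thus ?thesis by (simp add: padic_abs_mult)
qed simp

lemma root_of_unity_near_1:
  fixes c :: "'p::prime_card padic"
  assumes "c ^ n = 1" "n > 0" "padic_abs (c - 1) \<le> 1 / 3"
  shows "c = 1"
  using padic_abs_one_plus_power[OF assms(3,2)] assms(1,2) by simp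

lemma padic_abs_power_diff_le:
  fixes x y :: "'p::prime_card padic"
  assumes "padic_abs x \<le> 1" "padic_abs y \<le> 1"
  shows "padic_abs (x ^ m - y ^ m) \<le> padic_abs (x - y)"
proof (induction m)
  case (Suc m)
  have "x ^ Suc m - y ^ Suc m = x * (x ^ m - y ^ m) + (x - y) * y ^ m" by (simp add: algebra_simps)
  moreover have "padic_abs (x * (x ^ m - y ^ m)) \<le> 1 * padic_abs (x - y)"
    unfolding padic_abs_mult using assms Suc by (intro mult_mono) auto
  moreover have "padic_abs ((x - y) * y ^ m) \<le> padic_abs (x - y) * 1"
    unfolding padic_abs_mult padic_abs_power using assms by (intro mult_left_mono power_le_one) auto
  ultimately show ?case using padic_abs_ultra[of "x * (x ^ m - y ^ m)" "(x - y) * y ^ m"] by simp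
qed simp

text \<open>
  The order of the residue of \<open>c\<close> divides both \<open>n\<close> and \<open>p - 1\<close>, so \<open>c \<equiv> 1\<close> modulo \<open>p\<close>; for
  \<open>p = 2\<close> this estimate is too weak for the preceding lemma and \<open>c\<^sup>2\<close> is used instead.
\<close>
lemma padic_root_of_unity_coprime:
  fixes c :: "'p::prime_card padic"
  assumes c: "c ^ n = 1" and n: "n > 0" and cop: "coprime n (CARD('p) - 1)"
  shows "c = 1 \<or> c = - 1"
proof -
  let ?p = "CARD('p)"
  have p: "prime ?p" "?p \<ge> 2" using prime_card[where 'a='p] prime_ge_2_nat by auto
  have "padic_abs c ^ n = 1" using c by (simp flip: padic_abs_power)
  hence c1: "padic_abs c = 1" using n by (metis padic_abs_nonneg power_eq_1_iff neq0_conv abs_of_nonneg real_norm_def)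
  obtain a where a: "padic_abs (c - of_nat a) \<le> inverse (real ?p)"
    using padic_int_approx[of c 1] c1 by auto
  have ip: "inverse (real ?p) \<le> 1 / 2" using p by (simp add: field_simps)
  have "\<not> ?p dvd a"
  proof
    assume "?p dvd a"
    hence "padic_abs (of_nat a :: 'p padic) \<le> inverse (real ?p)"
      using padic_abs_of_int_dvd[where 'p='p, of 1 "int a"] by simp
    thus False using padic_abs_ultra[of "c - of_nat a" "of_nat a"] a c1 ip by simp
  qed
  \<comment> \<open>The integer a represents the residue of the unit c. Fermat's theorem for a
    transfers to c because taking powers does not increase distances in the unit ball.\<close>
  hence "[a ^ (?p - 1) = 1] (mod ?p)" by (rule fermat_theorem[OF p(1)])
  hence "[int (a ^ (?p - 1)) = int 1] (mod int ?p)" by (simp only: cong_int_iff)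
  hence "int ?p ^ 1 dvd int (a ^ (?p - 1)) - 1" by (simp add: cong_iff_dvd_diff)
  hence "padic_abs (of_int (int (a ^ (?p - 1)) - 1) :: 'p padic) \<le> inverse (real ?p ^ 1)"
    by (rule padic_abs_of_int_dvd)
  hence "padic_abs (of_nat a ^ (?p - 1) - 1 :: 'p padic) \<le> inverse (real ?p)" by simp
  moreover have "padic_abs (c ^ (?p - 1) - of_nat a ^ (?p - 1)) \<le> inverse (real ?p)"
    using padic_abs_power_diff_le[of c "of_nat a" "?p - 1"] c1 a padic_abs_of_nat_le_1[of a, where 'p='p] by simp
  ultimately have w: "padic_abs (c ^ (?p - 1) - 1) \<le> inverse (real ?p)"
    using padic_abs_ultra[of "c ^ (?p - 1) - of_nat a ^ (?p - 1)" "of_nat a ^ (?p - 1) - 1"] by simp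
  \<comment> \<open>Bezout: since c^n = 1, the element c equals (c^(p-1))^x. Closeness to 1 thus
    passes from c^(p-1) back to c.\<close>
  obtain x y where "(?p - 1) * x = n * y + gcd (?p - 1) n" using bezout_nat[of "?p - 1" n] p by auto
  hence "(?p - 1) * x = n * y + 1" using cop by (simp add: gcd.commute)
  hence "(c ^ (?p - 1)) ^ x = c" using c by (metis mult_1 power_add power_mult power_one power_one_right)
  hence "padic_abs (c - 1) \<le> padic_abs (c ^ (?p - 1) - 1)"
    using padic_abs_power_diff_le[of "c ^ (?p - 1)" 1 x] c1 by (simp add: padic_abs_power)
  hence near: "padic_abs (c - 1) \<le> inverse (real ?p)" using w by simp
  show ?thesis
  proof (cases "?p = 2")
    case False
    hence "inverse (real ?p) \<le> 1 / 3" using p by (simp add: field_simps)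
    thus ?thesis using root_of_unity_near_1[OF c n] near by simp
  next
    case True
    have two: "padic_abs (2 :: 'p padic) = 1 / 2"
      using padic_abs_of_nat_self[where 'p='p] True by simp
    \<comment> \<open>Both factors of c^2 - 1 are at most 1/2, so c^2 is within 1/4 of 1, inside the
      range where roots of unity are trivial.\<close>
    have "padic_abs (c + 1) \<le> 1 / 2"
      using padic_abs_ultra[of "c - 1" 2] near two True by (simp add: add.commute[of c 1])
    hence "padic_abs (c - 1) * padic_abs (c + 1) \<le> 1 / 2 * (1 / 2)"
      using near True by (intro mult_mono) auto
    moreover have "c ^ 2 - 1 = (c - 1) * (c + 1)" by (simp add: power2_eq_square algebra_simps)
    ultimately have "padic_abs (c ^ 2 - 1) \<le> 1 / 3" by (simp add: padic_abs_mult)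
    moreover have "(c ^ 2) ^ n = 1" using c by (metis power_mult mult.commute power_one)
    ultimately have "c ^ 2 = 1" using root_of_unity_near_1 n by blast
    thus ?thesis by (simp add: power2_eq_1_iff)
  qed
qed

lemma padic_abs_of_nat_cong:
  assumes "[a = b] (mod CARD('p) ^ m)"
  shows "padic_abs (of_nat a - of_nat b :: 'p::prime_card padic) \<le> inverse (real CARD('p) ^ m)"
proof -
  have "[int a = int b] (mod int (CARD('p) ^ m))" using assms by (simp only: cong_int_iff)
  hence "int CARD('p) ^ m dvd int a - int b" by (simp add: cong_iff_dvd_diff)
  from padic_abs_of_int_dvd[OF this] show ?thesis by simp
qed

lemma padic_abs_of_nat_not_cong:
  assumes "\<not> [a = b] (mod CARD('p))"
  shows "padic_abs (of_nat a - of_nat b :: 'p::prime_card padic) = 1"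
proof -
  have "\<not> [int a = int b] (mod int CARD('p))" using assms unfolding cong_int_iff .
  hence "\<not> int CARD('p) dvd int a - int b" by (simp add: cong_iff_dvd_diff)
  from padic_abs_of_int_not_dvd[OF this] show ?thesis by simp
qed

text \<open>
  The root of unity is a limit point of \<open>a\<^bsup>p\<^sup>k\<^esup>\<close>, where \<open>a\<close> has order \<open>q\<close> modulo \<open>p\<close>:
  the Teichmueller representative of \<open>a\<close>.
\<close>
lemma padic_root_of_unity_exists:
  assumes q: "q dvd CARD('p) - 1" "q > 1"
  obtains z :: "'p::prime_card padic" where "z ^ q = 1" "z \<noteq> 1"
proof -
  let ?p = "CARD('p)"
  have p: "prime ?p" "?p > 1" using prime_card[where 'a='p] prime_gt_1_nat by auto
  obtain g where "residue_primroot ?p g" using prime_primitive_root_exists[OF p(2,1)] by blast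
  hence g: "coprime g ?p" "ord ?p g = ?p - 1"
    using p by (auto simp: residue_primroot_def totient_prime coprime_commute)
  \<comment> \<open>The element of order q modulo p is g^r, for g a primitive root.\<close>
  define r where "r = (?p - 1) div q"
  have rq: "r * q = ?p - 1" using q by (simp add: r_def)
  define x where "x = (\<lambda>k. of_nat (g ^ (r * ?p ^ k)) :: 'p padic)"
  have xq: "padic_abs (x k ^ q - 1) \<le> inverse (real ?p ^ Suc k)" for k
  proof -
    have "coprime g (?p ^ Suc k)" using g by simp
    hence "[g ^ totient (?p ^ Suc k) = 1] (mod ?p ^ Suc k)" by (rule euler_theorem)
    \<comment> \<open>The totient (p - 1) p^k is exactly the exponent of g in the q-th power of
      \<open>x k\<close>, so Euler's theorem makes that power congruent to 1 modulo p^(k+1).\<close>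
    also have "totient (?p ^ Suc k) = r * ?p ^ k * q"
      using totient_prime_power_Suc[OF p(1), of k] rq by (simp add: mult_ac)
    finally have "[(g ^ (r * ?p ^ k)) ^ q = 1] (mod ?p ^ Suc k)" by (simp add: power_mult)
    from padic_abs_of_nat_cong[OF this] show ?thesis by (simp add: x_def)
  qed
  \<comment> \<open>This keeps the limit away from 1: p^k is prime to q, so \<open>x k\<close> stays
    incongruent to 1 modulo p.\<close>
  have x1: "padic_abs (x k - 1) = 1" for k
  proof -
    have "\<not> [g ^ (r * ?p ^ k) = 1] (mod ?p)"
    proof
      assume "[g ^ (r * ?p ^ k) = 1] (mod ?p)"
      hence "?p - 1 dvd r * ?p ^ k" using ord_divides g by metis
      hence "r * q dvd r * ?p ^ k" by (simp add: rq)
      moreover have "r \<noteq> 0" using rq p(2) by (cases r) auto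
      ultimately have "q dvd ?p ^ k" by simp
      moreover have "coprime (?p - 1) ?p" using coprime_diff_one_left_nat[of ?p] p(2) by simp
      hence "coprime q (?p ^ k)" using coprime_divisors[OF q(1) dvd_refl] by simp
      ultimately have "q = 1" by (metis coprime_absorb_left nat_dvd_1_iff_1)
      thus False using q by simp
    qed
    from padic_abs_of_nat_not_cong[OF this] show ?thesis by (simp add: x_def)
  qed
  have "seq_compact {x :: 'p padic. padic_abs x \<le> 1}"
    by (rule compact_imp_seq_compact[OF compact_padic_ball])
  moreover have "\<And>k. x k \<in> {x. padic_abs x \<le> 1}"
    using padic_abs_of_nat_le_1 unfolding x_def by blast
  ultimately obtain z s where z: "strict_mono (s :: nat \<Rightarrow> nat)" "(x \<circ> s) \<longlonglongrightarrow> z"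
    using seq_compactE[of _ x] by blast
  have "padic_abs (z ^ q - 1) \<le> 0"
  proof (rule field_le_epsilon)
    fix e :: real assume e: "e > 0"
    have "(\<lambda>k. (x \<circ> s) k ^ q) \<longlonglongrightarrow> z ^ q" by (intro tendsto_power_strong z tendsto_const)
    then obtain M where M: "\<And>k. k \<ge> M \<Longrightarrow> padic_abs (x (s k) ^ q - z ^ q) < e"
      using e unfolding lim_sequentially dist_padic_def by (metis comp_apply)
    have "inverse (real ?p) < 1" using p by (simp add: inverse_less_1_iff)
    then obtain K where K: "inverse (real ?p) ^ K < e" using real_arch_pow_inv[OF e] by blast
    define k where "k = max M K"
    have "K \<le> Suc (s k)" using seq_suble[OF z(1), of k] by (simp add: k_def)
    hence "inverse (real ?p) ^ Suc (s k) \<le> inverse (real ?p) ^ K"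
      using p by (intro power_decreasing) (auto simp: inverse_le_1_iff)
    hence "padic_abs (x (s k) ^ q - 1) < e" using xq[of "s k"] K by (simp add: power_inverse)
    moreover have "padic_abs (x (s k) ^ q - z ^ q) < e" using M by (simp add: k_def)
    ultimately show "padic_abs (z ^ q - 1) \<le> 0 + e"
      using padic_abs_diff_ultra[of "x (s k) ^ q - 1" "x (s k) ^ q - z ^ q"] by simp
  qed
  hence "z ^ q = 1" using padic_abs_nonneg[of "z ^ q - 1"] padic_abs_eq_0_iff[of "z ^ q - 1"] by simp
  moreover have "z \<noteq> 1"
  proof
    assume "z = 1"
    obtain k where "padic_abs ((x \<circ> s) k - z) < 1"
      using z(2)[unfolded lim_sequentially dist_padic_def, rule_format, of 1] by auto
    hence "padic_abs (x (s k) - 1) < 1" using \<open>z = 1\<close> by simp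
    thus False using x1 by simp
  qed
  ultimately show ?thesis using that by blast
qed

section \<open>Elementary matrices\<close>

lemma SL_carrier_iff:
  "A \<in> carrier (SL n F) \<longleftrightarrow> A \<in> carrier_mat n n \<and> (\<forall>i<n. \<forall>j<n. A $$ (i, j) \<in> F) \<and> det A = 1"
  by (simp add: SL_def)

lemma SL_mult [simp]: "A \<otimes>\<^bsub>SL n F\<^esub> B = A * B"
  by (simp add: SL_def)

lemma SL_one [simp]: "\<one>\<^bsub>SL n F\<^esub> = 1\<^sub>m n"
  by (simp add: SL_def)

lemma SL_carrier_mat: "A \<in> carrier (SL n F) \<Longrightarrow> A \<in> carrier_mat n n"
  by (simp add: SL_def)

lemma SL_mono: "F \<subseteq> K \<Longrightarrow> carrier (SL n F) \<subseteq> carrier (SL n K)"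
  by (auto simp: SL_carrier_iff subset_iff)

lemma is_subfield_UNIV: "is_subfield (UNIV :: 'a::field set)"
  by (simp add: is_subfield_def)

lemma is_subfield_Rats: "is_subfield (\<rat> :: 'a::field_char_0 set)"
  by (auto simp: is_subfield_def)

context
  fixes F :: "'a::field set"
  assumes F: "is_subfield F"
begin

lemma subfield_0: "0 \<in> F" and subfield_1: "1 \<in> F"
  and subfield_add: "x \<in> F \<Longrightarrow> y \<in> F \<Longrightarrow> x + y \<in> F"
  and subfield_mult: "x \<in> F \<Longrightarrow> y \<in> F \<Longrightarrow> x * y \<in> F"
  and subfield_minus: "x \<in> F \<Longrightarrow> - x \<in> F"
  and subfield_inverse: "x \<in> F \<Longrightarrow> inverse x \<in> F"
  using F by (auto simp: is_subfield_def)

lemma subfield_diff: "x \<in> F \<Longrightarrow> y \<in> F \<Longrightarrow> x - y \<in> F"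
  using subfield_add[of x "- y"] subfield_minus[of y] by simp

lemma subfield_divide: "x \<in> F \<Longrightarrow> y \<in> F \<Longrightarrow> x / y \<in> F"
  using subfield_mult[of x "inverse y"] subfield_inverse[of y] by (simp add: divide_inverse)

lemma subfield_sum: "(\<And>i. i \<in> I \<Longrightarrow> f i \<in> F) \<Longrightarrow> sum f I \<in> F"
  by (induction I rule: infinite_finite_induct) (auto intro: subfield_0 subfield_add)

lemma subfield_prod: "(\<And>i. i \<in> I \<Longrightarrow> f i \<in> F) \<Longrightarrow> prod f I \<in> F"
  by (induction I rule: infinite_finite_induct) (auto intro: subfield_1 subfield_mult)

lemma subfield_of_nat: "of_nat n \<in> F"
  by (induction n) (auto intro: subfield_0 subfield_1 subfield_add)

lemma subfield_signof: "signof p \<in> F"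
  using subfield_1 subfield_minus[OF subfield_1] by (auto simp: sign_def)

lemma subfield_det:
  assumes "A \<in> carrier_mat n n" "\<And>i j. i < n \<Longrightarrow> j < n \<Longrightarrow> A $$ (i, j) \<in> F"
  shows "det A \<in> F"
  unfolding det_def'[OF assms(1)]
proof (intro subfield_sum subfield_mult subfield_signof subfield_prod assms)
  fix p i assume "p \<in> {p. p permutes {0..<n}}" "i \<in> {0..<n}"
  thus "p i < n" using permutes_in_image[of p "{0..<n}" i] by simp
qed auto

lemma subfield_cofactor:
  assumes "A \<in> carrier_mat n n" "\<And>i j. i < n \<Longrightarrow> j < n \<Longrightarrow> A $$ (i, j) \<in> F" "i < n" "j < n"
  shows "cofactor A i j \<in> F"
proof -
  have *: "mat_delete A i j \<in> carrier_mat (n - 1) (n - 1)" using assms(1) by (simp add: mat_delete_def)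
  have "det (mat_delete A i j) \<in> F"
  proof (rule subfield_det[OF *])
    fix a b assume ab: "a < n - 1" "b < n - 1"
    hence "mat_delete A i j $$ (a, b) = A $$ (if a < i then a else Suc a, if b < j then b else Suc b)"
      using assms(1) by (simp add: mat_delete_def)
    thus "mat_delete A i j $$ (a, b) \<in> F"
      using ab by (simp add: assms(2))
  qed
  moreover have "(- 1) ^ (i + j) \<in> F"
    using subfield_1 subfield_minus[OF subfield_1] by (cases "even (i + j)") auto
  ultimately show ?thesis unfolding cofactor_def by (intro subfield_mult)
qed

lemma SL_mult_closed:
  assumes "A \<in> carrier (SL n F)" "B \<in> carrier (SL n F)"
  shows "A * B \<in> carrier (SL n F)"
  using assms by (auto simp: SL_carrier_iff det_mult scalar_prod_def intro!: subfield_sum subfield_mult)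

lemma SL_one_closed: "1\<^sub>m n \<in> carrier (SL n F)"
  by (auto simp: SL_carrier_iff subfield_0 subfield_1)

text \<open>With determinant 1 the adjugate is the inverse, and its entries are polynomials in those
  of A, hence in \<open>F\<close>. As \<open>adj_mat\<close> does not mention \<open>F\<close>, the
  same matrix inverts A over \<open>F\<close> and over Q_p.\<close>

lemma SL_adj_mat:
  assumes "A \<in> carrier (SL n F)"
  shows "adj_mat A \<in> carrier (SL n F)" "adj_mat A * A = 1\<^sub>m n" "A * adj_mat A = 1\<^sub>m n"
proof -
  have A: "A \<in> carrier_mat n n" "det A = 1" using assms by (auto simp: SL_carrier_iff)
  note adj = adj_mat[OF A(1)]
  show 1: "adj_mat A * A = 1\<^sub>m n" and "A * adj_mat A = 1\<^sub>m n" using adj A(2) by (simp_all, auto)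
  have "det (adj_mat A) = 1"
    using det_mult[OF adj(1) A(1)] 1 A(2) by simp
  thus "adj_mat A \<in> carrier (SL n F)"
    using assms adj(1) A(1) unfolding SL_carrier_iff
    by (simp add: adj_mat_def subfield_cofactor[where n=n])
qed

lemma group_SL: "group (SL n F)"
proof (rule groupI)
  fix x assume x: "x \<in> carrier (SL n F)"
  show "\<exists>y\<in>carrier (SL n F). y \<otimes>\<^bsub>SL n F\<^esub> x = \<one>\<^bsub>SL n F\<^esub>"
    using SL_adj_mat[OF x] by auto
  show "\<one>\<^bsub>SL n F\<^esub> \<otimes>\<^bsub>SL n F\<^esub> x = x" using SL_carrier_mat[OF x] by simp
qed (auto simp: SL_mult_closed SL_one_closed dest!: SL_carrier_mat intro: assoc_mult_mat)

end

section \<open>Generation of the special linear group by transvections\<close>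

definition elem_mat :: "nat \<Rightarrow> nat \<Rightarrow> nat \<Rightarrow> 'a::field \<Rightarrow> 'a mat" where
  "elem_mat n i j x = addrow_mat n x i j"

lemma elem_mat_carrier [simp]: "elem_mat n i j x \<in> carrier_mat n n"
  by (simp add: elem_mat_def)

lemma index_elem_mat:
  "a < n \<Longrightarrow> b < n \<Longrightarrow> i \<noteq> j \<Longrightarrow>
     elem_mat n i j x $$ (a, b) = (if a = b then 1 else if a = i \<and> b = j then x else 0)"
  by (auto simp: elem_mat_def)

lemma index_elem_mat_mult:
  assumes "A \<in> carrier_mat n m" "a < n" "b < m" "i < n" "j < n"
  shows "(elem_mat n i j x * A) $$ (a, b) = A $$ (a, b) + (if a = i then x * A $$ (j, b) else 0)"
  using assms unfolding elem_mat_def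
  by (subst addrow_mat[OF assms(1), symmetric]) auto

lemma elem_mat_SL:
  assumes "is_subfield F" "x \<in> F" "i < n" "j < n" "i \<noteq> j"
  shows "elem_mat n i j x \<in> carrier (SL n F)"
  using assms det_addrow_mat[of i j n x] subfield_0[OF assms(1)] subfield_1[OF assms(1)]
  by (auto simp: SL_carrier_iff index_elem_mat) (simp add: elem_mat_def)

lemma elem_mat_mult:
  assumes "i < n" "j < n" "i \<noteq> j"
  shows "elem_mat n i j x * elem_mat n i j y = elem_mat n i j (x + y)"
proof (rule eq_matI)
  fix a b assume "a < dim_row (elem_mat n i j (x + y))" "b < dim_col (elem_mat n i j (x + y))"
  hence "a < n" "b < n" by (auto simp: elem_mat_def)
  thus "(elem_mat n i j x * elem_mat n i j y) $$ (a, b) = elem_mat n i j (x + y) $$ (a, b)"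
    unfolding index_elem_mat_mult[OF elem_mat_carrier \<open>a < n\<close> \<open>b < n\<close> assms(1,2)]
    using assms by (simp add: index_elem_mat)
qed (auto simp: elem_mat_def)

lemma elem_mat_0: "i \<noteq> j \<Longrightarrow> elem_mat n i j 0 = 1\<^sub>m n"
  by (intro eq_matI) (auto simp: index_elem_mat elem_mat_def)

text \<open>Only left multiplication by transvections is used, so that membership follows row
  reduction and yields an induction principle for the group.\<close>

inductive_set elem_group :: "nat \<Rightarrow> 'a::field set \<Rightarrow> 'a mat set" for n F where
  one: "1\<^sub>m n \<in> elem_group n F"
| step: "i < n \<Longrightarrow> j < n \<Longrightarrow> i \<noteq> j \<Longrightarrow> x \<in> F \<Longrightarrow> A \<in> elem_group n F \<Longrightarrow> elem_mat n i j x * A \<in> elem_group n F"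

context
  fixes F :: "'a::field set" and n :: nat
  assumes F: "is_subfield F"
begin

text \<open>Row reduction runs from A down to the identity, whereas \<open>elem_group\<close> is
  built up from the identity. Undoing one transvection reconciles the two directions.\<close>

lemma elem_group_cancel:
  assumes "A \<in> carrier_mat n n" "i < n" "j < n" "i \<noteq> j" "x \<in> F"
    and "elem_mat n i j x * A \<in> elem_group n F"
  shows "A \<in> elem_group n F"
proof -
  have "elem_mat n i j (- x) * (elem_mat n i j x * A) = elem_mat n i j (- x) * elem_mat n i j x * A"
    by (rule assoc_mult_mat[OF elem_mat_carrier elem_mat_carrier assms(1), symmetric])
  also have "elem_mat n i j (- x) * elem_mat n i j x = 1\<^sub>m n"
    by (simp add: elem_mat_mult[OF assms(2,3,4)] elem_mat_0[OF assms(4)])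
  also have "1\<^sub>m n * A = A" using assms(1) by (rule left_mult_one_mat)
  finally have eq: "elem_mat n i j (- x) * (elem_mat n i j x * A) = A" .
  show ?thesis
    using elem_group.step[OF assms(2,3,4) subfield_minus[OF F assms(5)] assms(6)] unfolding eq .
qed

definition unit_cols :: "nat \<Rightarrow> 'a mat \<Rightarrow> bool" where
  "unit_cols k A \<longleftrightarrow> (\<forall>j<k. \<forall>i<n. A $$ (i, j) = (if i = j then 1 else 0))"

lemma unit_cols_elem_mult:
  assumes "unit_cols k A" "A \<in> carrier_mat n n" "i < n" "j < n" "i \<noteq> j" "k \<le> j"
  shows "unit_cols k (elem_mat n i j x * A)"
  unfolding unit_cols_def
proof (intro allI impI)
  fix b a assume "b < k" "a < n"
  thus "(elem_mat n i j x * A) $$ (a, b) = (if a = b then 1 else 0)"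
    using assms index_elem_mat_mult[OF assms(2) \<open>a < n\<close> _ assms(3,4), of b x] by (simp add: unit_cols_def)
qed

text \<open>With pivot 1 the other entries of column k are removed one at a time by adding multiples
  of row k, and the number of nonzero ones decreases. Row k vanishes in the first k columns, so
  these are preserved.\<close>

lemma elem_group_clear_column:
  assumes "A \<in> carrier (SL n F)" "unit_cols k A" "k < n" "A $$ (k, k) = 1"
    and "\<And>B. B \<in> carrier (SL n F) \<Longrightarrow> unit_cols (Suc k) B \<Longrightarrow> B \<in> elem_group n F"
  shows "A \<in> elem_group n F"
  using assms(1,2,4)
proof (induction "card {a. a < n \<and> a \<noteq> k \<and> A $$ (a, k) \<noteq> 0}" arbitrary: A rule: less_induct)
  case less
  note A = SL_carrier_mat[OF less.prems(1)]
  show ?case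
  proof (cases "\<exists>a<n. a \<noteq> k \<and> A $$ (a, k) \<noteq> 0")
    case False
    hence "unit_cols (Suc k) A"
      using less.prems assms(3) by (auto simp: unit_cols_def less_Suc_eq)
    thus ?thesis using assms(5) less.prems by blast
  next
    case True
    then obtain a where a: "a < n" "a \<noteq> k" "A $$ (a, k) \<noteq> 0" by blast
    let ?x = "- A $$ (a, k)"
    let ?B = "elem_mat n a k ?x * A"
    have x: "?x \<in> F" using less.prems(1) a assms(3) subfield_minus[OF F] by (auto simp: SL_carrier_iff)
    have idx: "?B $$ (b, k) = (if b = a then 0 else A $$ (b, k))" if "b < n" for b
      using index_elem_mat_mult[OF A that assms(3) a(1) assms(3), of ?x] that a less.prems(3) by simp
    have "?B \<in> elem_group n F"
    proof (rule less.hyps)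
      have "{b. b < n \<and> b \<noteq> k \<and> ?B $$ (b, k) \<noteq> 0} \<subseteq> {a. a < n \<and> a \<noteq> k \<and> A $$ (a, k) \<noteq> 0} - {a}"
      proof
        fix b assume "b \<in> {b. b < n \<and> b \<noteq> k \<and> ?B $$ (b, k) \<noteq> 0}"
        thus "b \<in> {a. a < n \<and> a \<noteq> k \<and> A $$ (a, k) \<noteq> 0} - {a}"
          using idx[of b] by (cases "b = a") auto
      qed
      also have "\<dots> \<subset> {a. a < n \<and> a \<noteq> k \<and> A $$ (a, k) \<noteq> 0}" using a by blast
      finally have "{b. b < n \<and> b \<noteq> k \<and> ?B $$ (b, k) \<noteq> 0} \<subset> {a. a < n \<and> a \<noteq> k \<and> A $$ (a, k) \<noteq> 0}" .
      thus "card {b. b < n \<and> b \<noteq> k \<and> ?B $$ (b, k) \<noteq> 0} < card {a. a < n \<and> a \<noteq> k \<and> A $$ (a, k) \<noteq> 0}"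
        by (intro psubset_card_mono) auto
      show "?B \<in> carrier (SL n F)"
        using a assms(3) x less.prems(1) by (intro SL_mult_closed[OF F] elem_mat_SL[OF F])
      show "unit_cols k ?B" using less.prems(2) A a assms(3) by (intro unit_cols_elem_mult) auto
      show "?B $$ (k, k) = 1" using idx[of k] a assms(3) less.prems by simp
    qed
    thus ?thesis using elem_group_cancel[OF A] a assms(3) x by blast
  qed
qed

text \<open>Otherwise column k would be a combination of the unit columns before it. Concretely, row
  k of the adjugate annihilates the first k columns, so its first k entries vanish; then it
  annihilates column k as well, contradicting that the adjugate is a left inverse.\<close>

lemma SL_pivot:
  assumes "A \<in> carrier (SL n F)" "unit_cols k A" "k < n"
  shows "\<exists>i. k \<le> i \<and> i < n \<and> A $$ (i, k) \<noteq> 0"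
proof (rule ccontr)
  assume "\<nexists>i. k \<le> i \<and> i < n \<and> A $$ (i, k) \<noteq> 0"
  hence z: "A $$ (i, k) = 0" if "k \<le> i" "i < n" for i using that by blast
  let ?B = "adj_mat A"
  note A = SL_carrier_mat[OF assms(1)] and B = SL_carrier_mat[OF SL_adj_mat(1)[OF F assms(1)]]
  have prod: "(?B * A) $$ (k, b) = (\<Sum>i\<in>{0..<n}. ?B $$ (k, i) * A $$ (i, b))" if "b < n" for b
    using A B assms(3) that by (simp add: scalar_prod_def)
  have "?B $$ (k, i) = 0" if "i < k" for i
  proof -
    have "(\<Sum>j\<in>{0..<n}. ?B $$ (k, j) * A $$ (j, i)) = (\<Sum>j\<in>{0..<n}. if j = i then ?B $$ (k, i) else 0)"
      using assms(2) that by (intro sum.cong) (auto simp: unit_cols_def)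
    also have "\<dots> = ?B $$ (k, i)" using that assms(3) by simp
    finally show ?thesis using prod[of i] SL_adj_mat(2)[OF F assms(1)] that assms(3) by simp
  qed
  hence "(\<Sum>i\<in>{0..<n}. ?B $$ (k, i) * A $$ (i, k)) = 0"
    using z by (intro sum.neutral) (metis atLeastLessThan_iff mult_zero_left mult_zero_right not_le)
  thus False using prod[of k] SL_adj_mat(2)[OF F assms(1)] assms(3) by simp
qed

text \<open>Gaussian elimination by transvections alone, with neither row exchanges nor scalings.
  Bringing the pivot to 1 takes a nonzero entry below it; in the last column there is no row below,
  but there the determinant forces the pivot to be 1.\<close>

lemma elem_group_unit_cols:
  assumes "A \<in> carrier (SL n F)" "unit_cols k A" "k \<le> n"
  shows "A \<in> elem_group n F"
  using assms(3,1,2)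
proof (induction k arbitrary: A rule: inc_induct)
  case base
  have "A = 1\<^sub>m n"
    using base SL_carrier_mat[OF base(1)] by (intro eq_matI) (auto simp: unit_cols_def)
  thus ?case by (simp add: elem_group.one)
next
  case (step k)
  have pivot: "B \<in> elem_group n F"
    if B: "B \<in> carrier (SL n F)" "unit_cols k B" and i: "k < i" "i < n" "B $$ (i, k) \<noteq> 0" for B i
  proof -
    note Bc = SL_carrier_mat[OF B(1)]
    \<comment> \<open>Adding this multiple of row i to row k makes the pivot equal to 1.\<close>
    let ?x = "(1 - B $$ (k, k)) / B $$ (i, k)"
    have x: "?x \<in> F"
      using B(1) i step.hyps
      by (intro subfield_divide[OF F] subfield_diff[OF F] subfield_1[OF F]) (auto simp: SL_carrier_iff)
    have "elem_mat n k i ?x * B \<in> elem_group n F"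
    proof (rule elem_group_clear_column)
      show "elem_mat n k i ?x * B \<in> carrier (SL n F)"
        using i x B(1) step.hyps by (intro SL_mult_closed[OF F] elem_mat_SL[OF F]) auto
      show "unit_cols k (elem_mat n k i ?x * B)"
        using B(2) Bc i step.hyps by (intro unit_cols_elem_mult) auto
      show "(elem_mat n k i ?x * B) $$ (k, k) = 1"
        using index_elem_mat_mult[OF Bc _ _ _ i(2), of k k k ?x] i step.hyps by simp
    qed (use step in auto)
    thus ?thesis using elem_group_cancel[OF Bc, of k i] i x step.hyps by auto
  qed
  note A = SL_carrier_mat[OF step.prems(1)]
  obtain i where i: "k \<le> i" "i < n" "A $$ (i, k) \<noteq> 0"
    using SL_pivot[OF step.prems(1,2)] step.hyps by blast
  show ?case
  proof (cases "k < i")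
    case True
    thus ?thesis using pivot step.prems i by blast
  next
    case False
    hence ik: "i = k" using i by simp
    show ?thesis
    proof (cases "Suc k < n")
      case True
      \<comment> \<open>Only the pivot itself is known to be nonzero; adding row k to row k + 1
        creates a nonzero entry below it.\<close>
      let ?B = "elem_mat n (Suc k) k 1 * A"
      have "?B \<in> elem_group n F" if "A $$ (Suc k, k) = 0"
      proof (rule pivot)
        show "?B \<in> carrier (SL n F)"
          using True step.prems(1) by (intro SL_mult_closed[OF F] elem_mat_SL[OF F] subfield_1[OF F]) auto
        show "unit_cols k ?B" using True step.prems(2) A by (intro unit_cols_elem_mult) auto
        show "?B $$ (Suc k, k) \<noteq> 0"
          using index_elem_mat_mult[OF A True _ True, of k k 1] True that i ik by simp
      qed (use True in auto)
      hence "A \<in> elem_group n F" if "A $$ (Suc k, k) = 0"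
        using that elem_group_cancel[OF A, of "Suc k" k 1] True subfield_1[OF F] by auto
      moreover have "A \<in> elem_group n F" if "A $$ (Suc k, k) \<noteq> 0"
        using pivot[OF step.prems, of "Suc k"] that True by auto
      ultimately show ?thesis by blast
    next
      case False
      hence n: "n = Suc k" using step.hyps by simp
      have entry: "A $$ (i, j) = (if i = j then 1 else 0)" if "i < n" "j < k" for i j
        using step.prems(2) that by (simp add: unit_cols_def)
      have "upper_triangular A"
      proof (rule upper_triangularI)
        fix i j assume "j < i" "i < dim_row A"
        thus "A $$ (i, j) = 0" using A n entry[of i j] by auto
      qed
      hence "prod_list (diag_mat A) = 1"
        using det_upper_triangular[OF _ A] step.prems(1) by (simp add: SL_carrier_iff)
      moreover have "diag_mat A = map (\<lambda>i. if i = k then A $$ (k, k) else 1) [0..<n]"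
        unfolding diag_mat_def by (rule map_cong) (use A n entry in \<open>auto simp: less_Suc_eq\<close>)
      moreover have "prod_list (map (\<lambda>i. if i = k then A $$ (k, k) else 1) [0..<k]) = 1"
        by (intro prod_list_neutral) auto
      ultimately have "A $$ (k, k) = 1" using n by simp
      thus ?thesis using elem_group_clear_column[OF step.prems(1,2)] step by auto
    qed
  qed
qed

theorem SL_elem_group: "A \<in> carrier (SL n F) \<Longrightarrow> A \<in> elem_group n F"
  using elem_group_unit_cols[of A 0] by (simp add: unit_cols_def)

end

lemma index_mult_elem_mat:
  assumes "A \<in> carrier_mat m n" "a < m" "b < n" "i < n" "j < n" "i \<noteq> j"
  shows "(A * elem_mat n i j x) $$ (a, b) = A $$ (a, b) + (if b = j then A $$ (a, i) * x else 0)"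
proof -
  have "(A * elem_mat n i j x) $$ (a, b) = (\<Sum>r\<in>{0..<n}. A $$ (a, r) * elem_mat n i j x $$ (r, b))"
    using assms by (simp add: scalar_prod_def elem_mat_def)
  also have "\<dots> = (\<Sum>r\<in>{0..<n}. (if r = b then A $$ (a, b) else 0) +
      (if r = i then if b = j then A $$ (a, i) * x else 0 else 0))"
    using assms by (intro sum.cong) (auto simp: index_elem_mat)
  also have "\<dots> = A $$ (a, b) + (if b = j then A $$ (a, i) * x else 0)"
    using assms by (simp add: sum.distrib)
  finally show ?thesis .
qed

text \<open>With B the inverse of A, the conjugate is 1 plus x times column i of A times row j of B.
  This rank-one form underlies both the Iwasawa argument and the contracted unipotents.\<close>

lemma index_conj_elem:
  assumes "A \<in> carrier_mat n n" "B \<in> carrier_mat n n" "A * B = 1\<^sub>m n" "i < n" "j < n" "i \<noteq> j" "a < n" "b < n"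
  shows "(A * elem_mat n i j x * B) $$ (a, b) = (if a = b then 1 else 0) + x * A $$ (a, i) * B $$ (j, b)"
proof -
  let ?E = "elem_mat n i j x"
  have "(A * ?E * B) $$ (a, b) = (\<Sum>r\<in>{0..<n}. (A * ?E) $$ (a, r) * B $$ (r, b))"
    using assms by (simp add: scalar_prod_def elem_mat_def)
  also have "\<dots> = (\<Sum>r\<in>{0..<n}. A $$ (a, r) * B $$ (r, b) +
      (if r = j then x * A $$ (a, i) * B $$ (j, b) else 0))"
  proof (intro sum.cong refl)
    fix r assume r: "r \<in> {0..<n}"
    hence "(A * ?E) $$ (a, r) = A $$ (a, r) + (if r = j then A $$ (a, i) * x else 0)"
      by (intro index_mult_elem_mat[OF assms(1,7) _ assms(4-6)]) auto
    thus "(A * ?E) $$ (a, r) * B $$ (r, b) = A $$ (a, r) * B $$ (r, b) +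
        (if r = j then x * A $$ (a, i) * B $$ (j, b) else 0)"
      by (simp add: algebra_simps)
  qed
  also have "\<dots> = (\<Sum>r\<in>{0..<n}. A $$ (a, r) * B $$ (r, b)) + x * A $$ (a, i) * B $$ (j, b)"
    using assms(5) by (simp add: sum.distrib)
  also have "(\<Sum>r\<in>{0..<n}. A $$ (a, r) * B $$ (r, b)) = (A * B) $$ (a, b)"
    using assms(1,2,7,8) by (simp add: scalar_prod_def)
  also have "\<dots> = (if a = b then 1 else 0)" unfolding assms(3) using assms(7,8) by simp
  finally show ?thesis .
qed

lemma inv_SL_eqI:
  assumes "is_subfield F" "A \<in> carrier (SL n F)" "B \<in> carrier (SL n F)" "A * B = 1\<^sub>m n"
  shows "inv\<^bsub>SL n F\<^esub> A = B"
proof -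
  interpret group "SL n F" by (rule group_SL[OF assms(1)])
  show ?thesis using inv_equality[of B A] inv_comm[of A B] assms by simp
qed

section \<open>Normal subgroups of the special linear group\<close>

definition scalar_mat :: "nat \<Rightarrow> 'a::field mat \<Rightarrow> bool" where
  "scalar_mat n A \<longleftrightarrow> (\<exists>c. A = c \<cdot>\<^sub>m 1\<^sub>m n)"

lemma scalar_matI:
  assumes "A \<in> carrier_mat n n" "\<And>i j. i < n \<Longrightarrow> j < n \<Longrightarrow> i \<noteq> j \<Longrightarrow> A $$ (i, j) = 0"
    and "\<And>i j. i < n \<Longrightarrow> j < n \<Longrightarrow> A $$ (i, i) = A $$ (j, j)"
  shows "scalar_mat n A"
  unfolding scalar_mat_def
proof (rule exI[of _ "A $$ (0, 0)"], rule eq_matI)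
  fix i j assume "i < dim_row (A $$ (0, 0) \<cdot>\<^sub>m 1\<^sub>m n)" "j < dim_col (A $$ (0, 0) \<cdot>\<^sub>m 1\<^sub>m n)"
  thus "A $$ (i, j) = (A $$ (0, 0) \<cdot>\<^sub>m 1\<^sub>m n) $$ (i, j)"
    using assms(2)[of i j] assms(3)[of i 0] by (cases "i = j") auto
qed (use assms in auto)

text \<open>Instantiated both over \<open>F\<close> and over all of Q_p, the latter for a group of
  limit points. Characteristic 0 provides the divisions by 2 and 3.\<close>

locale SL_normal =
  fixes F :: "'a::field_char_0 set" and n :: nat and N :: "'a mat set"
  assumes F: "is_subfield F" and normal: "N \<lhd> SL n F"
begin

abbreviation G where "G \<equiv> SL n F"

lemma group_G: "group G" by (rule group_SL[OF F])

lemma N_sub: "N \<subseteq> carrier G"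
  using normal_imp_subgroup[OF normal] by (rule subgroup.subset)

lemma N_mat: "A \<in> N \<Longrightarrow> A \<in> carrier_mat n n"
  using N_sub SL_carrier_mat by blast

lemma conj_closed:
  assumes "A \<in> N" "B \<in> carrier G" "C \<in> carrier G" "B * C = 1\<^sub>m n"
  shows "B * A * C \<in> N"
  using normal.inv_op_closed2[OF normal assms(2,1)] inv_SL_eqI[OF F assms(2-4)] by simp

lemma elem_conj_closed:
  assumes "A \<in> N" "x \<in> F" "i < n" "j < n" "i \<noteq> j"
  shows "elem_mat n i j x * A * elem_mat n i j (- x) \<in> N"
  using assms elem_mat_mult[of i n j x "- x"] elem_mat_0[of i j n]
  by (intro conj_closed elem_mat_SL[OF F] subfield_minus[OF F]) auto

lemma index_elem_conj:
  assumes "A \<in> carrier_mat n n" "i < n" "j < n" "i \<noteq> j" "a < n" "b < n"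
  shows "(elem_mat n i j x * A * elem_mat n i j (- x)) $$ (a, b) =
    A $$ (a, b) + (if a = i then x * A $$ (j, b) else 0) -
    (if b = j then (A $$ (a, i) + (if a = i then x * A $$ (j, i) else 0)) * x else 0)"
proof -
  have "elem_mat n i j x * A \<in> carrier_mat n n" using assms(1) by (rule mult_carrier_mat[OF elem_mat_carrier])
  from index_mult_elem_mat[OF this assms(5,6,2,3,4), of "- x"]
  show ?thesis
    using index_elem_mat_mult[OF assms(1,5,6,2,3), of x] index_elem_mat_mult[OF assms(1,5,2,2,3), of x]
    by simp
qed

text \<open>A diagonal matrix that is not scalar has two different diagonal entries; conjugation by
  a transvection in these two indices puts their difference off the diagonal.\<close>

lemma ex_off_diagonal:
  assumes "A \<in> N" "\<not> scalar_mat n A"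
  shows "\<exists>B\<in>N. \<exists>l<n. \<exists>k<n. l \<noteq> k \<and> B $$ (l, k) \<noteq> 0"
proof (cases "\<exists>l<n. \<exists>k<n. l \<noteq> k \<and> A $$ (l, k) \<noteq> 0")
  case False
  then obtain i j where ij: "i < n" "j < n" "A $$ (i, i) \<noteq> A $$ (j, j)"
    using scalar_matI[OF N_mat[OF assms(1)]] assms(2) by blast
  have ne: "i \<noteq> j" using ij by auto
  have "A $$ (i, j) = 0" "A $$ (j, i) = 0" using False ij ne by blast+
  hence "(elem_mat n i j 1 * A * elem_mat n i j (- 1)) $$ (i, j) = A $$ (j, j) - A $$ (i, i)"
    using ij ne by (subst index_elem_conj[OF N_mat[OF assms(1)] ij(1,2) ne ij(1,2)]) auto
  thus ?thesis
    using elem_conj_closed[OF assms(1) subfield_1[OF F] ij(1,2) ne] ij ne by (metis right_minus_eq)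
qed (use assms in blast)

text \<open>Such a matrix carries the coordinate line of index k to that of index l. With l fixed
  and k varying this expresses transitivity on the coordinate lines.\<close>

definition unit_col :: "nat \<Rightarrow> nat \<Rightarrow> 'a mat \<Rightarrow> bool" where
  "unit_col l k A \<longleftrightarrow> A $$ (l, k) \<noteq> 0 \<and> (\<forall>a<n. a \<noteq> l \<longrightarrow> A $$ (a, k) = 0)"

text \<open>Conjugation by a transvection with indices (a,l) adds a multiple of row l to row a, and
  its column operation changes column l only. As l differs from k, column k undergoes a pure row
  operation, which clears its entry in row a.\<close>

lemma ex_unit_col:
  assumes "A \<in> N" "l < n" "k < n" "l \<noteq> k" "A $$ (l, k) \<noteq> 0"
  shows "\<exists>B\<in>N. unit_col l k B"
  using assms(1,5)
proof (induction "card {a. a < n \<and> a \<noteq> l \<and> A $$ (a, k) \<noteq> 0}" arbitrary: A rule: less_induct)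
  case less
  show ?case
  proof (cases "\<exists>a<n. a \<noteq> l \<and> A $$ (a, k) \<noteq> 0")
    case False
    thus ?thesis using less.prems by (auto simp: unit_col_def)
  next
    case True
    then obtain a where a: "a < n" "a \<noteq> l" "A $$ (a, k) \<noteq> 0" by blast
    define x where "x = - (A $$ (a, k) / A $$ (l, k))"
    define B where "B = elem_mat n a l x * A * elem_mat n a l (- x)"
    have "A \<in> carrier G" using less.prems N_sub by blast
    hence x: "x \<in> F" using a assms unfolding x_def
      by (intro subfield_minus[OF F] subfield_divide[OF F]) (auto simp: SL_carrier_iff)
    have idx: "B $$ (b, k) = (if b = a then 0 else A $$ (b, k))" if "b < n" for b
      unfolding B_def index_elem_conj[OF N_mat[OF less.prems(1)] a(1) assms(2) a(2) that assms(3)]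
      using assms(4) less.prems(2) by (simp add: x_def)
    have B: "B \<in> N" unfolding B_def by (rule elem_conj_closed[OF less.prems(1) x a(1) assms(2) a(2)])
    have "{b. b < n \<and> b \<noteq> l \<and> B $$ (b, k) \<noteq> 0} \<subseteq> {a. a < n \<and> a \<noteq> l \<and> A $$ (a, k) \<noteq> 0} - {a}"
    proof
      fix b assume "b \<in> {b. b < n \<and> b \<noteq> l \<and> B $$ (b, k) \<noteq> 0}"
      thus "b \<in> {a. a < n \<and> a \<noteq> l \<and> A $$ (a, k) \<noteq> 0} - {a}"
        using idx[of b] by (cases "b = a") auto
    qed
    also have "\<dots> \<subset> {a. a < n \<and> a \<noteq> l \<and> A $$ (a, k) \<noteq> 0}" using a by blast
    finally have "card {b. b < n \<and> b \<noteq> l \<and> B $$ (b, k) \<noteq> 0} < card {a. a < n \<and> a \<noteq> l \<and> A $$ (a, k) \<noteq> 0}"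
      by (intro psubset_card_mono) auto
    thus ?thesis using less.hyps[of B] B idx[OF assms(2)] less.prems(2) a(2) by simp
  qed
qed

text \<open>Conjugation by a signed permutation matrix \<open>W\<close>, a product of three
  transvections, which sends e_k to e_i and fixes e_l. Then \<open>C\<close> maps e_i through e_k to
  a multiple of e_l.\<close>

lemma ex_unit_col_swap:
  assumes "B \<in> N" "unit_col l k B" "l < n" "k < n" "i < n" "i \<noteq> k" "i \<noteq> l" "k \<noteq> l"
  shows "\<exists>C\<in>N. unit_col l i C"
proof -
  have ki: "k \<noteq> i" using assms by simp
  define V where "V = elem_mat n k i (- 1) * elem_mat n i k (1 :: 'a)"
  define W where "W = elem_mat n i k 1 * V"
  have m1: "- 1 \<in> F" using subfield_minus[OF F subfield_1[OF F]] .
  have V: "V \<in> carrier G" unfolding V_def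
    by (intro SL_mult_closed[OF F] elem_mat_SL[OF F] m1 subfield_1[OF F] assms ki)
  have W: "W \<in> carrier G" unfolding W_def
    by (intro SL_mult_closed[OF F] elem_mat_SL[OF F] subfield_1[OF F] assms V)
  have Vidx: "V $$ (a, b) = elem_mat n i k 1 $$ (a, b) +
      (if a = k then - 1 * elem_mat n i k 1 $$ (i, b) else 0)" if "a < n" "b < n" for a b
    unfolding V_def by (rule index_elem_mat_mult[OF elem_mat_carrier that assms(4,5)])
  have Widx: "W $$ (a, b) = V $$ (a, b) + (if a = i then 1 * V $$ (k, b) else 0)"
    if "a < n" "b < n" for a b
    unfolding W_def by (rule index_elem_mat_mult[OF SL_carrier_mat[OF V] that assms(5,4)])
  have Wk: "W $$ (a, k) = (if a = i then 1 else 0)" if "a < n" for a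
    using that assms by (simp add: Widx Vidx index_elem_mat)
  have Wl: "W $$ (a, l) = (if a = l then 1 else 0)" if "a < n" for a
    using that assms by (simp add: Widx Vidx index_elem_mat)
  note W' = SL_adj_mat[OF F W]
  define C where "C = W * B * adj_mat W"
  have C: "C \<in> N" unfolding C_def by (rule conj_closed[OF assms(1) W W'(1,3)])
  have mats: "W \<in> carrier_mat n n" "B \<in> carrier_mat n n" "adj_mat W \<in> carrier_mat n n" "C \<in> carrier_mat n n"
    using W W'(1) assms(1) C N_mat SL_carrier_mat by blast+
  \<comment> \<open>Comparing column k of both sides of C W = W B yields column i of
    \<open>C\<close> without the entries of the inverse of \<open>W\<close>.\<close>
  have "C * W = W * B * (adj_mat W * W)"
    unfolding C_def by (rule assoc_mult_mat[OF mult_carrier_mat[OF mats(1,2)] mats(3,1)])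
  also have "\<dots> = W * B" using mats by (simp add: W'(2))
  finally have CW: "C * W = W * B" .
  have "C $$ (a, i) = (if a = l then B $$ (l, k) else 0)" if a: "a < n" for a
  proof -
    have "(C * W) $$ (a, k) = (\<Sum>b\<in>{0..<n}. C $$ (a, b) * W $$ (b, k))"
      using mats a assms by (simp add: scalar_prod_def)
    also have "\<dots> = (\<Sum>b\<in>{0..<n}. if b = i then C $$ (a, i) else 0)"
      by (intro sum.cong) (auto simp: Wk)
    also have "\<dots> = C $$ (a, i)" using assms(5) by simp
    finally have 1: "(C * W) $$ (a, k) = C $$ (a, i)" .
    have "(W * B) $$ (a, k) = (\<Sum>b\<in>{0..<n}. W $$ (a, b) * B $$ (b, k))"
      using mats a assms by (simp add: scalar_prod_def)
    also have "\<dots> = (\<Sum>b\<in>{0..<n}. if b = l then W $$ (a, l) * B $$ (l, k) else 0)"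
      using assms(2) by (intro sum.cong) (auto simp: unit_col_def)
    also have "\<dots> = W $$ (a, l) * B $$ (l, k)" using assms(3) by simp
    finally show ?thesis using 1 CW Wl[OF a] by (cases "a = l") auto
  qed
  hence "unit_col l i C" using assms(2,3) by (auto simp: unit_col_def)
  thus ?thesis using C by blast
qed

text \<open>The matrices 1 + e_l v with v a row vector vanishing at l: the transvections with centre
  e_l. They form an abelian normal subgroup of the stabilizer of the line of e_l, the subgroup that
  Iwasawa's criterion asks for.\<close>

definition row_group :: "nat \<Rightarrow> 'a mat set" where
  "row_group l = {A \<in> carrier G. A $$ (l, l) = 1 \<and> (\<forall>a<n. \<forall>b<n. a \<noteq> l \<longrightarrow> A $$ (a, b) = (if a = b then 1 else 0))}"

lemma row_group_mult:
  assumes "A \<in> row_group l" "B \<in> row_group l" "l < n"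
  shows "A * B \<in> row_group l" "A * B = B * A"
proof -
  have carr: "A \<in> carrier_mat n n" "B \<in> carrier_mat n n"
    using assms by (auto simp: row_group_def dest: SL_carrier_mat)
  have entry: "(C * D) $$ (a, b) = (if a = b then 1 else if a = l then C $$ (l, b) + D $$ (l, b) else 0)"
    if C: "C \<in> row_group l" and D: "D \<in> row_group l" and ab: "a < n" "b < n" for C D a b
  proof -
    have CD: "C \<in> carrier_mat n n" "D \<in> carrier_mat n n"
      using C D by (auto simp: row_group_def dest: SL_carrier_mat)
    have c: "C $$ (a', b') = (if a' = b' then 1 else if a' = l then C $$ (l, b') else 0)"
      and d: "D $$ (a', b') = (if a' = b' then 1 else if a' = l then D $$ (l, b') else 0)"
      if "a' < n" "b' < n" for a' b'
      using that C D by (auto simp: row_group_def)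
    have "(C * D) $$ (a, b) = (\<Sum>r\<in>{0..<n}. C $$ (a, r) * D $$ (r, b))"
      using CD ab by (simp add: scalar_prod_def)
    also have "\<dots> = (\<Sum>r\<in>{0..<n}. (if r = a then D $$ (a, b) else 0) +
        (if r = b then if a = l \<and> b \<noteq> l then C $$ (l, b) else 0 else 0))"
    proof (intro sum.cong refl)
      fix r assume "r \<in> {0..<n}"
      thus "C $$ (a, r) * D $$ (r, b) = (if r = a then D $$ (a, b) else 0) +
          (if r = b then if a = l \<and> b \<noteq> l then C $$ (l, b) else 0 else 0)"
        using c[of a r] d[of r b] ab by auto
    qed
    also have "\<dots> = D $$ (a, b) + (if a = l \<and> b \<noteq> l then C $$ (l, b) else 0)"
      using ab by (simp add: sum.distrib)
    finally show ?thesis using d[OF ab] by (auto simp: add.commute)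
  qed
  have "A * B \<in> carrier G" using assms by (auto simp: row_group_def intro: SL_mult_closed[OF F])
  thus "A * B \<in> row_group l" using entry[OF assms(1,2)] assms(3) unfolding row_group_def by auto
  show "A * B = B * A"
  proof (rule eq_matI)
    fix a b assume "a < dim_row (B * A)" "b < dim_col (B * A)"
    hence "a < n" "b < n" using carr by auto
    thus "(A * B) $$ (a, b) = (B * A) $$ (a, b)"
      using entry[OF assms(1,2)] entry[OF assms(2,1)] by (simp add: add.commute)
  qed (use carr in auto)
qed

lemma one_in_N: "1\<^sub>m n \<in> N"
  using subgroup.one_closed[OF normal_imp_subgroup[OF normal]] by simp

text \<open>Column i of h is a multiple of e_l, so the rank-one part of the conjugate lives in row
  l. Its entry at (l,l) vanishes because row j of the inverse annihilates column i of h for j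
  different from i.\<close>

lemma conj_elem_row_group:
  assumes h: "h \<in> N" "unit_col l i h" and ij: "i < n" "j < n" "i \<noteq> j" "l < n" "x \<in> F"
  shows "h * elem_mat n i j x * adj_mat h \<in> row_group l"
proof -
  have hG: "h \<in> carrier G" using h N_sub by blast
  note h' = SL_adj_mat[OF F hG]
  let ?E = "elem_mat n i j x" and ?h' = "adj_mat h"
  have mats: "h \<in> carrier_mat n n" "?h' \<in> carrier_mat n n"
    using hG h'(1) SL_carrier_mat by blast+
  note entry = index_conj_elem[OF mats h'(3) ij(1,2,3)]
  have "(?h' * h) $$ (j, i) = (\<Sum>r\<in>{0..<n}. ?h' $$ (j, r) * h $$ (r, i))"
    using mats ij by (simp add: scalar_prod_def)
  also have "\<dots> = (\<Sum>r\<in>{0..<n}. if r = l then ?h' $$ (j, l) * h $$ (l, i) else 0)"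
    using h(2) by (intro sum.cong) (auto simp: unit_col_def)
  also have "\<dots> = ?h' $$ (j, l) * h $$ (l, i)" using ij(4) by simp
  finally have "?h' $$ (j, l) * h $$ (l, i) = 0" using ij by (simp add: h'(2))
  hence jl: "?h' $$ (j, l) = 0" using h(2) by (simp add: unit_col_def)
  have "h * ?E * ?h' \<in> carrier G"
    by (intro SL_mult_closed[OF F] elem_mat_SL[OF F] hG h'(1) ij)
  thus ?thesis unfolding row_group_def using entry h(2) jl ij(4) by (auto simp: unit_col_def)
qed

abbreviation quot where "quot \<equiv> \<lambda>A. N #>\<^bsub>G\<^esub> A"

lemma quot_hom: "group_hom G (G Mod N) quot"
  using normal.r_coset_hom_Mod[OF normal] group_G normal.factorgroup_is_group[OF normal]
  by (simp add: group_hom_def group_hom_axioms_def)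

lemma quot_eq_one_iff: "A \<in> carrier G \<Longrightarrow> quot A = \<one>\<^bsub>G Mod N\<^esub> \<longleftrightarrow> A \<in> N"
  using group.coset_join1[OF group_G _ _ normal_imp_subgroup[OF normal], of A]
    group.coset_join2[OF group_G _ normal_imp_subgroup[OF normal], of A] by (auto simp: FactGroup_def)

lemma quot_conj:
  assumes "h \<in> N" "A \<in> carrier G"
  shows "quot (h * A * adj_mat h) = quot A"
proof -
  interpret Q: group_hom G "G Mod N" quot by (rule quot_hom)
  have hG: "h \<in> carrier G" using assms N_sub by blast
  note h' = SL_adj_mat[OF F hG]
  have "adj_mat h = inv\<^bsub>G\<^esub> h" using inv_SL_eqI[OF F hG h'(1,3)] by simp
  hence "adj_mat h \<in> N" using subgroup.m_inv_closed[OF normal_imp_subgroup[OF normal] assms(1)] by simp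
  hence "quot (adj_mat h) = \<one>\<^bsub>G Mod N\<^esub>" "quot h = \<one>\<^bsub>G Mod N\<^esub>"
    using quot_eq_one_iff hG h' assms by auto
  thus ?thesis
    using Q.hom_mult[of "h * A" "adj_mat h"] Q.hom_mult[of h A] assms(2) hG h'(1)
      SL_mult_closed[OF F hG assms(2)] Q.hom_closed[of A] by (simp del: mult_FactGroup one_FactGroup)
qed

text \<open>
  Iwasawa's argument: modulo \<open>N\<close> every elementary matrix agrees with an element of the abelian
  group \<open>row_group l\<close>, so the quotient is abelian; since elementary matrices are commutators with
  diagonal matrices, they all lie in \<open>N\<close>.
\<close>
theorem SL_normal_eq_carrier:
  assumes "A \<in> N" "\<not> scalar_mat n A"
  shows "N = carrier G"
proof -
  interpret Q: group_hom G "G Mod N" quot by (rule quot_hom)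
  obtain B l k where B: "B \<in> N" "l < n" "k < n" "l \<noteq> k" "B $$ (l, k) \<noteq> 0"
    using ex_off_diagonal[OF assms] by blast
  obtain C where C: "C \<in> N" "unit_col l k C" using ex_unit_col[OF B] by blast
  \<comment> \<open>Every coordinate line is carried to the line of e_l by an element of
    \<open>N\<close>: the identity for i = l, \<open>C\<close> for i = k, and a conjugate of
    \<open>C\<close> otherwise.\<close>
  have "\<exists>h\<in>N. unit_col l i h" if "i < n" for i
  proof -
    consider "i = l" | "i = k" | "i \<noteq> l" "i \<noteq> k" by blast
    thus ?thesis
    proof cases
      case 1
      have "unit_col l l (1\<^sub>m n)" using B by (auto simp: unit_col_def)
      thus ?thesis using 1 one_in_N by blast
    next
      case 3
      thus ?thesis using ex_unit_col_swap[OF C B(2,3) that] B(4) by auto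
    qed (use C in blast)
  qed
  hence elem: "\<exists>D\<in>row_group l. quot (elem_mat n i j x) = quot D"
    if "i < n" "j < n" "i \<noteq> j" "x \<in> F" for i j x
    using conj_elem_row_group[OF _ _ that(1,2,3) B(2) that(4)] quot_conj elem_mat_SL[OF F that(4,1,2,3)]
      that(1) by metis
  have carr: "D \<in> carrier G" if "D \<in> row_group l" for D using that by (simp add: row_group_def)
  have all: "\<exists>D\<in>row_group l. quot A = quot D" if "A \<in> carrier G" for A
    using SL_elem_group[OF F that]
  proof (induction rule: elem_group.induct)
    case one
    have "1\<^sub>m n \<in> row_group l" using B(2) by (auto simp: row_group_def SL_one_closed[OF F])
    thus ?case by blast
  next
    case (step i j x A)
    then obtain D where D: "D \<in> row_group l" "quot A = quot D" by blast
    obtain D' where D': "D' \<in> row_group l" "quot (elem_mat n i j x) = quot D'"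
      using elem step.hyps by blast
    have "A \<in> carrier G"
      using step.hyps(5)
      by (induction rule: elem_group.induct)
         (auto intro!: SL_mult_closed[OF F] elem_mat_SL[OF F] SL_one_closed[OF F])
    hence "quot (elem_mat n i j x * A) = quot (D' * D)"
      using Q.hom_mult[of "elem_mat n i j x" A] Q.hom_mult[of D' D] D D' carr
        elem_mat_SL[OF F step.hyps(4,1,2,3)] by simp
    thus ?case using row_group_mult(1)[OF D'(1) D(1) B(2)] by blast
  qed
  have comm: "quot (A * A') = quot (A' * A)" if A: "A \<in> carrier G" "A' \<in> carrier G" for A A'
  proof -
    obtain D D' where D: "D \<in> row_group l" "quot A = quot D" "D' \<in> row_group l" "quot A' = quot D'"
      using all A by meson
    show ?thesis
      using Q.hom_mult[of A A'] Q.hom_mult[of A' A] Q.hom_mult[of D D'] Q.hom_mult[of D' D]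
        row_group_mult(2)[OF D(1,3) B(2)] D carr A by simp
  qed
  have elem_N: "elem_mat n i j x \<in> N" if ij: "i < n" "j < n" "i \<noteq> j" and x: "x \<in> F" for i j x
  proof -
    \<comment> \<open>Conjugation by the diagonal matrix with 2 at i and 1/2 at j turns the
      transvection of y into that of 4 y. In an abelian quotient both agree, so the transvection of
      3 y is trivial; y = x / 3 gives every x.\<close>
    define d where "d = (\<lambda>a. if a = i then 2 else if a = j then 1 / 2 else (1 :: 'a))"
    define D where "D = multrow_mat n i 2 * multrow_mat n j (1 / 2 :: 'a)"
    have Dm: "D \<in> carrier_mat n n" by (simp add: D_def mult_carrier_mat[where n=n])
    have DX: "(D * X) $$ (a, b) = d a * X $$ (a, b)" if X: "X \<in> carrier_mat n n" "a < n" "b < n" for X a b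
    proof -
      have "D * X = multrow_mat n i 2 * (multrow_mat n j (1 / 2) * X)"
        unfolding D_def by (rule assoc_mult_mat[OF multrow_mat_carrier multrow_mat_carrier X(1)])
      also have "\<dots> = multrow i 2 (multrow j (1 / 2) X)"
        by (simp add: multrow_mat[OF X(1)] multrow_mat[of "multrow_mat n j (1 / 2) * X" n n] mult_carrier_mat[OF multrow_mat_carrier X(1)])
      finally show ?thesis using X ij by (simp add: d_def)
    qed
    have Didx: "D $$ (a, b) = (if a = b then d a else 0)" if "a < n" "b < n" for a b
      using DX[OF one_carrier_mat that] right_mult_one_mat[OF Dm] that by simp
    have "det D = 1"
      using det_mult[of "multrow_mat n i 2" n "multrow_mat n j (1 / 2 :: 'a)"] ij by (simp add: D_def det_multrow_mat)
    moreover have "d a \<in> F" for a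
      using subfield_of_nat[OF F, of 2] subfield_1[OF F] subfield_divide[OF F, of 1 2] by (auto simp: d_def)
    ultimately have D: "D \<in> carrier G" using Dm subfield_0[OF F] by (auto simp: SL_carrier_iff Didx)
    have XD: "(X * D) $$ (a, b) = X $$ (a, b) * d b" if X: "X \<in> carrier_mat n n" "a < n" "b < n" for X a b
    proof -
      have "(X * D) $$ (a, b) = (\<Sum>r\<in>{0..<n}. X $$ (a, r) * D $$ (r, b))"
        using X Dm by (simp add: scalar_prod_def)
      also have "\<dots> = (\<Sum>r\<in>{0..<n}. if r = b then X $$ (a, b) * d b else 0)"
        using X by (intro sum.cong) (auto simp: Didx)
      finally show ?thesis using X by simp
    qed
    have eq: "D * elem_mat n i j y = elem_mat n i j (4 * y) * D" for y
    proof (rule eq_matI)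
      fix a b assume "a < dim_row (elem_mat n i j (4 * y) * D)" "b < dim_col (elem_mat n i j (4 * y) * D)"
      hence "a < n" "b < n" using Dm by (auto simp: elem_mat_def)
      thus "(D * elem_mat n i j y) $$ (a, b) = (elem_mat n i j (4 * y) * D) $$ (a, b)"
        using ij DX[OF elem_mat_carrier] XD[OF elem_mat_carrier] by (auto simp: index_elem_mat d_def)
    qed (use Dm in \<open>auto simp: elem_mat_def\<close>)
    define y where "y = x / 3"
    have "of_nat 3 \<in> F" by (rule subfield_of_nat[OF F])
    hence y: "y \<in> F" unfolding y_def using x subfield_divide[OF F] by simp
    have "of_nat 4 \<in> F" by (rule subfield_of_nat[OF F])
    hence y4: "4 * y \<in> F" using y subfield_mult[OF F] by simp
    note E = elem_mat_SL[OF F y ij] elem_mat_SL[OF F y4 ij] elem_mat_SL[OF F x ij]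
    have "quot (elem_mat n i j (4 * y) * D) = quot (elem_mat n i j y * D)"
      using comm[OF D E(1)] eq[of y] by simp
    hence "quot (elem_mat n i j (4 * y)) = quot (elem_mat n i j y)"
      using Q.hom_mult[of _ D] D E Q.H.right_cancel[of "quot D"] by simp
    moreover have "elem_mat n i j (4 * y) = elem_mat n i j x * elem_mat n i j y"
      using ij by (simp add: elem_mat_mult y_def field_simps)
    ultimately have "quot (elem_mat n i j x) \<otimes>\<^bsub>G Mod N\<^esub> quot (elem_mat n i j y) = quot (elem_mat n i j y)"
      using Q.hom_mult[OF E(3,1)] by simp
    hence "quot (elem_mat n i j x) = \<one>\<^bsub>G Mod N\<^esub>"
      using Q.H.r_cancel_one Q.hom_closed E by metis
    thus ?thesis using quot_eq_one_iff E by blast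
  qed
  have "A \<in> N" if "A \<in> carrier G" for A
    using SL_elem_group[OF F that]
  proof (induction rule: elem_group.induct)
    case (step i j x A)
    thus ?case using subgroup.m_closed[OF normal_imp_subgroup[OF normal]] elem_N by fastforce
  qed (rule one_in_N)
  thus ?thesis using N_sub by blast
qed

end

section \<open>Quotients of topological groups\<close>

locale top_group = group G for G (structure) +
  fixes T
  assumes hausdorff: "hausdorff_topological_group G T"
begin

lemma topspace_eq [simp]: "topspace T = carrier G"
  using hausdorff by (simp add: hausdorff_topological_group_def)

lemma Hausdorff: "Hausdorff_space T"
  using hausdorff by (simp add: hausdorff_topological_group_def)

lemma continuous_mult: "continuous_map (prod_topology T T) T (\<lambda>(x, y). x \<otimes> y)"
  using hausdorff by (simp add: hausdorff_topological_group_def)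

lemma continuous_inv: "continuous_map T T (\<lambda>x. inv x)"
  using hausdorff by (simp add: hausdorff_topological_group_def)

lemma openin_carrier: "openin T U \<Longrightarrow> U \<subseteq> carrier G"
  using openin_subset by fastforce

lemma continuous_mult_map:
  assumes "continuous_map X T f" "continuous_map X T g"
  shows "continuous_map X T (\<lambda>x. f x \<otimes> g x)"
  using continuous_map_compose[OF continuous_map_pairedI[OF assms] continuous_mult]
  by (simp add: o_def)

lemma continuous_mult_left: "a \<in> carrier G \<Longrightarrow> continuous_map T T (\<lambda>x. a \<otimes> x)"
  by (rule continuous_mult_map) auto

lemma continuous_mult_right: "a \<in> carrier G \<Longrightarrow> continuous_map T T (\<lambda>x. x \<otimes> a)"
  by (rule continuous_mult_map) auto

lemma openin_mult_left: "openin T U \<Longrightarrow> a \<in> carrier G \<Longrightarrow> openin T {x \<in> carrier G. a \<otimes> x \<in> U}"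
  using openin_continuous_map_preimage[OF continuous_mult_left] by fastforce

lemma openin_mult_right: "openin T U \<Longrightarrow> a \<in> carrier G \<Longrightarrow> openin T {x \<in> carrier G. x \<otimes> a \<in> U}"
  using openin_continuous_map_preimage[OF continuous_mult_right] by fastforce

lemma openin_inv: "openin T U \<Longrightarrow> openin T {x \<in> carrier G. inv x \<in> U}"
  using openin_continuous_map_preimage[OF continuous_inv] by fastforce

lemma mult_inv_mult:
  assumes "x \<in> carrier G" "y \<in> carrier G"
  shows "x \<otimes> (inv x \<otimes> y) = y"
  using m_assoc[OF assms(1) inv_closed[OF assms(1)] assms(2)] assms by simp

lemma mult_nbhds:
  assumes "openin T W" "x \<in> carrier G" "y \<in> carrier G" "x \<otimes> y \<in> W"
  obtains U V where "openin T U" "openin T V" "x \<in> U" "y \<in> V" "\<And>u v. u \<in> U \<Longrightarrow> v \<in> V \<Longrightarrow> u \<otimes> v \<in> W"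
proof -
  let ?S = "{z \<in> topspace (prod_topology T T). (\<lambda>(x, y). x \<otimes> y) z \<in> W}"
  have "openin (prod_topology T T) ?S"
    by (rule openin_continuous_map_preimage[OF continuous_mult assms(1)])
  moreover have "(x, y) \<in> ?S" using assms by simp
  ultimately obtain U V where UV: "openin T U" "openin T V" "x \<in> U" "y \<in> V" and sub: "U \<times> V \<subseteq> ?S"
    using openin_prod_topology_alt[of T T ?S] by meson
  show ?thesis
  proof (rule that[OF UV])
    fix u v assume "u \<in> U" "v \<in> V"
    hence "(u, v) \<in> ?S" using sub by (intro subsetD[OF sub]) simp
    thus "u \<otimes> v \<in> W" by simp
  qed
qed

end

lemma hausdorff_topological_groupI:
  assumes "group G" "topspace T = carrier G" "Hausdorff_space T"
    and mult: "\<And>W x y. openin T W \<Longrightarrow> x \<in> carrier G \<Longrightarrow> y \<in> carrier G \<Longrightarrow> x \<otimes>\<^bsub>G\<^esub> y \<in> W \<Longrightarrow>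
      \<exists>U V. openin T U \<and> openin T V \<and> x \<in> U \<and> y \<in> V \<and> (\<forall>u\<in>U. \<forall>v\<in>V. u \<otimes>\<^bsub>G\<^esub> v \<in> W)"
    and inv: "\<And>W x. openin T W \<Longrightarrow> x \<in> carrier G \<Longrightarrow> inv\<^bsub>G\<^esub> x \<in> W \<Longrightarrow>
      \<exists>U. openin T U \<and> x \<in> U \<and> (\<forall>u\<in>U. inv\<^bsub>G\<^esub> u \<in> W)"
  shows "hausdorff_topological_group G T"
  unfolding hausdorff_topological_group_def
proof (intro conjI assms)
  interpret group G by fact
  show "continuous_map (prod_topology T T) T (\<lambda>(x, y). x \<otimes>\<^bsub>G\<^esub> y)"
    unfolding continuous_map
  proof (intro conjI allI impI)
    fix W assume W: "openin T W"
    show "openin (prod_topology T T) {z \<in> topspace (prod_topology T T). (case z of (x, y) \<Rightarrow> x \<otimes>\<^bsub>G\<^esub> y) \<in> W}"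
      unfolding openin_prod_topology_alt
    proof (intro allI impI)
      fix x y assume "(x, y) \<in> {z \<in> topspace (prod_topology T T). (case z of (x, y) \<Rightarrow> x \<otimes>\<^bsub>G\<^esub> y) \<in> W}"
      then obtain U V where UV: "openin T U" "openin T V" "x \<in> U" "y \<in> V" "\<forall>u\<in>U. \<forall>v\<in>V. u \<otimes>\<^bsub>G\<^esub> v \<in> W"
        using mult[OF W, of x y] assms(2) by auto
      moreover have "U \<subseteq> topspace T" "V \<subseteq> topspace T" using UV openin_subset by blast+
      hence "U \<times> V \<subseteq> {z \<in> topspace (prod_topology T T). (case z of (x, y) \<Rightarrow> x \<otimes>\<^bsub>G\<^esub> y) \<in> W}"
        using UV(5) by auto
      ultimately show "\<exists>U V. openin T U \<and> openin T V \<and> x \<in> U \<and> y \<in> V \<and>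
          U \<times> V \<subseteq> {z \<in> topspace (prod_topology T T). (case z of (x, y) \<Rightarrow> x \<otimes>\<^bsub>G\<^esub> y) \<in> W}"
        by blast
    qed
  qed (use assms(2) in auto)
  show "continuous_map T T (\<lambda>x. inv\<^bsub>G\<^esub> x)"
    unfolding continuous_map
  proof (intro conjI allI impI)
    fix W assume W: "openin T W"
    show "openin T {x \<in> topspace T. inv\<^bsub>G\<^esub> x \<in> W}"
    proof (subst openin_subopen, intro ballI)
      fix x assume "x \<in> {x \<in> topspace T. inv\<^bsub>G\<^esub> x \<in> W}"
      then obtain U where U: "openin T U" "x \<in> U" "\<forall>u\<in>U. inv\<^bsub>G\<^esub> u \<in> W"
        using inv[OF W, of x] assms(2) by auto
      moreover have "U \<subseteq> topspace T" using U openin_subset by blast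
      ultimately show "\<exists>U. openin T U \<and> x \<in> U \<and> U \<subseteq> {x \<in> topspace T. inv\<^bsub>G\<^esub> x \<in> W}" by blast
    qed
  qed (use assms(2) in auto)
qed

lemma top_group_iff: "top_group G T \<longleftrightarrow> hausdorff_topological_group G T"
  by (auto simp: top_group_def top_group_axioms_def hausdorff_topological_group_def)

text \<open>The quotient is given by an arbitrary surjection with closed kernel instead of the coset
  map, so that an iterated quotient can be viewed directly as a quotient of the original
  group.\<close>

locale top_group_quotient = top_group G T + group_hom G Q \<phi>
  for G (structure) and T and Q and \<phi> +
  assumes surj: "\<phi> ` carrier G = carrier Q"
    and closed_kernel: "closedin T (kernel G Q \<phi>)"
begin

abbreviation QT where "QT \<equiv> quotient_topology T \<phi>"

lemma topspace_QT: "topspace QT = carrier Q"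
  using quotient_imp_surjective_map[OF quotient_map_quotient_topology[of T \<phi>]] surj by simp

lemma openin_QT: "openin QT U \<longleftrightarrow> U \<subseteq> carrier Q \<and> openin T {x \<in> carrier G. \<phi> x \<in> U}"
  by (simp add: openin_quotient_topology surj)

text \<open>The saturation of \<open>U\<close> is a union of translates of \<open>U\<close> by
  elements of the kernel, and translates of open sets are open.\<close>

lemma openin_image:
  assumes "openin T U"
  shows "openin QT (\<phi> ` U)"
  unfolding openin_QT
proof
  note U = openin_carrier[OF assms]
  show "\<phi> ` U \<subseteq> carrier Q" using U by auto
  show "openin T {x \<in> carrier G. \<phi> x \<in> \<phi> ` U}"
  proof (subst openin_subopen, intro ballI)
    fix x assume "x \<in> {x \<in> carrier G. \<phi> x \<in> \<phi> ` U}"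
    hence x: "x \<in> carrier G" and "\<phi> x \<in> \<phi> ` U" by simp_all
    then obtain u where u: "u \<in> U" "\<phi> x = \<phi> u" by (elim imageE)
    have uG: "u \<in> carrier G" using u(1) U by (rule subsetD[rotated])
    define k where "k = inv x \<otimes> u"
    have k: "k \<in> carrier G" "\<phi> k = \<one>\<^bsub>Q\<^esub>" using x u uG by (auto simp: k_def)
    have xk: "x \<otimes> k = u" unfolding k_def using x uG by (rule mult_inv_mult)
    have "openin T {y \<in> carrier G. y \<otimes> k \<in> U}" by (rule openin_mult_right[OF assms k(1)])
    moreover have "x \<in> {y \<in> carrier G. y \<otimes> k \<in> U}" using x u xk by simp
    moreover have "{y \<in> carrier G. y \<otimes> k \<in> U} \<subseteq> {x \<in> carrier G. \<phi> x \<in> \<phi> ` U}"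
    proof
      fix y assume y: "y \<in> {y \<in> carrier G. y \<otimes> k \<in> U}"
      hence "\<phi> (y \<otimes> k) = \<phi> y" using k(1,2) by simp
      hence "\<phi> y \<in> \<phi> ` U" using y by (intro image_eqI[of _ _ "y \<otimes> k"]) auto
      thus "y \<in> {x \<in> carrier G. \<phi> x \<in> \<phi> ` U}" using y by simp
    qed
    ultimately show "\<exists>V. openin T V \<and> x \<in> V \<and> V \<subseteq> {x \<in> carrier G. \<phi> x \<in> \<phi> ` U}" by blast
  qed
qed

lemma hausdorff_quotient: "hausdorff_topological_group Q QT"
proof (rule hausdorff_topological_groupI)
  show "Group.group Q" by (rule H.group_axioms)
  show "topspace QT = carrier Q" by (rule topspace_QT)
  show "Hausdorff_space QT"
    unfolding Hausdorff_space_def topspace_QT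
  proof (intro allI impI, elim conjE)
    fix q r assume qr: "q \<in> carrier Q" "r \<in> carrier Q" "q \<noteq> r"
    obtain x y where x: "x \<in> carrier G" "q = \<phi> x" and y: "y \<in> carrier G" "r = \<phi> y"
      using qr surj by (metis imageE)
    \<comment> \<open>An open set containing x^(-1) y. Continuity of multiplication gives
      \<open>U\<close> around x^(-1) and \<open>V\<close> around y whose products avoid the kernel,
      and then the images of the inverse of \<open>U\<close> and of \<open>V\<close> are
      disjoint.\<close>
    let ?W = "carrier G - kernel G Q \<phi>"
    have W: "openin T ?W" using closed_kernel by (simp add: closedin_def)
    have "inv x \<otimes> y \<in> ?W"
    proof -
      have "\<phi> (inv x \<otimes> y) = inv\<^bsub>Q\<^esub> q \<otimes>\<^bsub>Q\<^esub> r" using x y by simp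
      moreover have "inv\<^bsub>Q\<^esub> q \<otimes>\<^bsub>Q\<^esub> r \<noteq> \<one>\<^bsub>Q\<^esub>"
        using qr by (metis H.inv_closed H.inv_equality H.inv_inv)
      ultimately show ?thesis using x y by (simp add: kernel_def)
    qed
    then obtain U V where UV: "openin T U" "openin T V" "inv x \<in> U" "y \<in> V"
      "\<And>u v. u \<in> U \<Longrightarrow> v \<in> V \<Longrightarrow> u \<otimes> v \<in> ?W"
      using mult_nbhds[OF W, of "inv x" y] x y by blast
    let ?U = "{z \<in> carrier G. inv z \<in> U}"
    have "disjnt (\<phi> ` ?U) (\<phi> ` V)"
      unfolding disjnt_iff
    proof safe
      fix u v assume uv: "u \<in> carrier G" "inv u \<in> U" "v \<in> V" "\<phi> u = \<phi> v"
      have "v \<in> carrier G" using uv openin_carrier UV(2) by blast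
      hence "inv u \<otimes> v \<in> kernel G Q \<phi>" using uv by (simp add: kernel_def)
      thus False using UV(5)[OF uv(2,3)] by blast
    qed
    moreover have "q \<in> \<phi> ` ?U" "r \<in> \<phi> ` V" using x y UV by auto
    moreover have "openin QT (\<phi> ` ?U)" "openin QT (\<phi> ` V)"
      using openin_image openin_inv UV by blast+
    ultimately show "\<exists>U V. openin QT U \<and> openin QT V \<and> q \<in> U \<and> r \<in> V \<and> disjnt U V" by blast
  qed
next
  fix W q r assume W: "openin QT W" and qr: "q \<in> carrier Q" "r \<in> carrier Q" "q \<otimes>\<^bsub>Q\<^esub> r \<in> W"
  obtain x y where x: "x \<in> carrier G" "q = \<phi> x" and y: "y \<in> carrier G" "r = \<phi> y"
    using qr surj by (metis imageE)
  have 1: "openin T {x \<in> carrier G. \<phi> x \<in> W}" using W openin_QT by blast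
  have 2: "x \<otimes> y \<in> {x \<in> carrier G. \<phi> x \<in> W}" using x y qr by simp
  obtain U V where UV: "openin T U" "openin T V" "x \<in> U" "y \<in> V"
      "\<And>u v. u \<in> U \<Longrightarrow> v \<in> V \<Longrightarrow> u \<otimes> v \<in> {x \<in> carrier G. \<phi> x \<in> W}"
    using mult_nbhds[OF 1 x(1) y(1) 2] by blast
  have "u \<otimes>\<^bsub>Q\<^esub> v \<in> W" if uv: "u \<in> \<phi> ` U" "v \<in> \<phi> ` V" for u v
  proof -
    obtain u' v' where *: "u' \<in> U" "v' \<in> V" "u = \<phi> u'" "v = \<phi> v'" using uv by blast
    have "u' \<in> carrier G" "v' \<in> carrier G" using * UV(1,2) openin_carrier by blast+
    thus ?thesis using UV(5)[OF *(1,2)] * by simp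
  qed
  thus "\<exists>U V. openin QT U \<and> openin QT V \<and> q \<in> U \<and> r \<in> V \<and> (\<forall>u\<in>U. \<forall>v\<in>V. u \<otimes>\<^bsub>Q\<^esub> v \<in> W)"
    using UV(3,4) x y openin_image[OF UV(1)] openin_image[OF UV(2)]
    by (intro exI[of _ "\<phi> ` U"] exI[of _ "\<phi> ` V"]) auto
next
  fix W q assume W: "openin QT W" and q: "q \<in> carrier Q" "inv\<^bsub>Q\<^esub> q \<in> W"
  obtain x where x: "x \<in> carrier G" "q = \<phi> x" using q surj by (metis imageE)
  let ?U = "{z \<in> carrier G. inv z \<in> {x \<in> carrier G. \<phi> x \<in> W}}"
  have "openin T {x \<in> carrier G. \<phi> x \<in> W}" using W openin_QT by blast
  hence "openin QT (\<phi> ` ?U)" by (intro openin_image openin_inv)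
  moreover have "q \<in> \<phi> ` ?U" using x q by auto
  moreover have "\<forall>u\<in>\<phi> ` ?U. inv\<^bsub>Q\<^esub> u \<in> W" by auto
  ultimately show "\<exists>U. openin QT U \<and> q \<in> U \<and> (\<forall>u\<in>U. inv\<^bsub>Q\<^esub> u \<in> W)" by blast
qed

end

section \<open>Neighbourhood bases of coarser group topologies\<close>

text \<open>
  A neighbourhood base at the identity of a group topology coarser than \<open>T\<close> in which the closure
  of the trivial subgroup is \<open>N\<close>.
\<close>
definition coarser_group_base :: "('a, 'b) monoid_scheme \<Rightarrow> 'a topology \<Rightarrow> 'a set set \<Rightarrow> 'a set \<Rightarrow> bool" where
  "coarser_group_base G T \<V> N \<longleftrightarrow>
     \<V> \<noteq> {} \<and> \<Inter>\<V> = N \<and>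
     (\<forall>V\<in>\<V>. openin T V \<and> \<one>\<^bsub>G\<^esub> \<in> V) \<and>
     (\<forall>V\<in>\<V>. \<forall>V'\<in>\<V>. \<exists>W\<in>\<V>. W \<subseteq> V \<inter> V') \<and>
     (\<forall>V\<in>\<V>. \<exists>W\<in>\<V>. \<forall>x\<in>W. \<forall>y\<in>W. x \<otimes>\<^bsub>G\<^esub> y \<in> V) \<and>
     (\<forall>V\<in>\<V>. \<exists>W\<in>\<V>. \<forall>x\<in>W. inv\<^bsub>G\<^esub> x \<in> V) \<and>
     (\<forall>V\<in>\<V>. \<forall>g\<in>carrier G. \<exists>W\<in>\<V>. \<forall>x\<in>W. g \<otimes>\<^bsub>G\<^esub> x \<otimes>\<^bsub>G\<^esub> inv\<^bsub>G\<^esub> g \<in> V)"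

text \<open>The sets \<open>N <#> U\<close> are the basic neighbourhoods of the identity in the
  pullback of the quotient topology by \<open>N\<close>. The condition is a criterion for minimality
  of the quotient, phrased by neighbourhood bases in the group itself.\<close>

definition minimal_modulo :: "('a, 'b) monoid_scheme \<Rightarrow> 'a topology \<Rightarrow> 'a set \<Rightarrow> bool" where
  "minimal_modulo G T N \<longleftrightarrow>
     (\<forall>\<V> U. coarser_group_base G T \<V> N \<longrightarrow> openin T U \<longrightarrow> \<one>\<^bsub>G\<^esub> \<in> U \<longrightarrow> (\<exists>V\<in>\<V>. V \<subseteq> N <#>\<^bsub>G\<^esub> U))"

context top_group_quotient
begin

text \<open>Preimages of neighbourhoods of the identity inherit the group conditions. The Hausdorff
  property enters in the intersection: a point outside the kernel is excluded by the preimage of the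
  complement of its image.\<close>

lemma coarser_group_base_preimage:
  assumes T': "hausdorff_topological_group Q T'" and coarser: "\<And>U. openin T' U \<Longrightarrow> openin QT U"
  shows "coarser_group_base G T {{x \<in> carrier G. \<phi> x \<in> W} |W. openin T' W \<and> \<one>\<^bsub>Q\<^esub> \<in> W} (kernel G Q \<phi>)"
    (is "coarser_group_base G T ?V _")
proof -
  interpret T': top_group Q T' using T' by (simp add: top_group_iff)
  have V: "{x \<in> carrier G. \<phi> x \<in> W} \<in> ?V" if "openin T' W" "\<one>\<^bsub>Q\<^esub> \<in> W" for W using that by blast
  have top: "openin T' (carrier Q)" by (metis T'.topspace_eq openin_topspace)
  show ?thesis
    unfolding coarser_group_base_def
  proof (intro conjI ballI)
    show "?V \<noteq> {}" using V[OF top] by blast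
    show "\<Inter>?V = kernel G Q \<phi>"
    proof
      show "kernel G Q \<phi> \<subseteq> \<Inter>?V" by (auto simp: kernel_def)
      show "\<Inter>?V \<subseteq> kernel G Q \<phi>"
      proof
        fix x assume x: "x \<in> \<Inter>?V"
        have xG: "x \<in> carrier G" using InterD[OF x V[OF top]] by simp
        have "\<phi> x = \<one>\<^bsub>Q\<^esub>"
        proof (rule ccontr)
          assume ne: "\<phi> x \<noteq> \<one>\<^bsub>Q\<^esub>"
          have "closedin T' {\<phi> x}" using xG by (intro closedin_Hausdorff_singleton T'.Hausdorff) simp
          hence "openin T' (carrier Q - {\<phi> x})" by (simp add: closedin_def)
          hence "{y \<in> carrier G. \<phi> y \<in> carrier Q - {\<phi> x}} \<in> ?V" by (rule V) (use ne in auto)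
          hence "x \<in> {y \<in> carrier G. \<phi> y \<in> carrier Q - {\<phi> x}}" using x by (rule InterD[rotated])
          thus False by simp
        qed
        thus "x \<in> kernel G Q \<phi>" using xG by (simp add: kernel_def)
      qed
    qed
  next
    fix V assume "V \<in> ?V"
    then obtain W where W: "V = {x \<in> carrier G. \<phi> x \<in> W}" "openin T' W" "\<one>\<^bsub>Q\<^esub> \<in> W" by blast
    show "openin T V" using coarser[OF W(2)] by (simp add: W(1) openin_QT)
    show "\<one> \<in> V" using W by simp
    obtain A B where AB: "openin T' A" "openin T' B" "\<one>\<^bsub>Q\<^esub> \<in> A" "\<one>\<^bsub>Q\<^esub> \<in> B"
      "\<And>a b. a \<in> A \<Longrightarrow> b \<in> B \<Longrightarrow> a \<otimes>\<^bsub>Q\<^esub> b \<in> W"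
      using T'.mult_nbhds[OF W(2), of "\<one>\<^bsub>Q\<^esub>" "\<one>\<^bsub>Q\<^esub>"] W(3) by auto
    have "{x \<in> carrier G. \<phi> x \<in> A \<inter> B} \<in> ?V" using AB by (intro V openin_Int) auto
    moreover have "\<forall>x\<in>{x \<in> carrier G. \<phi> x \<in> A \<inter> B}. \<forall>y\<in>{x \<in> carrier G. \<phi> x \<in> A \<inter> B}. x \<otimes> y \<in> V"
      using AB(5) by (simp add: W(1))
    ultimately show "\<exists>W\<in>?V. \<forall>x\<in>W. \<forall>y\<in>W. x \<otimes> y \<in> V" by (rule rev_bexI)
    have "{x \<in> carrier G. \<phi> x \<in> {x \<in> carrier Q. inv\<^bsub>Q\<^esub> x \<in> W}} \<in> ?V"
      using W T'.openin_inv by (intro V) auto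
    moreover have "\<forall>x\<in>{x \<in> carrier G. \<phi> x \<in> {x \<in> carrier Q. inv\<^bsub>Q\<^esub> x \<in> W}}. inv x \<in> V"
      by (simp add: W(1))
    ultimately show "\<exists>W\<in>?V. \<forall>x\<in>W. inv x \<in> V" by (rule rev_bexI)
    show "\<exists>W\<in>?V. \<forall>x\<in>W. g \<otimes> x \<otimes> inv g \<in> V" if g: "g \<in> carrier G" for g
    proof -
      let ?W' = "{y \<in> carrier Q. \<phi> g \<otimes>\<^bsub>Q\<^esub> y \<in> {x \<in> carrier Q. x \<otimes>\<^bsub>Q\<^esub> inv\<^bsub>Q\<^esub> \<phi> g \<in> W}}"
      have "openin T' ?W'" using g W(2) by (intro T'.openin_mult_left T'.openin_mult_right) auto
      moreover have "\<one>\<^bsub>Q\<^esub> \<in> ?W'" using g W(3) by simp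
      ultimately have "{x \<in> carrier G. \<phi> x \<in> ?W'} \<in> ?V" by (rule V)
      moreover have "\<forall>x\<in>{x \<in> carrier G. \<phi> x \<in> ?W'}. g \<otimes> x \<otimes> inv g \<in> V"
        using g by (simp add: W(1))
      ultimately show ?thesis by (rule rev_bexI)
    qed
    show "\<exists>W\<in>?V. W \<subseteq> V \<inter> V'" if V': "V' \<in> ?V" for V'
    proof -
      obtain W' where W': "V' = {x \<in> carrier G. \<phi> x \<in> W'}" "openin T' W'" "\<one>\<^bsub>Q\<^esub> \<in> W'"
        using V' by blast
      have "{x \<in> carrier G. \<phi> x \<in> W \<inter> W'} \<in> ?V" using W W' by (intro V openin_Int) auto
      moreover have "{x \<in> carrier G. \<phi> x \<in> W \<inter> W'} \<subseteq> V \<inter> V'" using W W' by auto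
      ultimately show ?thesis by (rule rev_bexI)
    qed
  qed
qed

text \<open>Translations reduce the comparison of two group topologies to neighbourhoods of the
  identity, where \<open>minimal_modulo\<close> applies. A factor from the kernel disappears under
  \<phi>, so the product of the kernel with a set has the same image as the set.\<close>

lemma minimal_quotient:
  assumes "minimal_modulo G T (kernel G Q \<phi>)"
  shows "minimal_topological_group Q QT"
  unfolding minimal_topological_group_def
proof (intro conjI notI hausdorff_quotient, elim exE conjE)
  fix T' assume T': "hausdorff_topological_group Q T'" "T' \<noteq> QT" "\<forall>U. openin T' U \<longrightarrow> openin QT U"
  interpret T': top_group Q T' using T' by (simp add: top_group_iff)
  interpret QT: top_group Q QT using hausdorff_quotient by (simp add: top_group_iff)
  have "openin T' A" if A: "openin QT A" for A
  proof (subst openin_subopen, intro ballI)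
    fix q assume q: "q \<in> A"
    have AQ: "A \<subseteq> carrier Q" by (rule QT.openin_carrier[OF A])
    have qQ: "q \<in> carrier Q" using q AQ by blast
    let ?U = "{x \<in> carrier G. \<phi> x \<in> {y \<in> carrier Q. y \<otimes>\<^bsub>Q\<^esub> q \<in> A}}"
    have "openin T ?U" using QT.openin_mult_right[OF A qQ] openin_QT by blast
    moreover have "\<one> \<in> ?U" using q qQ by simp
    ultimately obtain V where V: "V \<in> {{x \<in> carrier G. \<phi> x \<in> W} |W. openin T' W \<and> \<one>\<^bsub>Q\<^esub> \<in> W}"
      "V \<subseteq> kernel G Q \<phi> <#> ?U"
      using coarser_group_base_preimage[OF T'(1)] T'(3) assms unfolding minimal_modulo_def by meson
    then obtain W where W: "V = {x \<in> carrier G. \<phi> x \<in> W}" "openin T' W" "\<one>\<^bsub>Q\<^esub> \<in> W" by blast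
    let ?B = "{r \<in> carrier Q. r \<otimes>\<^bsub>Q\<^esub> inv\<^bsub>Q\<^esub> q \<in> W}"
    have "openin T' ?B" using W(2) qQ by (intro T'.openin_mult_right) auto
    moreover have "q \<in> ?B" using qQ W(3) by simp
    moreover have "?B \<subseteq> A"
    proof
      fix r assume r: "r \<in> ?B"
      then obtain x where x: "x \<in> carrier G" "\<phi> x = r \<otimes>\<^bsub>Q\<^esub> inv\<^bsub>Q\<^esub> q"
        using surj qQ by (metis (no_types, lifting) H.inv_closed H.m_closed imageE mem_Collect_eq)
      hence "x \<in> V" using r W(1) by simp
      then obtain k u where ku: "x = k \<otimes> u" "k \<in> kernel G Q \<phi>" "u \<in> ?U"
        using V(2) by (auto simp: set_mult_def)
      hence "\<phi> x = \<phi> u" by (simp add: kernel_def)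
      hence "r \<otimes>\<^bsub>Q\<^esub> inv\<^bsub>Q\<^esub> q \<otimes>\<^bsub>Q\<^esub> q \<in> A" using ku x by simp
      thus "r \<in> A" using r qQ by (simp add: H.m_assoc)
    qed
    ultimately show "\<exists>B. openin T' B \<and> q \<in> B \<and> B \<subseteq> A" by blast
  qed
  hence "T' = QT" using T'(3) by (auto simp: topology_eq)
  thus False using T'(2) by simp
qed

end

section \<open>Iterated quotients, the centre, and induced topologies\<close>

lemma quotient_topology_compose:
  "quotient_topology (quotient_topology T f) g = quotient_topology T (g \<circ> f)"
proof -
  have top: "topspace (quotient_topology T f) = f ` topspace T"
    using quotient_imp_surjective_map[OF quotient_map_quotient_topology] by metis
  have "{x \<in> topspace T. f x \<in> {y \<in> f ` topspace T. g y \<in> U}} = {x \<in> topspace T. g (f x) \<in> U}" for U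
    by auto
  hence "openin (quotient_topology (quotient_topology T f) g) U \<longleftrightarrow> openin (quotient_topology T (g \<circ> f)) U" for U
    by (auto simp: openin_quotient_topology top image_image)
  thus ?thesis by (simp add: topology_eq)
qed

context top_group
begin

lemma coset_quotient:
  assumes "N \<lhd> G" "closedin T N"
  shows "top_group_quotient G T (G Mod N) (\<lambda>x. N #> x)" "kernel G (G Mod N) (\<lambda>x. N #> x) = N"
proof -
  interpret normal N G by fact
  show ker: "kernel G (G Mod N) (\<lambda>x. N #> x) = N"
    using coset_join1[OF _ _ subgroup_axioms] coset_join2[OF _ subgroup_axioms] subset
    by (auto simp: kernel_def FactGroup_def)
  show "top_group_quotient G T (G Mod N) (\<lambda>x. N #> x)"
    unfolding top_group_quotient_def top_group_quotient_axioms_def ker group_hom_def group_hom_axioms_def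
    using r_coset_hom_Mod factorgroup_is_group assms(2) top_group_axioms group_axioms
    by (auto simp: FactGroup_def RCOSETS_def)
qed

lemma totally_minimalI:
  assumes "\<And>N. N \<lhd> G \<Longrightarrow> closedin T N \<Longrightarrow> minimal_modulo G T N"
  shows "totally_minimal_topological_group G T"
  unfolding totally_minimal_topological_group_def
proof (intro conjI allI impI hausdorff)
  fix N assume "N \<lhd> G \<and> closedin T N"
  hence N: "N \<lhd> G" "closedin T N" by auto
  show "minimal_topological_group (G Mod N) (coset_topology G T N)"
    by (rule top_group_quotient.minimal_quotient[OF coset_quotient(1)[OF N]])
       (simp only: coset_quotient(2)[OF N] assms[OF N])
qed

text \<open>A quotient of G/Z by P is the quotient of G by the kernel of the composite map, so the
  assumption on G covers it. Working with arbitrary surjections replaces the third isomorphism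
  theorem.\<close>

lemma totally_minimal_quotient:
  assumes min: "\<And>N. N \<lhd> G \<Longrightarrow> closedin T N \<Longrightarrow> minimal_modulo G T N"
    and Z: "Z \<lhd> G" "closedin T Z"
  shows "totally_minimal_topological_group (G Mod Z) (coset_topology G T Z)"
  unfolding totally_minimal_topological_group_def
proof (intro conjI allI impI)
  interpret Q: top_group_quotient G T "G Mod Z" "\<lambda>x. Z #> x" by (rule coset_quotient[OF Z])
  show haus: "hausdorff_topological_group (G Mod Z) (coset_topology G T Z)"
    by (rule Q.hausdorff_quotient)
  interpret QT: top_group "G Mod Z" "coset_topology G T Z" using haus by (simp add: top_group_iff)
  fix P assume "P \<lhd> G Mod Z \<and> closedin (coset_topology G T Z) P"
  hence P: "P \<lhd> G Mod Z" "closedin (coset_topology G T Z) P" by auto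
  interpret R: top_group_quotient "G Mod Z" "coset_topology G T Z" "G Mod Z Mod P"
    "\<lambda>x. P #>\<^bsub>G Mod Z\<^esub> x" by (rule QT.coset_quotient[OF P])
  let ?\<psi> = "(\<lambda>x. P #>\<^bsub>G Mod Z\<^esub> x) \<circ> (\<lambda>x. Z #> x)"
  have hom: "?\<psi> \<in> hom G (G Mod Z Mod P)" by (intro homI) (simp_all del: mult_FactGroup one_FactGroup)
  have ker: "kernel G (G Mod Z Mod P) ?\<psi> = {x \<in> carrier G. Z #> x \<in> P}"
  proof -
    have "(P #>\<^bsub>G Mod Z\<^esub> (Z #> x) = \<one>\<^bsub>G Mod Z Mod P\<^esub>) = (Z #> x \<in> P)" if "x \<in> carrier G" for x
      using QT.coset_quotient(2)[OF P] Q.hom_closed[OF that] unfolding kernel_def by blast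
    thus ?thesis unfolding kernel_def comp_apply by blast
  qed
  have "closedin T {x \<in> topspace T. Z #> x \<in> P}"
    by (rule closedin_continuous_map_preimage[OF quotient_imp_continuous_map[OF quotient_map_quotient_topology] P(2)])
  hence closed: "closedin T (kernel G (G Mod Z Mod P) ?\<psi>)" by (simp add: ker)
  have surj: "?\<psi> ` carrier G = carrier (G Mod Z Mod P)"
    unfolding image_comp[symmetric] Q.surj R.surj ..
  interpret S: top_group_quotient G T "G Mod Z Mod P" ?\<psi>
    unfolding top_group_quotient_def top_group_quotient_axioms_def group_hom_def group_hom_axioms_def
    using top_group_axioms group_axioms R.H.group_axioms hom closed surj by blast
  show "minimal_topological_group (G Mod Z Mod P) (coset_topology (G Mod Z) (coset_topology G T Z) P)"
    unfolding quotient_topology_compose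
    by (rule S.minimal_quotient[OF min[OF S.normal_kernel closed]])
qed

text \<open>An intersection of equalizers of continuous maps into a Hausdorff space.\<close>

lemma closedin_center: "closedin T (group_center G)"
proof -
  have "closedin T {z \<in> topspace T. z \<otimes> g = g \<otimes> z}" if "g \<in> carrier G" for g
    using that by (intro closedin_continuous_maps_eq[OF Hausdorff] continuous_mult_left continuous_mult_right)
  hence "closedin T (\<Inter>g\<in>carrier G. {z \<in> topspace T. z \<otimes> g = g \<otimes> z})"
    by (intro closedin_Inter) auto
  moreover have "(\<Inter>g\<in>carrier G. {z \<in> topspace T. z \<otimes> g = g \<otimes> z}) = group_center G"
    unfolding group_center_def by auto
  ultimately show ?thesis by simp
qed

text \<open>Injectivity carries the Hausdorff property over. This later produces the coarser
  topology on the rational matrices, from an injective map into a quotient.\<close>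

lemma hausdorff_pullback:
  assumes "Group.group H" "f \<in> hom H G" "inj_on f (carrier H)"
  shows "hausdorff_topological_group H (pullback_topology (carrier H) f T)"
proof -
  interpret f: group_hom H G f
    using assms group_axioms by (simp add: group_hom_def group_hom_axioms_def)
  let ?P = "pullback_topology (carrier H) f T"
  have top: "topspace ?P = carrier H" by (auto simp: topspace_pullback_topology)
  have P: "openin ?P (f -` U \<inter> carrier H)" if "openin T U" for U
    using that by (auto simp: openin_pullback_topology)
  show ?thesis
  proof (rule hausdorff_topological_groupI)
    have "continuous_map ?P T (id \<circ> f)" by (intro continuous_map_pullback continuous_map_id)
    thus "Hausdorff_space ?P"
      using Hausdorff_space_injective_preimage[OF Hausdorff, of ?P f] assms(3) by (simp add: top)
  next
    fix W x y assume W: "openin ?P W" and xy: "x \<in> carrier H" "y \<in> carrier H" "x \<otimes>\<^bsub>H\<^esub> y \<in> W"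
    obtain W' where W': "openin T W'" "W = f -` W' \<inter> carrier H" using W by (auto simp: openin_pullback_topology)
    have "f x \<otimes> f y \<in> W'" using xy W' by simp
    then obtain U V where UV: "openin T U" "openin T V" "f x \<in> U" "f y \<in> V"
      "\<And>u v. u \<in> U \<Longrightarrow> v \<in> V \<Longrightarrow> u \<otimes> v \<in> W'"
      using mult_nbhds[OF W'(1), of "f x" "f y"] xy by auto
    have "\<forall>u\<in>f -` U \<inter> carrier H. \<forall>v\<in>f -` V \<inter> carrier H. u \<otimes>\<^bsub>H\<^esub> v \<in> W"
      using UV(5) W'(2) by auto
    thus "\<exists>U V. openin ?P U \<and> openin ?P V \<and> x \<in> U \<and> y \<in> V \<and> (\<forall>u\<in>U. \<forall>v\<in>V. u \<otimes>\<^bsub>H\<^esub> v \<in> W)"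
      using P UV xy by blast
  next
    fix W x assume W: "openin ?P W" and x: "x \<in> carrier H" "inv\<^bsub>H\<^esub> x \<in> W"
    obtain W' where W': "openin T W'" "W = f -` W' \<inter> carrier H" using W by (auto simp: openin_pullback_topology)
    have "openin ?P (f -` {x \<in> carrier G. inv x \<in> W'} \<inter> carrier H)" by (intro P openin_inv W')
    moreover have "x \<in> f -` {x \<in> carrier G. inv x \<in> W'} \<inter> carrier H" using x W'(2) by simp
    moreover have "\<forall>u\<in>f -` {x \<in> carrier G. inv x \<in> W'} \<inter> carrier H. inv\<^bsub>H\<^esub> u \<in> W" using W'(2) by simp
    ultimately show "\<exists>U. openin ?P U \<and> x \<in> U \<and> (\<forall>u\<in>U. inv\<^bsub>H\<^esub> u \<in> W)" by blast
  qed (use assms top in auto)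
qed

end

lemma (in group) normal_center: "group_center G \<lhd> G"
proof -
  have sub: "z \<in> carrier G" if "z \<in> group_center G" for z
    using that by (simp add: group_center_def)
  have comm: "z \<otimes> g = g \<otimes> z" if "z \<in> group_center G" "g \<in> carrier G" for z g
    using that by (simp add: group_center_def)
  have centerI: "z \<in> group_center G" if "z \<in> carrier G" "\<And>g. g \<in> carrier G \<Longrightarrow> z \<otimes> g = g \<otimes> z" for z
    unfolding group_center_def using that by blast
  have "subgroup (group_center G) G"
  proof
    show "\<one> \<in> group_center G" by (rule centerI) auto
  next
    fix x y assume xy: "x \<in> group_center G" "y \<in> group_center G"
    note x = sub[OF xy(1)] and y = sub[OF xy(2)]
    show "x \<otimes> y \<in> group_center G"
    proof (rule centerI)
      fix g assume g: "g \<in> carrier G"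
      have "x \<otimes> y \<otimes> g = x \<otimes> (g \<otimes> y)" by (simp only: m_assoc[OF x y g] comm[OF xy(2) g])
      also have "\<dots> = g \<otimes> x \<otimes> y" by (simp only: m_assoc[OF x g y, symmetric] comm[OF xy(1) g])
      finally show "x \<otimes> y \<otimes> g = g \<otimes> (x \<otimes> y)" by (simp only: m_assoc[OF g x y])
    qed (use x y in simp)
  next
    fix x assume "x \<in> group_center G"
    note x = sub[OF this] and cx = comm[OF this]
    show "inv x \<in> group_center G"
    proof (rule centerI)
      fix g assume g: "g \<in> carrier G"
      have "inv (x \<otimes> inv g) = inv (inv g \<otimes> x)" using cx[of "inv g"] g by simp
      thus "inv x \<otimes> g = g \<otimes> inv x" using x g by (simp add: inv_mult_group)
    qed (use x in simp)
  qed (use sub in blast)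
  moreover have "g \<otimes> z \<otimes> inv g \<in> group_center G" if g: "g \<in> carrier G" and z: "z \<in> group_center G" for g z
  proof -
    have "g \<otimes> z \<otimes> inv g = z \<otimes> g \<otimes> inv g" by (simp only: comm[OF z g])
    also have "\<dots> = z" using g sub[OF z] by (simp add: m_assoc)
    finally show ?thesis using z by simp
  qed
  ultimately show ?thesis by (simp add: normal_inv_iff)
qed

section \<open>The topology of the special linear group\<close>

text \<open>The maximum norm, submultiplicative because the absolute value is ultrametric. The
  inserted 0 keeps \<open>Max\<close> meaningful for matrices without entries.\<close>

definition mnorm :: "'p::prime_card padic mat \<Rightarrow> real" where
  "mnorm A = Max (insert 0 ((\<lambda>ij. padic_abs (A $$ ij)) ` ({..<dim_row A} \<times> {..<dim_col A})))"

lemma mnorm_ge: "i < dim_row A \<Longrightarrow> j < dim_col A \<Longrightarrow> padic_abs (A $$ (i, j)) \<le> mnorm A"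
  unfolding mnorm_def by (intro Max_ge) auto

lemma mnorm_nonneg [simp]: "0 \<le> mnorm A"
  unfolding mnorm_def by (intro Max_ge) auto

lemma mnorm_leI:
  assumes "0 \<le> c" "\<And>i j. i < dim_row A \<Longrightarrow> j < dim_col A \<Longrightarrow> padic_abs (A $$ (i, j)) \<le> c"
  shows "mnorm A \<le> c"
  unfolding mnorm_def using assms by (subst Max_le_iff) auto

lemma mnorm_lessI:
  assumes "0 < c" "\<And>i j. i < dim_row A \<Longrightarrow> j < dim_col A \<Longrightarrow> padic_abs (A $$ (i, j)) < c"
  shows "mnorm A < c"
  unfolding mnorm_def using assms by (subst Max_less_iff) auto

lemma mnorm_attained:
  assumes "A \<in> carrier_mat n n" "mnorm A > 0"
  shows "\<exists>i<n. \<exists>j<n. padic_abs (A $$ (i, j)) = mnorm A"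
proof -
  have "mnorm A \<in> insert 0 ((\<lambda>ij. padic_abs (A $$ ij)) ` ({..<dim_row A} \<times> {..<dim_col A}))"
    unfolding mnorm_def by (intro Max_in) auto
  then obtain ij where "ij \<in> {..<dim_row A} \<times> {..<dim_col A}" "mnorm A = padic_abs (A $$ ij)"
    using assms(2) by auto
  thus ?thesis using assms(1) by (intro exI[of _ "fst ij"] exI[of _ "snd ij"] conjI) auto
qed

lemma mnorm_eq_0:
  assumes "A \<in> carrier_mat n n" "mnorm A = 0"
  shows "A = 0\<^sub>m n n"
proof (rule eq_matI)
  fix i j assume "i < dim_row (0\<^sub>m n n :: 'a padic mat)" "j < dim_col (0\<^sub>m n n :: 'a padic mat)"
  hence "padic_abs (A $$ (i, j)) \<le> 0" "i < n" "j < n" using mnorm_ge[of i A j] assms by auto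
  thus "A $$ (i, j) = 0\<^sub>m n n $$ (i, j)" using padic_abs_nonneg[of "A $$ (i, j)"]
    by (simp add: order_antisym)
qed (use assms in auto)

lemma mnorm_ultra:
  assumes "A \<in> carrier_mat n m" "B \<in> carrier_mat n m"
  shows "mnorm (A + B) \<le> max (mnorm A) (mnorm B)"
proof (rule mnorm_leI)
  show "0 \<le> max (mnorm A) (mnorm B)" using mnorm_nonneg[of A] by linarith
  fix i j assume "i < dim_row (A + B)" "j < dim_col (A + B)"
  hence ij: "i < n" "j < m" using assms by auto
  hence "(A + B) $$ (i, j) = A $$ (i, j) + B $$ (i, j)" using assms by simp
  thus "padic_abs ((A + B) $$ (i, j)) \<le> max (mnorm A) (mnorm B)"
    using padic_abs_ultra[of "A $$ (i, j)" "B $$ (i, j)"] mnorm_ge[of i A j] mnorm_ge[of i B j] assms ij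
    by (auto simp: le_max_iff_disj)
qed

lemma mnorm_diff_ultra:
  assumes "A \<in> carrier_mat n m" "B \<in> carrier_mat n m"
  shows "mnorm (A - B) \<le> max (mnorm A) (mnorm B)"
proof (rule mnorm_leI)
  show "0 \<le> max (mnorm A) (mnorm B)" using mnorm_nonneg[of A] by linarith
  fix i j assume "i < dim_row (A - B)" "j < dim_col (A - B)"
  hence ij: "i < n" "j < m" using assms by auto
  hence "(A - B) $$ (i, j) = A $$ (i, j) - B $$ (i, j)" using assms by simp
  thus "padic_abs ((A - B) $$ (i, j)) \<le> max (mnorm A) (mnorm B)"
    using padic_abs_diff_ultra[of "A $$ (i, j)" "B $$ (i, j)"] mnorm_ge[of i A j] mnorm_ge[of i B j] assms ij
    by (auto simp: le_max_iff_disj)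
qed

lemma mnorm_diff_commute:
  assumes "A \<in> carrier_mat n m" "B \<in> carrier_mat n m"
  shows "mnorm (A - B) = mnorm (B - A)"
proof -
  have "(\<lambda>ij. padic_abs ((A - B) $$ ij)) ` ({..<n} \<times> {..<m}) = (\<lambda>ij. padic_abs ((B - A) $$ ij)) ` ({..<n} \<times> {..<m})"
    using assms by (intro image_cong) (auto simp: padic_abs_minus_commute)
  thus ?thesis using assms by (simp add: mnorm_def)
qed

lemma diff_eq_diff_add_diff_mat:
  assumes "A \<in> carrier_mat n m" "B \<in> carrier_mat n m" "C \<in> carrier_mat n m"
  shows "A - C = (A - B) + (B - C :: 'a::ab_group_add mat)"
  using assms by (intro eq_matI) auto

lemma mnorm_diff_triangle:
  assumes "A \<in> carrier_mat n m" "B \<in> carrier_mat n m" "C \<in> carrier_mat n m"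
  shows "mnorm (A - C) \<le> max (mnorm (A - B)) (mnorm (B - C))"
proof -
  show ?thesis
    unfolding diff_eq_diff_add_diff_mat[OF assms]
    by (intro mnorm_ultra[where n=n and m=m] minus_carrier_mat assms)
qed

lemma mnorm_eqI:
  assumes "A \<in> carrier_mat n m" "B \<in> carrier_mat n m" "mnorm (A - B) < mnorm A"
  shows "mnorm B = mnorm A"
proof -
  have "A = (A - B) + B" "B = A - (A - B)" using assms by (auto intro!: eq_matI)
  hence "mnorm A \<le> max (mnorm (A - B)) (mnorm B)" "mnorm B \<le> max (mnorm A) (mnorm (A - B))"
    using mnorm_ultra[of "A - B" n m B] mnorm_diff_ultra[of A n m "A - B"] minus_carrier_mat[OF assms(2), of A] assms
    by (metis, metis)
  thus ?thesis using assms(3) by linarith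
qed

lemma mnorm_mult:
  assumes "A \<in> carrier_mat n m" "B \<in> carrier_mat m k"
  shows "mnorm (A * B) \<le> mnorm A * mnorm B"
proof (rule mnorm_leI)
  show "0 \<le> mnorm A * mnorm B" by simp
  fix i j assume "i < dim_row (A * B)" "j < dim_col (A * B)"
  hence ij: "i < n" "j < k" using assms by auto
  have "padic_abs (A $$ (i, r) * B $$ (r, j)) \<le> mnorm A * mnorm B" if "r < m" for r
    unfolding padic_abs_mult using mnorm_ge[of i A r] mnorm_ge[of r B j] assms ij that
    by (intro mult_mono) auto
  hence "padic_abs (\<Sum>r\<in>{0..<m}. A $$ (i, r) * B $$ (r, j)) \<le> mnorm A * mnorm B"
    by (intro padic_abs_sum_le) auto
  moreover have "(A * B) $$ (i, j) = (\<Sum>r\<in>{0..<m}. A $$ (i, r) * B $$ (r, j))"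
    using assms ij by (simp add: scalar_prod_def)
  ultimately show "padic_abs ((A * B) $$ (i, j)) \<le> mnorm A * mnorm B" by simp
qed

lemma mnorm_mult_diff:
  assumes "A \<in> carrier_mat n n" "A' \<in> carrier_mat n n" "B \<in> carrier_mat n n" "B' \<in> carrier_mat n n"
  shows "mnorm (A * B - A' * B') \<le> max (mnorm A * mnorm (B - B')) (mnorm (A - A') * mnorm B')"
proof -
  have "A * B - A' * B' = A * (B - B') + (A - A') * B'"
    unfolding mult_minus_distrib_mat[OF assms(1,3,4)] minus_mult_distrib_mat[OF assms(1,2,4)]
    by (intro diff_eq_diff_add_diff_mat[where n=n and m=n] mult_carrier_mat[where n=n] assms)
  also have "mnorm \<dots> \<le> max (mnorm (A * (B - B'))) (mnorm ((A - A') * B'))"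
    using assms by (intro mnorm_ultra[where n=n and m=n] mult_carrier_mat[where n=n]) auto
  also have "\<dots> \<le> max (mnorm A * mnorm (B - B')) (mnorm (A - A') * mnorm B')"
    using assms by (intro max.mono mnorm_mult[where n=n and m=n and k=n]) auto
  finally show ?thesis .
qed

lemma mnorm_mult_continuous:
  assumes "A \<in> carrier_mat n n" "B \<in> carrier_mat n n" "e > 0"
  obtains d where "d > 0" "\<And>A' B'. A' \<in> carrier_mat n n \<Longrightarrow> B' \<in> carrier_mat n n \<Longrightarrow>
     mnorm (A - A') < d \<Longrightarrow> mnorm (B - B') < d \<Longrightarrow> mnorm (A * B - A' * B') < e"
proof -
  define c where "c = 1 + mnorm A + mnorm B"
  have c: "c > 0" "mnorm A < c" "mnorm B < c" "1 \<le> c"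
    using mnorm_nonneg[of A] mnorm_nonneg[of B] unfolding c_def by linarith+
  define d where "d = min 1 (e / c)"
  have d: "d > 0" "d \<le> 1" "c * d \<le> e" using assms(3) c by (auto simp: d_def min_def field_simps)
  show ?thesis
  proof (rule that[OF d(1)])
    fix A' B' assume *: "A' \<in> carrier_mat n n" "B' \<in> carrier_mat n n" "mnorm (A - A') < d" "mnorm (B - B') < d"
    have "B' = B - (B - B')" using assms *(2) by (intro eq_matI) auto
    hence "mnorm B' \<le> max (mnorm B) (mnorm (B - B'))"
      using mnorm_diff_ultra[OF assms(2) minus_carrier_mat[OF *(2), of B]] by simp
    hence B': "mnorm B' \<le> c" using *(4) d c by linarith
    have 1: "mnorm A * mnorm (B - B') < c * d"
      using *(4) c d by (intro mult_strict_mono) auto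
    have "mnorm (A - A') * mnorm B' \<le> mnorm (A - A') * c" using B' by (intro mult_left_mono) auto
    also have "\<dots> < d * c" using *(3) c by (intro mult_strict_right_mono) auto
    finally show "mnorm (A * B - A' * B') < e"
      using mnorm_mult_diff[OF assms(1) *(1) assms(2) *(2)] 1 d(3) by (simp add: mult.commute)
  qed
qed

text \<open>The identity B' - A' = B' (A - B) A' compares the inverses without recourse to
  determinants.\<close>

lemma mnorm_inverse_continuous:
  assumes A: "A \<in> carrier_mat n n" "A' \<in> carrier_mat n n" "A * A' = 1\<^sub>m n" and "e > 0"
  obtains d where "d > 0" "\<And>B B'. B \<in> carrier_mat n n \<Longrightarrow> B' \<in> carrier_mat n n \<Longrightarrow> B' * B = 1\<^sub>m n \<Longrightarrow>
     mnorm (A - B) < d \<Longrightarrow> mnorm (A' - B') < e"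
proof -
  define c where "c = 1 + mnorm A'"
  have c: "c \<ge> 1" "mnorm A' \<le> c" using mnorm_nonneg[of A'] by (auto simp: c_def)
  define d where "d = min (inverse c) (e / (c * c))"
  have d: "d > 0" "d * c \<le> 1" "c * d * c \<le> e"
    using assms(4) c unfolding d_def by (auto simp: min_def field_simps)
  show ?thesis
  proof (rule that[OF d(1)])
    fix B B' assume B: "B \<in> carrier_mat n n" "B' \<in> carrier_mat n n" "B' * B = 1\<^sub>m n" and AB: "mnorm (A - B) < d"
    have "B' * (A - B) * A' = (B' * A - 1\<^sub>m n) * A'"
      by (simp add: mult_minus_distrib_mat[OF B(2) A(1) B(1)] B(3))
    also have "\<dots> = B' * A * A' - A'"
      using A B by (simp add: minus_mult_distrib_mat[of _ n n] mult_carrier_mat[of _ n n])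
    also have "B' * A * A' = B'" using A B by (simp add: assoc_mult_mat[of _ n n _ n _ n])
    finally have eq: "B' - A' = B' * (A - B) * A'" by simp
    have "mnorm (B' * (A - B) * A') \<le> mnorm (B' * (A - B)) * mnorm A'"
      using A B by (intro mnorm_mult[where n=n and m=n and k=n] mult_carrier_mat[where n=n]) auto
    also have "\<dots> \<le> (mnorm B' * mnorm (A - B)) * mnorm A'"
      using A B by (intro mult_right_mono mnorm_mult[where n=n and m=n and k=n]) auto
    finally have le: "mnorm (B' - A') \<le> mnorm B' * mnorm (A - B) * mnorm A'" unfolding eq .
    \<comment> \<open>The estimate for B' - A' still contains the norm of B'. If that exceeded c,
      then B' - A' would be smaller than B', and the isosceles principle would give B' the norm of
      A', which is at most c.\<close>
    have "mnorm B' \<le> c"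
    proof (rule ccontr)
      assume *: "\<not> mnorm B' \<le> c"
      have "mnorm (A - B) * mnorm A' \<le> mnorm (A - B) * c" using c by (intro mult_left_mono) auto
      also have "\<dots> < d * c" using AB c by (intro mult_strict_right_mono) auto
      finally have "mnorm (A - B) * mnorm A' < 1" using d by simp
      hence "mnorm B' * (mnorm (A - B) * mnorm A') < mnorm B' * 1"
        using * c by (intro mult_strict_left_mono) auto
      hence "mnorm (B' - A') < mnorm B'" using le by (simp add: mult.assoc)
      hence "mnorm A' = mnorm B'" using mnorm_eqI[OF B(2) A(2)] by simp
      thus False using * c by simp
    qed
    hence "mnorm B' * mnorm (A - B) * mnorm A' \<le> c * mnorm (A - B) * c"
      using c by (intro mult_mono) auto
    also have "\<dots> < c * d * c" using AB c by (intro mult_strict_right_mono mult_strict_left_mono) auto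
    finally have "mnorm (B' - A') < e" using le d(3) by simp
    thus "mnorm (A' - B') < e" using mnorm_diff_commute[OF A(2) B(2)] by simp
  qed
qed

text \<open>With finitely many entries a basic box contains a norm ball, its radius being the least
  of the radii at the single entries. From here on the topology of \<open>SL n F\<close> is accessed
  through this criterion.\<close>

lemma openin_SL_topology:
  fixes F :: "'p::prime_card padic set"
  shows "openin (SL_topology n F) U \<longleftrightarrow> U \<subseteq> carrier (SL n F) \<and>
    (\<forall>A\<in>U. \<exists>e>0. \<forall>B\<in>carrier (SL n F). mnorm (A - B) < e \<longrightarrow> B \<in> U)"
proof -
  let ?I = "{..<n} \<times> {..<n}"
  let ?T = "product_topology (\<lambda>_. top_of_set F) ?I"
  let ?f = "\<lambda>A. restrict (\<lambda>ij. A $$ ij) ?I :: nat \<times> nat \<Rightarrow> 'p padic"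
  let ?G = "carrier (SL n F)"
  have G: "A \<in> carrier_mat n n" "\<And>i j. i < n \<Longrightarrow> j < n \<Longrightarrow> A $$ (i, j) \<in> F" if "A \<in> ?G" for A
    using that by (auto simp: SL_carrier_iff)
  have near: "(\<forall>ij\<in>?I. B $$ ij \<in> ball (A $$ ij) e) \<longleftrightarrow> mnorm (A - B) < e"
    if "A \<in> ?G" "B \<in> ?G" "e > 0" for A B e
  proof
    assume *: "\<forall>ij\<in>?I. B $$ ij \<in> ball (A $$ ij) e"
    show "mnorm (A - B) < e"
    proof (rule mnorm_lessI[OF that(3)])
      fix i j assume "i < dim_row (A - B)" "j < dim_col (A - B)"
      hence "i < n" "j < n" using G(1)[OF that(2)] by auto
      thus "padic_abs ((A - B) $$ (i, j)) < e"
        using *[rule_format, of "(i, j)"] G(1)[OF that(1)] G(1)[OF that(2)] by (simp add: dist_padic_def)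
    qed
  next
    assume *: "mnorm (A - B) < e"
    show "\<forall>ij\<in>?I. B $$ ij \<in> ball (A $$ ij) e"
    proof clarify
      fix i j assume ij: "i < n" "j < n"
      hence "padic_abs ((A - B) $$ (i, j)) \<le> mnorm (A - B)"
        using G(1)[OF that(2)] by (intro mnorm_ge) auto
      thus "B $$ (i, j) \<in> ball (A $$ (i, j)) e"
        using * ij G(1)[OF that(1)] G(1)[OF that(2)] by (simp add: dist_padic_def)
    qed
  qed
  show ?thesis
  proof
    assume "openin (SL_topology n F) U"
    then obtain S where S: "openin ?T S" "U = ?f -` S \<inter> ?G"
      by (auto simp: SL_topology_def openin_pullback_topology)
    have "\<exists>e>0. \<forall>B\<in>?G. mnorm (A - B) < e \<longrightarrow> B \<in> U" if "A \<in> U" for A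
    proof -
      have A: "A \<in> ?G" "?f A \<in> S" using that S(2) by auto
      obtain V where "finite {ij \<in> ?I. V ij \<noteq> topspace (top_of_set F)}"
        and V: "\<forall>ij\<in>?I. openin (top_of_set F) (V ij)" "?f A \<in> Pi\<^sub>E ?I V" "Pi\<^sub>E ?I V \<subseteq> S"
        using S(1)[unfolded openin_product_topology_alt, rule_format, OF A(2)] by (elim exE conjE) (rule that)
      have "\<exists>e>0. ball (A $$ ij) e \<inter> F \<subseteq> V ij" if ij: "ij \<in> ?I" for ij
      proof -
        obtain O' where O': "open O'" "V ij = F \<inter> O'" using V(1)[rule_format, OF ij] by (auto simp: openin_open)
        have "A $$ ij \<in> O'" using V(2) ij O'(2) by (auto simp: PiE_iff)
        then obtain e where "e > 0" "ball (A $$ ij) e \<subseteq> O'" using O'(1) open_contains_ball by blast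
        thus ?thesis using O'(2) by blast
      qed
      then obtain e where e: "\<And>ij. ij \<in> ?I \<Longrightarrow> e ij > 0 \<and> ball (A $$ ij) (e ij) \<inter> F \<subseteq> V ij" by metis
      define d where "d = Min (insert 1 (e ` ?I))"
      have d: "d > 0" "\<And>ij. ij \<in> ?I \<Longrightarrow> d \<le> e ij"
        unfolding d_def using e by (subst Min_gr_iff) auto
      have "B \<in> U" if B: "B \<in> ?G" "mnorm (A - B) < d" for B
      proof -
        have *: "\<forall>ij\<in>?I. B $$ ij \<in> ball (A $$ ij) d" using near[OF A(1) B(1) d(1)] B(2) by blast
        have "B $$ ij \<in> V ij" if ij: "ij \<in> ?I" for ij
        proof -
          have "B $$ ij \<in> ball (A $$ ij) (e ij)" using *[rule_format, OF ij] d(2)[OF ij] by simp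
          moreover have "B $$ ij \<in> F" using G(2)[OF B(1)] ij by auto
          ultimately show ?thesis using e[OF ij] by blast
        qed
        hence "?f B \<in> Pi\<^sub>E ?I V" by (auto simp: PiE_iff)
        thus ?thesis using V(3) S(2) B(1) by blast
      qed
      thus ?thesis using d(1) by blast
    qed
    thus "U \<subseteq> ?G \<and> (\<forall>A\<in>U. \<exists>e>0. \<forall>B\<in>?G. mnorm (A - B) < e \<longrightarrow> B \<in> U)" using S(2) by blast
  next
    assume U: "U \<subseteq> ?G \<and> (\<forall>A\<in>U. \<exists>e>0. \<forall>B\<in>?G. mnorm (A - B) < e \<longrightarrow> B \<in> U)"
    then obtain e where e: "\<And>A. A \<in> U \<Longrightarrow> e A > 0" "\<And>A B. A \<in> U \<Longrightarrow> B \<in> ?G \<Longrightarrow> mnorm (A - B) < e A \<Longrightarrow> B \<in> U"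
      by metis
    define S where "S = (\<Union>A\<in>U. Pi\<^sub>E ?I (\<lambda>ij. F \<inter> ball (A $$ ij) (e A)))"
    have "openin ?T S"
      unfolding S_def
      by (intro openin_Union) (auto simp: openin_PiE_gen intro!: openin_open_Int)
    moreover have "U = ?f -` S \<inter> ?G"
    proof
      show "U \<subseteq> ?f -` S \<inter> ?G"
      proof
        fix A assume A: "A \<in> U"
        hence AG: "A \<in> ?G" using U by blast
        have "?f A \<in> Pi\<^sub>E ?I (\<lambda>ij. F \<inter> ball (A $$ ij) (e A))"
          using G(2)[OF AG] e(1)[OF A] by auto
        thus "A \<in> ?f -` S \<inter> ?G" using A AG by (auto simp: S_def)
      qed
      show "?f -` S \<inter> ?G \<subseteq> U"
      proof
        fix B assume "B \<in> ?f -` S \<inter> ?G"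
        then obtain A where A: "A \<in> U" "?f B \<in> Pi\<^sub>E ?I (\<lambda>ij. F \<inter> ball (A $$ ij) (e A))" and B: "B \<in> ?G"
          by (auto simp: S_def)
        have AG: "A \<in> ?G" using A(1) U by blast
        have "B $$ ij \<in> ball (A $$ ij) (e A)" if ij: "ij \<in> ?I" for ij
          using PiE_mem[OF A(2) ij] ij by simp
        hence "\<forall>ij\<in>?I. B $$ ij \<in> ball (A $$ ij) (e A)" by blast
        hence "mnorm (A - B) < e A" using near[OF AG B e(1)[OF A(1)]] by blast
        thus "B \<in> U" by (rule e(2)[OF A(1) B])
      qed
    qed
    ultimately show "openin (SL_topology n F) U"
      unfolding SL_topology_def openin_pullback_topology by blast
  qed
qed

lemma topspace_SL_topology [simp]: "topspace (SL_topology n (F :: 'p::prime_card padic set)) = carrier (SL n F)"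
proof -
  have "openin (SL_topology n F) (carrier (SL n F))"
    unfolding openin_SL_topology by (auto intro: exI[of _ 1])
  moreover have "topspace (SL_topology n F) \<subseteq> carrier (SL n F)"
    using openin_topspace[of "SL_topology n F"] unfolding openin_SL_topology by blast
  ultimately show ?thesis using openin_subset by blast
qed

lemma openin_SL_ball:
  fixes F :: "'p::prime_card padic set"
  assumes "A \<in> carrier_mat n n"
  shows "openin (SL_topology n F) {B \<in> carrier (SL n F). mnorm (A - B) < e}"
  unfolding openin_SL_topology
proof (intro conjI ballI)
  fix B assume B: "B \<in> {B \<in> carrier (SL n F). mnorm (A - B) < e}"
  have "mnorm (A - C) < e" if C: "C \<in> carrier (SL n F)" "mnorm (B - C) < e" for C
  proof -
    have "B \<in> carrier_mat n n" "mnorm (A - B) < e" using B SL_carrier_mat by auto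
    thus ?thesis using mnorm_diff_triangle[OF assms _ SL_carrier_mat[OF C(1)], of B] C(2) by simp
  qed
  moreover have "e > 0" using B by (auto intro: order_le_less_trans[OF mnorm_nonneg])
  ultimately show "\<exists>d>0. \<forall>C\<in>carrier (SL n F). mnorm (B - C) < d \<longrightarrow> C \<in> {B \<in> carrier (SL n F). mnorm (A - B) < e}"
    by (intro exI[of _ e]) simp
qed auto

lemma mnorm_diff_self: "A \<in> carrier_mat n n \<Longrightarrow> mnorm (A - A) = 0"
  unfolding mnorm_def by (rule Max_eqI) (auto simp: minus_r_inv_mat)

lemma hausdorff_SL:
  fixes F :: "'p::prime_card padic set"
  assumes F: "is_subfield F"
  shows "hausdorff_topological_group (SL n F) (SL_topology n F)"
proof (rule hausdorff_topological_groupI)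
  let ?B = "\<lambda>A e. {B \<in> carrier (SL n F). mnorm (A - B) < e}"
  have self: "A \<in> ?B A e" if "A \<in> carrier (SL n F)" "e > 0" for A e
    using that mnorm_diff_self[OF SL_carrier_mat[OF that(1)]] by simp
  show "group (SL n F)" by (rule group_SL[OF F])
  show "Hausdorff_space (SL_topology n F)"
    unfolding Hausdorff_space_def topspace_SL_topology
  proof (intro allI impI, elim conjE)
    fix A B assume A: "A \<in> carrier (SL n F)" and B: "B \<in> carrier (SL n F)" and ne: "A \<noteq> B"
    note m = SL_carrier_mat[OF A] SL_carrier_mat[OF B]
    have "mnorm (A - B) \<noteq> 0"
    proof
      assume "mnorm (A - B) = 0"
      hence z: "A - B = 0\<^sub>m n n" using m by (intro mnorm_eq_0) auto
      have "A = B"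
      proof (rule eq_matI)
        fix i j assume ij: "i < dim_row B" "j < dim_col B"
        hence "(A - B) $$ (i, j) = 0" using m by (simp add: z)
        thus "A $$ (i, j) = B $$ (i, j)" using m ij by simp
      qed (use m in auto)
      thus False using ne by simp
    qed
    hence e: "mnorm (A - B) > 0" using mnorm_nonneg[of "A - B"] by linarith
    have "disjnt (?B A (mnorm (A - B))) (?B B (mnorm (A - B)))"
      unfolding disjnt_iff
    proof safe
      fix C assume C: "C \<in> carrier (SL n F)" "mnorm (A - C) < mnorm (A - B)" "mnorm (B - C) < mnorm (A - B)"
      thus False
        using mnorm_diff_triangle[OF m(1) SL_carrier_mat[OF C(1)] m(2)]
          mnorm_diff_commute[OF m(2) SL_carrier_mat[OF C(1)]] by simp
    qed
    thus "\<exists>U V. openin (SL_topology n F) U \<and> openin (SL_topology n F) V \<and> A \<in> U \<and> B \<in> V \<and> disjnt U V"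
      by (intro exI[of _ "?B A (mnorm (A - B))"] exI[of _ "?B B (mnorm (A - B))"] conjI
          openin_SL_ball m self[OF A e] self[OF B e])
  qed
next
  let ?B = "\<lambda>A e. {B \<in> carrier (SL n F). mnorm (A - B) < e}"
  have self: "A \<in> ?B A e" if "A \<in> carrier (SL n F)" "e > 0" for A e
    using that mnorm_diff_self[OF SL_carrier_mat[OF that(1)]] by simp
  fix W A B assume W: "openin (SL_topology n F) W" and A: "A \<in> carrier (SL n F)" and B: "B \<in> carrier (SL n F)"
    and AB: "A \<otimes>\<^bsub>SL n F\<^esub> B \<in> W"
  obtain e where e: "e > 0" "\<And>C. C \<in> carrier (SL n F) \<Longrightarrow> mnorm (A * B - C) < e \<Longrightarrow> C \<in> W"
    using W AB unfolding openin_SL_topology by force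
  obtain d where d: "d > 0" "\<And>A' B'. A' \<in> carrier_mat n n \<Longrightarrow> B' \<in> carrier_mat n n \<Longrightarrow>
     mnorm (A - A') < d \<Longrightarrow> mnorm (B - B') < d \<Longrightarrow> mnorm (A * B - A' * B') < e"
    using mnorm_mult_continuous[OF SL_carrier_mat[OF A] SL_carrier_mat[OF B] e(1)] by blast
  have "\<forall>u\<in>?B A d. \<forall>v\<in>?B B d. u \<otimes>\<^bsub>SL n F\<^esub> v \<in> W"
  proof (intro ballI)
    fix u v assume "u \<in> ?B A d" "v \<in> ?B B d"
    hence u: "u \<in> carrier (SL n F)" "mnorm (A - u) < d" and v: "v \<in> carrier (SL n F)" "mnorm (B - v) < d"
      by simp_all
    have "mnorm (A * B - u * v) < e"
      by (rule d(2)[OF SL_carrier_mat[OF u(1)] SL_carrier_mat[OF v(1)] u(2) v(2)])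
    thus "u \<otimes>\<^bsub>SL n F\<^esub> v \<in> W" using e(2)[OF SL_mult_closed[OF F u(1) v(1)]] by simp
  qed
  thus "\<exists>U V. openin (SL_topology n F) U \<and> openin (SL_topology n F) V \<and> A \<in> U \<and> B \<in> V \<and>
      (\<forall>u\<in>U. \<forall>v\<in>V. u \<otimes>\<^bsub>SL n F\<^esub> v \<in> W)"
    by (intro exI[of _ "?B A d"] exI[of _ "?B B d"] conjI openin_SL_ball
        SL_carrier_mat[OF A] SL_carrier_mat[OF B] self[OF A d(1)] self[OF B d(1)])
next
  let ?B = "\<lambda>A e. {B \<in> carrier (SL n F). mnorm (A - B) < e}"
  interpret group "SL n F" by (rule group_SL[OF F])
  fix W A assume W: "openin (SL_topology n F) W" and A: "A \<in> carrier (SL n F)" and AW: "inv\<^bsub>SL n F\<^esub> A \<in> W"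
  obtain e where e: "e > 0" "\<And>C. C \<in> carrier (SL n F) \<Longrightarrow> mnorm (inv\<^bsub>SL n F\<^esub> A - C) < e \<Longrightarrow> C \<in> W"
    using W AW unfolding openin_SL_topology by force
  have mats: "B \<in> carrier_mat n n" "inv\<^bsub>SL n F\<^esub> B \<in> carrier_mat n n" "B * inv\<^bsub>SL n F\<^esub> B = 1\<^sub>m n" "inv\<^bsub>SL n F\<^esub> B * B = 1\<^sub>m n"
    if "B \<in> carrier (SL n F)" for B
    using that r_inv[OF that] l_inv[OF that] SL_carrier_mat[OF that] SL_carrier_mat[OF inv_closed[OF that]] by auto
  obtain d where d: "d > 0" "\<And>B B'. B \<in> carrier_mat n n \<Longrightarrow> B' \<in> carrier_mat n n \<Longrightarrow> B' * B = 1\<^sub>m n \<Longrightarrow>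
     mnorm (A - B) < d \<Longrightarrow> mnorm (inv\<^bsub>SL n F\<^esub> A - B') < e"
    using mnorm_inverse_continuous[OF mats(1-3)[OF A] e(1)] by blast
  have "\<forall>u\<in>?B A d. inv\<^bsub>SL n F\<^esub> u \<in> W"
  proof
    fix u assume "u \<in> ?B A d"
    hence u: "u \<in> carrier (SL n F)" "mnorm (A - u) < d" by simp_all
    show "inv\<^bsub>SL n F\<^esub> u \<in> W" by (rule e(2)[OF inv_closed[OF u(1)] d(2)[OF mats(1,2,4)[OF u(1)] u(2)]])
  qed
  moreover have "A \<in> ?B A d" using A d(1) mnorm_diff_self[OF mats(1)[OF A]] by simp
  ultimately show "\<exists>U. openin (SL_topology n F) U \<and> A \<in> U \<and> (\<forall>u\<in>U. inv\<^bsub>SL n F\<^esub> u \<in> W)"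
    by (intro exI[of _ "?B A d"] conjI openin_SL_ball mats(1)[OF A])
qed (rule topspace_SL_topology)

section \<open>Closedness, density and compactness for matrices\<close>

lemma tendsto_det:
  fixes X :: "nat \<Rightarrow> 'p::prime_card padic mat"
  assumes "\<And>k. X k \<in> carrier_mat n n" "A \<in> carrier_mat n n"
    and "\<And>i j. i < n \<Longrightarrow> j < n \<Longrightarrow> (\<lambda>k. X k $$ (i, j)) \<longlonglongrightarrow> A $$ (i, j)"
  shows "(\<lambda>k. det (X k)) \<longlonglongrightarrow> det A"
  unfolding det_def'[OF assms(1)] det_def'[OF assms(2)]
proof (intro tendsto_sum tendsto_mult tendsto_const tendsto_prod' assms(3))
  fix \<pi> i assume "\<pi> \<in> {\<pi>. \<pi> permutes {0..<n}}" "i \<in> {0..<n}"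
  thus "\<pi> i < n" using permutes_in_image[of \<pi> "{0..<n}" i] by simp
qed auto

text \<open>The determinant is continuous, so determinant 1 survives the limit. Cluster points are
  first found as mere matrices and enter the group in this way.\<close>

lemma det_approx_1:
  fixes A :: "'p::prime_card padic mat"
  assumes A: "A \<in> carrier_mat n n"
    and approx: "\<And>e. e > 0 \<Longrightarrow> \<exists>B\<in>carrier (SL n UNIV). mnorm (A - B) < e"
  shows "A \<in> carrier (SL n UNIV)"
proof -
  have "\<exists>B\<in>carrier (SL n UNIV). mnorm (A - B) < inverse (real (Suc k))" for k
    by (rule approx) simp
  then obtain X where X: "\<And>k. X k \<in> carrier (SL n UNIV)" "\<And>k. mnorm (A - X k) < inverse (real (Suc k))" by metis
  have mat: "X k \<in> carrier_mat n n" and det: "det (X k) = 1" for k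
    using X(1)[of k] by (auto simp: SL_carrier_iff)
  have "(\<lambda>k. X k $$ (i, j)) \<longlonglongrightarrow> A $$ (i, j)" if ij: "i < n" "j < n" for i j
  proof (rule metric_LIMSEQ_I)
    fix e :: real assume "e > 0"
    then obtain N where N: "inverse (real (Suc N)) < e" using reals_Archimedean by blast
    have "dist (X k $$ (i, j)) (A $$ (i, j)) < e" if k: "k \<ge> N" for k
    proof -
      have "padic_abs ((A - X k) $$ (i, j)) \<le> mnorm (A - X k)"
        using A mat[of k] ij by (intro mnorm_ge) auto
      moreover have "(A - X k) $$ (i, j) = A $$ (i, j) - X k $$ (i, j)" using A mat[of k] ij by simp
      moreover have "inverse (real (Suc k)) \<le> inverse (real (Suc N))"
        using k by (intro le_imp_inverse_le) auto
      hence "mnorm (A - X k) < e" using X(2)[of k] N by linarith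
      ultimately show ?thesis
        by (simp add: dist_padic_def padic_abs_minus_commute[of "A $$ (i, j)"])
    qed
    thus "\<exists>no. \<forall>k\<ge>no. dist (X k $$ (i, j)) (A $$ (i, j)) < e" by blast
  qed
  hence "(\<lambda>k. det (X k)) \<longlonglongrightarrow> det A" by (rule tendsto_det[OF mat A])
  hence "det A = 1" by (simp add: det LIMSEQ_const_iff)
  thus ?thesis using A by (simp add: SL_carrier_iff)
qed

lemma subfield_of_rat: "is_subfield F \<Longrightarrow> of_rat q \<in> (F :: 'a::field_char_0 set)"
proof -
  assume F: "is_subfield F"
  have int: "of_int k \<in> F" for k
    using subfield_of_nat[OF F, of "nat k"] subfield_minus[OF F subfield_of_nat[OF F, of "nat (- k)"]]
    by (cases "k \<ge> 0") (auto simp: of_nat_nat)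
  obtain a b :: int where ab: "b \<noteq> 0" "q = of_int a / of_int b" by (rule rat_fracE)
  show ?thesis unfolding ab(2) by (simp add: of_rat_divide subfield_divide[OF F int int])
qed

text \<open>Rational approximations of the entries have a determinant D close to 1, and dividing row
  0 by D restores determinant 1. Every subfield contains the rationals, so the result lies over
  \<open>F\<close>.\<close>

lemma SL_dense:
  fixes A :: "'p::prime_card padic mat"
  assumes F: "is_subfield F" and n: "n > 0" and A: "A \<in> carrier (SL n UNIV)" and e: "e > 0"
  obtains B where "B \<in> carrier (SL n F)" "mnorm (A - B) < e"
proof -
  have Am: "A \<in> carrier_mat n n" and dA: "det A = 1" using A by (auto simp: SL_carrier_iff)
  have "\<exists>q. padic_abs (A $$ (i, j) - of_rat q) < inverse (real (Suc k))" for i j k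
    by (rule padic_approx_rat[of "inverse (real (Suc k))" "A $$ (i, j)"]) auto
  then obtain q where q: "\<And>i j k. padic_abs (A $$ (i, j) - of_rat (q i j k)) < inverse (real (Suc k))" by metis
  define X where "X = (\<lambda>k. mat n n (\<lambda>(i, j). of_rat (q i j k)) :: 'p padic mat)"
  have Xm: "X k \<in> carrier_mat n n" for k by (simp add: X_def)
  have lim: "(\<lambda>k. X k $$ (i, j)) \<longlonglongrightarrow> A $$ (i, j)" if ij: "i < n" "j < n" for i j
  proof (rule metric_LIMSEQ_I)
    fix e :: real assume "e > 0"
    then obtain N where N: "inverse (real (Suc N)) < e" using reals_Archimedean by blast
    have "dist (X k $$ (i, j)) (A $$ (i, j)) < e" if k: "k \<ge> N" for k
    proof -
      have "inverse (real (Suc k)) \<le> inverse (real (Suc N))"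
        using k by (intro le_imp_inverse_le) auto
      hence "padic_abs (A $$ (i, j) - of_rat (q i j k)) < e" using q[of i j k] N by linarith
      thus ?thesis using ij
        by (simp add: X_def dist_padic_def padic_abs_minus_commute[of "A $$ (i, j)"])
    qed
    thus "\<exists>no. \<forall>k\<ge>no. dist (X k $$ (i, j)) (A $$ (i, j)) < e" by blast
  qed
  have "(\<lambda>k. det (X k)) \<longlonglongrightarrow> 1" using tendsto_det[OF Xm Am lim] dA by simp
  define c where "c = 1 + mnorm A"
  have c: "c \<ge> 1" by (simp add: c_def)
  \<comment> \<open>The bound d \<le> 1 yields |D| = 1 and keeps the approximating entries within c;
    the bound c d \<le> e covers the change made in row 0.\<close>
  define d where "d = min 1 (e / c)"
  have d: "d > 0" "d \<le> 1" "c * d \<le> e" "d \<le> e"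
    using e c by (auto simp: d_def min_def field_simps)
  obtain K where K: "\<And>k. k \<ge> K \<Longrightarrow> dist (det (X k)) 1 < d"
    using \<open>(\<lambda>k. det (X k)) \<longlonglongrightarrow> 1\<close> d(1) unfolding lim_sequentially by blast
  obtain L where L: "inverse (real (Suc L)) < d" using reals_Archimedean d(1) by blast
  define k where "k = max K L"
  have near: "padic_abs (A $$ (i, j) - X k $$ (i, j)) < d" if "i < n" "j < n" for i j
  proof -
    have "inverse (real (Suc k)) \<le> inverse (real (Suc L))"
      by (intro le_imp_inverse_le) (auto simp: k_def)
    hence "padic_abs (A $$ (i, j) - of_rat (q i j k)) < d" using q[of i j k] L by linarith
    thus ?thesis using that by (simp add: X_def)
  qed
  define D where "D = det (X k)"
  have D1: "padic_abs (1 - D) < d" using K[of k] by (simp add: k_def D_def dist_padic_def padic_abs_minus_commute)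
  hence Dabs: "padic_abs D = 1" using padic_abs_eqI[of 1 D] d by simp
  hence D0: "D \<noteq> 0" by auto
  define B where "B = multrow 0 (inverse D) (X k)"
  have Xk: "X k $$ (i, j) \<in> F" if "i < n" "j < n" for i j
    using that subfield_of_rat[OF F] by (simp add: X_def)
  have "D \<in> F" unfolding D_def by (rule subfield_det[OF F Xm Xk])
  hence "inverse D \<in> F" by (rule subfield_inverse[OF F])
  hence BF: "B $$ (i, j) \<in> F" if "i < n" "j < n" for i j
    using Xk[OF that] subfield_mult[OF F \<open>inverse D \<in> F\<close> Xk[OF that]] that Xm[of k] by (auto simp: B_def)
  have Bm: "B \<in> carrier_mat n n" using Xm[of k] by (simp add: B_def)
  have "det B = 1"
    unfolding B_def by (subst det_multrow[OF n Xm]) (use D0 in \<open>simp add: D_def\<close>)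
  hence BG: "B \<in> carrier (SL n F)" using Bm BF by (simp add: SL_carrier_iff)
  have "mnorm (A - B) < e"
  proof (rule mnorm_lessI[OF e])
    fix i j assume "i < dim_row (A - B)" "j < dim_col (A - B)"
    hence ij: "i < n" "j < n" using Bm by auto
    have idx: "(A - B) $$ (i, j) = A $$ (i, j) - B $$ (i, j)" using Am Bm ij by simp
    show "padic_abs ((A - B) $$ (i, j)) < e"
    proof (cases "i = 0")
      case False
      hence "B $$ (i, j) = X k $$ (i, j)" using ij Xm[of k] by (simp add: B_def)
      thus ?thesis using near[OF ij] d(4) by (simp add: idx)
    next
      case True
      hence B0: "B $$ (i, j) = inverse D * X k $$ (i, j)" using ij Xm[of k] by (simp add: B_def)
      have "padic_abs (X k $$ (i, j)) \<le> max (padic_abs (A $$ (i, j))) (padic_abs (A $$ (i, j) - X k $$ (i, j)))"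
        using padic_abs_diff_ultra[of "A $$ (i, j)" "A $$ (i, j) - X k $$ (i, j)"] by simp
      also have "\<dots> \<le> c" proof (rule max.boundedI)
        show "padic_abs (A $$ (i, j)) \<le> c" using mnorm_ge[of i A j] Am ij by (simp add: c_def)
        show "padic_abs (A $$ (i, j) - X k $$ (i, j)) \<le> c" using near[OF ij] d(2) c by linarith
      qed
      finally have Xc: "padic_abs (X k $$ (i, j)) \<le> c" .
      have "X k $$ (i, j) - B $$ (i, j) = inverse D * (D - 1) * X k $$ (i, j)"
        using D0 by (simp add: B0 field_simps)
      hence "padic_abs (X k $$ (i, j) - B $$ (i, j)) = padic_abs (1 - D) * padic_abs (X k $$ (i, j))"
        by (simp add: padic_abs_mult padic_abs_inverse Dabs padic_abs_minus_commute[of D 1])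
      also have "\<dots> \<le> padic_abs (1 - D) * c" using Xc by (intro mult_left_mono) auto
      also have "\<dots> < d * c" using D1 c by (intro mult_strict_right_mono) auto
      finally have "padic_abs (X k $$ (i, j) - B $$ (i, j)) < e" using d(3) by (simp add: mult.commute)
      moreover have "padic_abs (A $$ (i, j) - X k $$ (i, j)) < e" using near[OF ij] d(4) by simp
      ultimately show ?thesis
        using padic_abs_ultra[of "A $$ (i, j) - X k $$ (i, j)" "X k $$ (i, j) - B $$ (i, j)"] by (simp add: idx)
    qed
  qed
  thus ?thesis using that BG by blast
qed

text \<open>Compactness of a product of balls, applied to the filter generated by the bounded parts
  of the given sets. Filters take the place of sequences because no countable base of the family is
  assumed.\<close>

lemma bounded_matrices_cluster:
  fixes \<V> :: "'p::prime_card padic mat set set"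
  assumes "\<V> \<noteq> {}" and directed: "\<And>V V'. V \<in> \<V> \<Longrightarrow> V' \<in> \<V> \<Longrightarrow> \<exists>W\<in>\<V>. W \<subseteq> V \<inter> V'"
    and bounded: "\<And>V. V \<in> \<V> \<Longrightarrow> \<exists>A\<in>V. A \<in> carrier_mat n n \<and> mnorm A \<le> R"
  obtains M where "M \<in> carrier_mat n n"
    "\<And>V e. V \<in> \<V> \<Longrightarrow> e > 0 \<Longrightarrow> \<exists>A\<in>V. A \<in> carrier_mat n n \<and> mnorm A \<le> R \<and> mnorm (M - A) < e"
proof -
  let ?I = "{..<n} \<times> {..<n}"
  \<comment> \<open>Matrices become functions on all index pairs, set to 0 outside the range, so
    that compactness in a plain function space applies.\<close>
  define S where "S = (\<lambda>ij. if ij \<in> ?I then {x :: 'p padic. padic_abs x \<le> R} else {0})"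
  define f where "f = (\<lambda>A ij. if ij \<in> ?I then A $$ ij else (0 :: 'p padic))"
  define B where "B = (\<lambda>V. f ` {A \<in> V. A \<in> carrier_mat n n \<and> mnorm A \<le> R})"
  have "compactin (product_topology (\<lambda>_. euclidean) UNIV) (Pi\<^sub>E UNIV S)"
    unfolding compactin_PiE by (auto simp: S_def compact_padic_cball)
  hence K: "compact (Pi\<^sub>E UNIV S)" by (simp add: euclidean_product_topology)
  define \<F> where "\<F> = (INF V\<in>\<V>. principal (B V))"
  have base: "eventually P \<F> \<longleftrightarrow> (\<exists>V\<in>\<V>. eventually P (principal (B V)))" for P
    unfolding \<F>_def
  proof (rule eventually_INF_base[OF assms(1)])
    fix V V' assume "V \<in> \<V>" "V' \<in> \<V>"
    then obtain W where W: "W \<in> \<V>" "W \<subseteq> V \<inter> V'" using directed by blast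
    hence "principal (B W) \<le> inf (principal (B V)) (principal (B V'))"
      by (auto simp: B_def)
    thus "\<exists>W\<in>\<V>. principal (B W) \<le> inf (principal (B V)) (principal (B V'))" using W(1) by blast
  qed
  have "\<F> \<noteq> bot"
  proof
    assume "\<F> = bot"
    hence "eventually (\<lambda>_. False) \<F>" by simp
    then obtain V where V: "V \<in> \<V>" "B V = {}" unfolding base by (auto simp: eventually_principal)
    thus False using bounded[OF V(1)] by (auto simp: B_def)
  qed
  moreover have "eventually (\<lambda>x. x \<in> Pi\<^sub>E UNIV S) \<F>"
  proof -
    obtain V where V: "V \<in> \<V>" using assms(1) by blast
    have "x \<in> Pi\<^sub>E UNIV S" if xB: "x \<in> B V" for x
    proof -
      obtain A where A: "A \<in> carrier_mat n n" "mnorm A \<le> R" "x = f A" using xB by (auto simp: B_def)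
      have "f A ij \<in> S ij" for ij
      proof (cases "ij \<in> ?I")
        case True
        then obtain i j where ij: "ij = (i, j)" "i < n" "j < n" by auto
        thus ?thesis using mnorm_ge[of i A j] A by (simp add: f_def S_def)
      qed (auto simp: f_def S_def)
      thus ?thesis unfolding A(3) by (intro PiE_I) auto
    qed
    thus ?thesis unfolding base using V by (auto simp: eventually_principal)
  qed
  ultimately obtain x where x: "x \<in> Pi\<^sub>E UNIV S" "inf (nhds x) \<F> \<noteq> bot"
    using K unfolding compact_filter by blast
  define M where "M = mat n n x"
  show ?thesis
  proof (rule that)
    show "M \<in> carrier_mat n n" by (simp add: M_def)
    fix V and e :: real assume V: "V \<in> \<V>" and e: "e > 0"
    have "eventually (\<lambda>y. dist (y ij) (x ij) < e) (nhds x)" for ij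
    proof -
      have "continuous_on UNIV (\<lambda>y :: nat \<times> nat \<Rightarrow> 'p padic. y ij)" by (rule continuous_on_product_coordinates)
      hence "open ((\<lambda>y :: nat \<times> nat \<Rightarrow> 'p padic. y ij) -` ball (x ij) e)" by (rule open_vimage[OF open_ball])
      moreover have "x \<in> (\<lambda>y. y ij) -` ball (x ij) e" using e by simp
      ultimately show ?thesis
        unfolding eventually_nhds by (intro exI[of _ "(\<lambda>y. y ij) -` ball (x ij) e"]) (auto simp: dist_commute)
    qed
    hence "eventually (\<lambda>y. \<forall>ij\<in>?I. dist (y ij) (x ij) < e) (nhds x)"
      by (intro eventually_ball_finite) auto
    moreover have "eventually (\<lambda>y. y \<in> B V) \<F>" unfolding base using V by (auto simp: eventually_principal)
    ultimately have "eventually (\<lambda>y. (\<forall>ij\<in>?I. dist (y ij) (x ij) < e) \<and> y \<in> B V) (inf (nhds x) \<F>)"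
      unfolding eventually_inf by blast
    then obtain y where y: "\<forall>ij\<in>?I. dist (y ij) (x ij) < e" "y \<in> B V"
      using eventually_happens'[OF x(2)] by blast
    then obtain A where A: "A \<in> V" "A \<in> carrier_mat n n" "mnorm A \<le> R" "y = f A" by (auto simp: B_def)
    have "mnorm (M - A) < e"
    proof (rule mnorm_lessI[OF e])
      fix i j assume "i < dim_row (M - A)" "j < dim_col (M - A)"
      hence "i < n" "j < n" using A(2) by auto
      thus "padic_abs ((M - A) $$ (i, j)) < e"
        using y(1) A by (simp add: M_def f_def dist_padic_def padic_abs_minus_commute)
    qed
    thus "\<exists>A\<in>V. A \<in> carrier_mat n n \<and> mnorm A \<le> R \<and> mnorm (M - A) < e" using A by blast
  qed
qed

section \<open>Minimality modulo a normal subgroup\<close>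

lemma mnorm_one_le: "mnorm (1\<^sub>m n :: 'p::prime_card padic mat) \<le> 1"
  by (rule mnorm_leI) auto

text \<open>If all entries were smaller than 1, so would be every term of the Leibniz formula and
  hence the determinant.\<close>

lemma mnorm_SL_ge_1:
  fixes A :: "'p::prime_card padic mat"
  assumes A: "A \<in> carrier (SL n UNIV)" and n: "n > 0"
  shows "1 \<le> mnorm A"
proof (rule ccontr)
  assume *: "\<not> 1 \<le> mnorm A"
  have Am: "A \<in> carrier_mat n n" "det A = 1" using A by (auto simp: SL_carrier_iff)
  have "padic_abs (det A) < 1"
    unfolding det_def'[OF Am(1)]
  proof (rule padic_abs_sum_less)
    fix \<pi> assume "\<pi> \<in> {\<pi>. \<pi> permutes {0..<n}}"
    hence \<pi>: "\<pi> i < n" if "i < n" for i using permutes_in_image[of \<pi> "{0..<n}" i] that by simp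
    have "padic_abs (signof \<pi> :: 'p padic) = 1" by (simp add: sign_def)
    hence "padic_abs (signof \<pi> * (\<Prod>i = 0..<n. A $$ (i, \<pi> i))) = (\<Prod>i = 0..<n. padic_abs (A $$ (i, \<pi> i)))"
      by (simp add: padic_abs_mult padic_abs_prod)
    also have "\<dots> \<le> (\<Prod>i = 0..<n. mnorm A)"
      using mnorm_ge[of _ A] Am(1) \<pi> by (intro prod_mono) auto
    also have "\<dots> = mnorm A ^ n" by simp
    also have "\<dots> < 1" using * n by (simp add: power_less_one_iff)
    finally show "padic_abs (signof \<pi> * (\<Prod>i = 0..<n. A $$ (i, \<pi> i))) < 1" .
  qed simp
  thus False using Am(2) by simp
qed

text \<open>
  \<open>elem_mat n s r 1\<close> moves a maximal entry of \<open>g\<close> to another row, so that a maximal row of \<open>h\<close> and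
  a maximal column of \<open>h\<inverse>\<close> can be found at different indices.
\<close>
lemma SL_max_entries:
  fixes g :: "'p::prime_card padic mat"
  assumes F: "is_subfield F" and g: "g \<in> carrier (SL n F)" "mnorm g > 1"
  obtains h h' k k' i j a b where
    "h \<in> carrier (SL n F)" "h' \<in> carrier (SL n F)" "k \<in> carrier (SL n F)" "k' \<in> carrier (SL n F)"
    "h * h' = 1\<^sub>m n" "h' * h = 1\<^sub>m n" "k * k' = 1\<^sub>m n" "k' * k = 1\<^sub>m n" "h = k * g"
    "mnorm k \<le> 1" "mnorm k' \<le> 1"
    "i < n" "j < n" "i \<noteq> j" "a < n" "b < n"
    "padic_abs (h $$ (j, b)) = mnorm h" "padic_abs (h' $$ (a, i)) = mnorm h'" "mnorm h = mnorm g"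
proof -
  note result = that
  define g' where "g' = adj_mat g"
  have g': "g' \<in> carrier (SL n F)" "g' * g = 1\<^sub>m n" "g * g' = 1\<^sub>m n"
    using SL_adj_mat[OF F g(1)] by (auto simp: g'_def)
  note gm = SL_carrier_mat[OF g(1)] SL_carrier_mat[OF g'(1)]
  have n: "n > 0" using mnorm_attained[OF gm(1)] g(2) by fastforce
  have "g' \<in> carrier (SL n UNIV)" using g'(1) SL_mono[of F UNIV n] by blast
  hence g'1: "mnorm g' \<ge> 1" using mnorm_SL_ge_1 n by blast
  obtain r b where r: "r < n" "b < n" "padic_abs (g $$ (r, b)) = mnorm g"
    using mnorm_attained[OF gm(1)] g(2) by force
  obtain a c where c: "a < n" "c < n" "padic_abs (g' $$ (a, c)) = mnorm g'"
    using mnorm_attained[OF gm(2)] g'1 by force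
  have simple: thesis if "i < n" "j < n" "i \<noteq> j" "b < n" "a < n"
      "padic_abs (g $$ (j, b)) = mnorm g" "padic_abs (g' $$ (a, i)) = mnorm g'" for i j a b
    by (rule result[of g g' "1\<^sub>m n" "1\<^sub>m n" i j a b])
       (use g g' gm that mnorm_one_le SL_one_closed[OF F] in simp_all)
  show thesis
  proof (cases "r = c")
    case False
    thus thesis using simple[of c r b a] r c by auto
  next
    case True
    have "\<exists>s<n. s \<noteq> r"
    proof (rule ccontr)
      assume "\<not> (\<exists>s<n. s \<noteq> r)"
      hence all: "s = r" if "s < n" for s using that by blast
      have "n = 1" using all[of 0] all[of 1] n by (cases "n = 1") auto
      \<comment> \<open>For n = 1 the only entry is the determinant 1, against
        \<open>mnorm g > 1\<close>. Hence there is a second row.\<close>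
      hence "det g = g $$ (0, 0)" using det_single gm(1) by blast
      moreover have "det g = 1" using g(1) by (simp add: SL_carrier_iff)
      ultimately have "padic_abs (g $$ (r, b)) = 1" using \<open>n = 1\<close> r by simp
      thus False using r(3) g(2) by simp
    qed
    then obtain s where s: "s < n" "s \<noteq> r" by blast
    show thesis
    proof (cases "padic_abs (g $$ (s, b)) = mnorm g")
      case True
      thus thesis using simple[of c s b a] s r c \<open>r = c\<close> by auto
    next
      case gs: False
      show thesis
      proof (cases "padic_abs (g' $$ (a, s)) = mnorm g'")
        case True
        thus thesis using simple[of s r b a] s r c \<open>r = c\<close> by auto
      next
        case g's: False
        have gs': "padic_abs (g $$ (s, b)) < padic_abs (g $$ (r, b))"
          using gs mnorm_ge[of s g b] gm(1) s r by auto
        have g's': "padic_abs (g' $$ (a, s)) < padic_abs (g' $$ (a, r))"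
          using g's mnorm_ge[of a g' s] gm(2) s c \<open>r = c\<close> by auto
        \<comment> \<open>Adding row r to row s of g amounts to subtracting column s from column r
          in the inverse. By the two strict inequalities both maxima persist: that of
          \<open>h\<close> in row s, that of \<open>h'\<close> in column r.\<close>
        define k where "k = elem_mat n s r (1 :: 'p padic)"
        define k' where "k' = elem_mat n s r (- 1 :: 'p padic)"
        have k: "k \<in> carrier (SL n F)" "k' \<in> carrier (SL n F)"
          unfolding k_def k'_def
          by (intro elem_mat_SL[OF F] subfield_minus[OF F] subfield_1[OF F] s r)+
        note km = SL_carrier_mat[OF k(1)] SL_carrier_mat[OF k(2)]
        have kk: "k * k' = 1\<^sub>m n" "k' * k = 1\<^sub>m n"
          using s r by (auto simp: k_def k'_def elem_mat_mult elem_mat_0)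
        have "mnorm (elem_mat n s r y) \<le> 1" if y: "padic_abs y \<le> 1" for y :: "'p padic"
        proof (rule mnorm_leI)
          fix c d assume "c < dim_row (elem_mat n s r y)" "d < dim_col (elem_mat n s r y)"
          hence "c < n" "d < n" by (auto simp: elem_mat_def)
          thus "padic_abs (elem_mat n s r y $$ (c, d)) \<le> 1" using s(2) y by (simp add: index_elem_mat)
        qed simp
        hence knorm: "mnorm k \<le> 1" "mnorm k' \<le> 1" by (auto simp: k_def k'_def)
        define h where "h = k * g"
        define h' where "h' = g' * k'"
        have h: "h \<in> carrier (SL n F)" "h' \<in> carrier (SL n F)"
          unfolding h_def h'_def by (intro SL_mult_closed[OF F] g g' k)+
        have "h * h' = k * (g * (g' * k'))"
          unfolding h_def h'_def by (rule assoc_mult_mat[OF km(1) gm(1) mult_carrier_mat[OF gm(2) km(2)]])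
        also have "g * (g' * k') = g * g' * k'" by (rule assoc_mult_mat[OF gm(1,2) km(2), symmetric])
        finally have hh': "h * h' = 1\<^sub>m n" using km kk by (simp add: g'(3))
        have "h' * h = g' * (k' * (k * g))"
          unfolding h_def h'_def by (rule assoc_mult_mat[OF gm(2) km(2) mult_carrier_mat[OF km(1) gm(1)]])
        also have "k' * (k * g) = k' * k * g" by (rule assoc_mult_mat[OF km(2,1) gm(1), symmetric])
        finally have h'h: "h' * h = 1\<^sub>m n" using gm kk by (simp add: g'(2))
        note hm = SL_carrier_mat[OF h(1)] SL_carrier_mat[OF h(2)]
        have "h $$ (s, b) = g $$ (s, b) + g $$ (r, b)"
          unfolding h_def k_def using index_elem_mat_mult[OF gm(1) s(1) r(2) s(1) r(1), of 1] by simp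
        moreover have "padic_abs (g $$ (s, b) + g $$ (r, b)) = padic_abs (g $$ (r, b))"
          using padic_abs_eqI[of "g $$ (r, b)" "g $$ (s, b) + g $$ (r, b)"] gs' by simp
        ultimately have 1: "padic_abs (h $$ (s, b)) = mnorm g" using r by simp
        have "h' $$ (a, r) = g' $$ (a, r) - g' $$ (a, s)"
          unfolding h'_def k'_def using index_mult_elem_mat[OF gm(2) c(1) r(1) s(1) r(1) s(2), of "-1"] by simp
        moreover have "padic_abs (g' $$ (a, r) - g' $$ (a, s)) = padic_abs (g' $$ (a, r))"
          using padic_abs_eqI[of "g' $$ (a, r)" "g' $$ (a, r) - g' $$ (a, s)"] g's' by simp
        ultimately have 2: "padic_abs (h' $$ (a, r)) = mnorm g'" using c \<open>r = c\<close> by simp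
        have "mnorm h \<le> mnorm k * mnorm g" unfolding h_def by (rule mnorm_mult[OF km(1) gm(1)])
        also have "\<dots> \<le> 1 * mnorm g" using knorm by (intro mult_right_mono) auto
        finally have h1: "mnorm h = mnorm g" using 1 mnorm_ge[of s h b] hm s r by auto
        have "mnorm h' \<le> mnorm g' * mnorm k'" unfolding h'_def by (rule mnorm_mult[OF gm(2) km(2)])
        also have "\<dots> \<le> mnorm g' * 1" using knorm by (intro mult_left_mono) auto
        finally have h2: "mnorm h' = mnorm g'" using 2 mnorm_ge[of a h' r] hm c r by auto
        show thesis
          by (rule result[OF h k hh' h'h kk h_def knorm r(1) s(1) s(2)[symmetric] c(1) r(2)])
             (use 1 2 h1 h2 in auto)
      qed
    qed
  qed
qed

text \<open>
  If \<open>g\<close> is large then a conjugate of a transvection of size one is close to the identity.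
\<close>
lemma SL_contracted_unipotent:
  fixes g :: "'p::prime_card padic mat"
  assumes F: "is_subfield F" and g: "g \<in> carrier (SL n F)" "mnorm g > 1"
  obtains u where "u \<in> carrier (SL n F)" "mnorm (u - 1\<^sub>m n) = 1"
    "(u - 1\<^sub>m n) * (u - 1\<^sub>m n) = 0\<^sub>m n n" "mnorm (1\<^sub>m n - g * u * adj_mat g) \<le> inverse (mnorm g)"
proof -
  obtain h h' k k' i j a b where
    h: "h \<in> carrier (SL n F)" "h' \<in> carrier (SL n F)" and k: "k \<in> carrier (SL n F)" "k' \<in> carrier (SL n F)"
    and inv: "h * h' = 1\<^sub>m n" "h' * h = 1\<^sub>m n" "k * k' = 1\<^sub>m n" "k' * k = 1\<^sub>m n" and hkg: "h = k * g"
    and knorm: "mnorm k \<le> 1" "mnorm k' \<le> 1"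
    and ij: "i < n" "j < n" "i \<noteq> j" and ab: "a < n" "b < n"
    and max: "padic_abs (h $$ (j, b)) = mnorm h" "padic_abs (h' $$ (a, i)) = mnorm h'" "mnorm h = mnorm g"
    by (rule SL_max_entries[OF F g])
  note mats = SL_carrier_mat[OF h(1)] SL_carrier_mat[OF h(2)] SL_carrier_mat[OF k(1)] SL_carrier_mat[OF k(2)]
    SL_carrier_mat[OF g(1)] SL_carrier_mat[OF SL_adj_mat(1)[OF F g(1)]]
  have n: "n > 0" using ij by simp
  have "h' \<in> carrier (SL n UNIV)" using h(2) SL_mono[of F UNIV n] by blast
  hence h'1: "mnorm h' \<ge> 1" using mnorm_SL_ge_1 n by blast
  \<comment> \<open>The entries of u - 1 are x times one entry of column i of \<open>h'\<close> and
    one of row j of \<open>h\<close>. Since (a,i) and (j,b) are positions of maximal entries, this x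
    gives the largest of them absolute value exactly 1.\<close>
  define x where "x = inverse (h' $$ (a, i) * h $$ (j, b))"
  have xabs: "padic_abs x = inverse (mnorm h' * mnorm h)"
    by (simp add: x_def padic_abs_inverse padic_abs_mult max(1,2))
  have pos: "mnorm h' * mnorm h > 0" using h'1 g(2) max(3) by simp
  have xone: "padic_abs x * (mnorm h' * mnorm h) = 1"
    unfolding xabs by (rule left_inverse) (use pos in linarith)
  have x: "x \<in> F"
    unfolding x_def using h ij ab by (intro subfield_inverse[OF F] subfield_mult[OF F]) (auto simp: SL_carrier_iff)
  define u where "u = h' * elem_mat n i j x * h"
  have uG: "u \<in> carrier (SL n F)"
    unfolding u_def by (intro SL_mult_closed[OF F] h elem_mat_SL[OF F x ij])
  note um = SL_carrier_mat[OF uG]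
  have entry: "(u - 1\<^sub>m n) $$ (c, d) = x * h' $$ (c, i) * h $$ (j, d)" if "c < n" "d < n" for c d
    using index_conj_elem[OF mats(2,1) inv(2) ij that, of x] that um by (simp add: u_def)
  have dims: "u - 1\<^sub>m n \<in> carrier_mat n n" by (rule minus_carrier_mat) simp
  have "mnorm (u - 1\<^sub>m n) \<le> 1"
  proof (rule mnorm_leI)
    fix c d assume "c < dim_row (u - 1\<^sub>m n)" "d < dim_col (u - 1\<^sub>m n)"
    hence cd: "c < n" "d < n" by auto
    have "padic_abs ((u - 1\<^sub>m n) $$ (c, d)) = padic_abs x * (padic_abs (h' $$ (c, i)) * padic_abs (h $$ (j, d)))"
      by (simp add: entry[OF cd] padic_abs_mult)
    also have "\<dots> \<le> padic_abs x * (mnorm h' * mnorm h)"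
      using mnorm_ge[of c h' i] mnorm_ge[of j h d] mats cd ij by (intro mult_left_mono mult_mono) auto
    also have "\<dots> = 1" by (rule xone)
    finally show "padic_abs ((u - 1\<^sub>m n) $$ (c, d)) \<le> 1" .
  qed simp
  moreover have "padic_abs ((u - 1\<^sub>m n) $$ (a, b)) = 1"
    unfolding entry[OF ab] padic_abs_mult max(1,2) mult.assoc by (rule xone)
  hence "1 \<le> mnorm (u - 1\<^sub>m n)" using mnorm_ge[of a "u - 1\<^sub>m n" b] ab by simp
  ultimately have u1: "mnorm (u - 1\<^sub>m n) = 1" by simp
  \<comment> \<open>The square contains the product of row j of \<open>h\<close> and column i of
    \<open>h'\<close>, an off-diagonal entry of h h' = 1. This is why i and j had to be
    different.\<close>
  have usq: "(u - 1\<^sub>m n) * (u - 1\<^sub>m n) = 0\<^sub>m n n"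
  proof (rule eq_matI)
    fix c d assume "c < dim_row (0\<^sub>m n n :: 'p padic mat)" "d < dim_col (0\<^sub>m n n :: 'p padic mat)"
    hence cd: "c < n" "d < n" by auto
    have "((u - 1\<^sub>m n) * (u - 1\<^sub>m n)) $$ (c, d) = (\<Sum>r\<in>{0..<n}. (u - 1\<^sub>m n) $$ (c, r) * (u - 1\<^sub>m n) $$ (r, d))"
      using dims cd by (simp add: scalar_prod_def)
    also have "\<dots> = (\<Sum>r\<in>{0..<n}. (x * h' $$ (c, i) * x * h $$ (j, d)) * (h $$ (j, r) * h' $$ (r, i)))"
    proof (intro sum.cong refl)
      fix r assume "r \<in> {0..<n}"
      hence r: "r < n" by simp
      show "(u - 1\<^sub>m n) $$ (c, r) * (u - 1\<^sub>m n) $$ (r, d) =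
          (x * h' $$ (c, i) * x * h $$ (j, d)) * (h $$ (j, r) * h' $$ (r, i))"
        unfolding entry[OF cd(1) r] entry[OF r cd(2)] by (simp only: mult_ac)
    qed
    also have "\<dots> = (x * h' $$ (c, i) * x * h $$ (j, d)) * (h * h') $$ (j, i)"
      using mats ij by (simp add: scalar_prod_def sum_distrib_left)
    also have "(h * h') $$ (j, i) = 0" unfolding inv(1) using ij by simp
    finally show "((u - 1\<^sub>m n) * (u - 1\<^sub>m n)) $$ (c, d) = 0\<^sub>m n n $$ (c, d)" using cd by simp
  qed (use dims in auto)
  have "k' * h = g"
  proof -
    have "k' * h = k' * k * g" unfolding hkg by (rule assoc_mult_mat[OF mats(4,3,5), symmetric])
    thus ?thesis using mats by (simp add: inv(4))
  qed
  hence "g * h' = k' * (h * h')" using assoc_mult_mat[OF mats(4,1,2)] by simp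
  hence gh': "g * h' = k'" using mats by (simp add: inv(1))
  have "h * adj_mat g = k * (g * adj_mat g)" unfolding hkg by (rule assoc_mult_mat[OF mats(3,5,6)])
  hence hg': "h * adj_mat g = k" using mats SL_adj_mat(3)[OF F g(1)] by simp
  have E: "elem_mat n i j x \<in> carrier_mat n n" by simp
  note h'E = mult_carrier_mat[OF mats(2) E]
  have "g * u = g * h' * elem_mat n i j x * h"
    unfolding u_def assoc_mult_mat[OF mats(5) h'E mats(1), symmetric] assoc_mult_mat[OF mats(5,2) E] ..
  hence "g * u * adj_mat g = g * h' * elem_mat n i j x * (h * adj_mat g)"
    using assoc_mult_mat[OF mult_carrier_mat[OF mult_carrier_mat[OF mats(5,2)] E] mats(1,6)] by simp
  \<comment> \<open>Since g is \<open>k'\<close> times \<open>h\<close>, conjugating u by g undoes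
    the conjugation by \<open>h\<close> and leaves a transvection of size |x| conjugated by matrices
    of norm at most 1. It differs from 1 by at most |x|.\<close>
  hence eq: "g * u * adj_mat g = k' * elem_mat n i j x * k" by (simp only: gh' hg')
  have "mnorm (1\<^sub>m n - g * u * adj_mat g) \<le> padic_abs x"
    unfolding eq
  proof (rule mnorm_leI)
    fix c d assume "c < dim_row (1\<^sub>m n - k' * elem_mat n i j x * k)" "d < dim_col (1\<^sub>m n - k' * elem_mat n i j x * k)"
    hence cd: "c < n" "d < n" using mats by auto
    have "(1\<^sub>m n - k' * elem_mat n i j x * k) $$ (c, d) = 1\<^sub>m n $$ (c, d) - (k' * elem_mat n i j x * k) $$ (c, d)"
      using cd mats by (intro index_minus_mat) auto
    hence "(1\<^sub>m n - k' * elem_mat n i j x * k) $$ (c, d) = - (x * k' $$ (c, i) * k $$ (j, d))"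
      using cd index_conj_elem[OF mats(4,3) inv(4) ij cd, of x] by simp
    hence "padic_abs ((1\<^sub>m n - k' * elem_mat n i j x * k) $$ (c, d)) = padic_abs x * (padic_abs (k' $$ (c, i)) * padic_abs (k $$ (j, d)))"
      by (simp add: padic_abs_mult)
    also have "\<dots> \<le> padic_abs x * (1 * 1)"
      using mnorm_ge[of c k' i] mnorm_ge[of j k d] mats cd ij knorm by (intro mult_left_mono mult_mono) auto
    finally show "padic_abs ((1\<^sub>m n - k' * elem_mat n i j x * k) $$ (c, d)) \<le> padic_abs x" by simp
  qed simp
  also have "padic_abs x \<le> inverse (mnorm g)"
  proof -
    have "1 * mnorm h \<le> mnorm h' * mnorm h" using h'1 by (intro mult_right_mono) auto
    thus ?thesis unfolding xabs max(3)[symmetric] using g(2) max(3) by (intro le_imp_inverse_le) auto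
  qed
  finally show ?thesis using that uG u1 usq by blast
qed

text \<open>Coprimality enters here: the scalar satisfies c^n = det A = 1, so it is 1 or -1 and lies
  in every subfield.\<close>

lemma scalar_SL_subfield:
  fixes A :: "'p::prime_card padic mat"
  assumes F: "is_subfield F" and cop: "coprime n (CARD('p) - 1)" "n > 0"
    and A: "A \<in> carrier (SL n UNIV)" "scalar_mat n A"
  shows "A \<in> carrier (SL n F)"
proof -
  obtain c where c: "A = c \<cdot>\<^sub>m 1\<^sub>m n" using A(2) by (auto simp: scalar_mat_def)
  have "c ^ n = 1" using A(1) by (simp add: c SL_carrier_iff)
  hence "c = 1 \<or> c = - 1" using padic_root_of_unity_coprime cop by blast
  hence "c \<in> F" using subfield_1[OF F] subfield_minus[OF F subfield_1[OF F]] by auto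
  thus ?thesis using A(1) subfield_0[OF F] by (auto simp: SL_carrier_iff c)
qed

section \<open>The normal subgroup of limit points over Q_p\<close>

locale SL_coarser =
  fixes F :: "'p::prime_card padic set" and n :: nat and N and \<V>
  assumes F: "is_subfield F" and n: "n > 0" and cop: "coprime n (CARD('p) - 1)"
    and normal: "N \<lhd> SL n F"
    and base: "coarser_group_base (SL n F) (SL_topology n F) \<V> N"
begin

abbreviation G where "G \<equiv> SL n F"

sublocale top_group G "SL_topology n F"
  using hausdorff_SL[OF F] by (simp add: top_group_iff)

lemma
  shows base_nonempty: "\<V> \<noteq> {}" and base_Inter: "\<Inter>\<V> = N"
    and base_open: "V \<in> \<V> \<Longrightarrow> openin (SL_topology n F) V" and base_one: "V \<in> \<V> \<Longrightarrow> 1\<^sub>m n \<in> V"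
    and base_Int: "V \<in> \<V> \<Longrightarrow> V' \<in> \<V> \<Longrightarrow> \<exists>W\<in>\<V>. W \<subseteq> V \<inter> V'"
    and base_mult: "V \<in> \<V> \<Longrightarrow> \<exists>W\<in>\<V>. \<forall>x\<in>W. \<forall>y\<in>W. x * y \<in> V"
    and base_inv: "V \<in> \<V> \<Longrightarrow> \<exists>W\<in>\<V>. \<forall>x\<in>W. inv\<^bsub>G\<^esub> x \<in> V"
    and base_conj: "V \<in> \<V> \<Longrightarrow> g \<in> carrier G \<Longrightarrow> \<exists>W\<in>\<V>. \<forall>x\<in>W. g * x * inv\<^bsub>G\<^esub> g \<in> V"
proof -
  have b: "\<V> \<noteq> {}" "\<Inter>\<V> = N" "\<forall>V\<in>\<V>. openin (SL_topology n F) V \<and> 1\<^sub>m n \<in> V"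
    "\<forall>V\<in>\<V>. \<forall>V'\<in>\<V>. \<exists>W\<in>\<V>. W \<subseteq> V \<inter> V'"
    "\<forall>V\<in>\<V>. \<exists>W\<in>\<V>. \<forall>x\<in>W. \<forall>y\<in>W. x * y \<in> V"
    "\<forall>V\<in>\<V>. \<exists>W\<in>\<V>. \<forall>x\<in>W. inv\<^bsub>G\<^esub> x \<in> V"
    "\<forall>V\<in>\<V>. \<forall>g\<in>carrier G. \<exists>W\<in>\<V>. \<forall>x\<in>W. g * x * inv\<^bsub>G\<^esub> g \<in> V"
    using base unfolding coarser_group_base_def SL_mult SL_one by - (elim conjE, assumption)+
  show "\<V> \<noteq> {}" "\<Inter>\<V> = N" by (rule b)+
  show "V \<in> \<V> \<Longrightarrow> openin (SL_topology n F) V" "V \<in> \<V> \<Longrightarrow> 1\<^sub>m n \<in> V" using b(3) by simp_all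
  show "V \<in> \<V> \<Longrightarrow> V' \<in> \<V> \<Longrightarrow> \<exists>W\<in>\<V>. W \<subseteq> V \<inter> V'" by (rule b(4)[rule_format])
  show "V \<in> \<V> \<Longrightarrow> \<exists>W\<in>\<V>. \<forall>x\<in>W. \<forall>y\<in>W. x * y \<in> V" by (rule bspec[OF b(5)])
  show "V \<in> \<V> \<Longrightarrow> \<exists>W\<in>\<V>. \<forall>x\<in>W. inv\<^bsub>G\<^esub> x \<in> V" by (rule bspec[OF b(6)])
  show "V \<in> \<V> \<Longrightarrow> g \<in> carrier G \<Longrightarrow> \<exists>W\<in>\<V>. \<forall>x\<in>W. g * x * inv\<^bsub>G\<^esub> g \<in> V"
    by (rule bspec[OF bspec[OF b(7)]])
qed

lemma base_sub: "V \<in> \<V> \<Longrightarrow> V \<subseteq> carrier G"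
  using base_open openin_carrier by blast

lemma base_ball:
  assumes "V \<in> \<V>"
  obtains e where "e > 0" "\<And>B. B \<in> carrier G \<Longrightarrow> mnorm (1\<^sub>m n - B) < e \<Longrightarrow> B \<in> V"
  using base_open[OF assms] base_one[OF assms] unfolding openin_SL_topology by blast

lemma sub_UNIV: "carrier G \<subseteq> carrier (SL n UNIV)"
  by (rule SL_mono) simp

lemma inv_eq_adj: "A \<in> carrier G \<Longrightarrow> inv\<^bsub>G\<^esub> A = adj_mat A"
  using inv_SL_eqI[OF F] SL_adj_mat[OF F] by blast

text \<open>The closure of the trivial subgroup in the extension of the coarser topology to \<open>SL n UNIV\<close>.\<close>
definition M :: "'p padic mat set" where
  "M = {m \<in> carrier (SL n UNIV). \<forall>V\<in>\<V>. \<forall>e>0. \<exists>g\<in>V. mnorm (m - g) < e}"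

lemma M_memI:
  assumes "m \<in> carrier_mat n n" "\<And>V e. V \<in> \<V> \<Longrightarrow> e > 0 \<Longrightarrow> \<exists>g\<in>V. mnorm (m - g) < e"
  shows "m \<in> M"
proof -
  obtain V where V: "V \<in> \<V>" using base_nonempty by blast
  have "m \<in> carrier (SL n UNIV)"
    by (rule det_approx_1[OF assms(1)]) (use assms(2)[OF V] base_sub[OF V] sub_UNIV in blast)
  thus ?thesis using assms(2) unfolding M_def by blast
qed

lemma M_approx: "m \<in> M \<Longrightarrow> V \<in> \<V> \<Longrightarrow> e > 0 \<Longrightarrow> \<exists>g\<in>V. mnorm (m - g) < e"
  unfolding M_def by blast

lemma M_sub: "m \<in> M \<Longrightarrow> m \<in> carrier (SL n UNIV)"
  unfolding M_def by blast

lemma mem_G_mat: "A \<in> carrier G \<Longrightarrow> A \<in> carrier_mat n n" "V \<in> \<V> \<Longrightarrow> A \<in> V \<Longrightarrow> A \<in> carrier_mat n n"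
  using SL_carrier_mat base_sub by blast+

text \<open>The usual argument that the closure of a small neighbourhood lies in a larger one. If
  products from \<open>W\<close> lie in \<open>V\<close>, then elements v of \<open>W\<close> near m
  satisfy v^(-1) m in \<open>W\<close>, so m = v (v^(-1) m) lies in \<open>V\<close>.\<close>

lemma M_Int_G:
  assumes m: "m \<in> M" "m \<in> carrier G"
  shows "m \<in> N"
proof -
  have "m \<in> V" if V: "V \<in> \<V>" for V
  proof -
    obtain W where W: "W \<in> \<V>" "\<And>x y. x \<in> W \<Longrightarrow> y \<in> W \<Longrightarrow> x * y \<in> V" using base_mult[OF V] by blast
    have "openin (SL_topology n F) {g \<in> carrier G. inv\<^bsub>G\<^esub> g \<in> {x \<in> carrier G. x \<otimes>\<^bsub>G\<^esub> m \<in> W}}"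
      by (intro openin_inv openin_mult_right base_open W m)
    moreover have "m \<in> {g \<in> carrier G. inv\<^bsub>G\<^esub> g \<in> {x \<in> carrier G. x \<otimes>\<^bsub>G\<^esub> m \<in> W}}"
      using m base_one[OF W(1)] l_inv[OF m(2)] by simp
    ultimately obtain e where e: "e > 0"
      "\<forall>B\<in>carrier G. mnorm (m - B) < e \<longrightarrow> B \<in> {g \<in> carrier G. inv\<^bsub>G\<^esub> g \<in> {x \<in> carrier G. x \<otimes>\<^bsub>G\<^esub> m \<in> W}}"
      unfolding openin_SL_topology by (elim conjE) (drule (1) bspec, elim exE conjE, rule that)
    obtain v where v: "v \<in> W" "mnorm (m - v) < e" using M_approx[OF m(1) W(1) e(1)] by blast
    have vG: "v \<in> carrier G" using v(1) base_sub[OF W(1)] by blast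
    have "inv\<^bsub>G\<^esub> v * m \<in> W" using e(2)[rule_format, OF vG v(2)] by simp
    hence "v * (inv\<^bsub>G\<^esub> v * m) \<in> V" by (rule W(2)[OF v(1)])
    thus "m \<in> V" using mult_inv_mult[OF vG m(2)] by simp
  qed
  thus ?thesis using base_Inter by blast
qed

lemma group_UNIV: "group (SL n (UNIV :: 'p padic set))"
  by (rule group_SL[OF is_subfield_UNIV])

lemma inv_UNIV:
  assumes "A \<in> carrier (SL n (UNIV :: 'p padic set))"
  shows "inv\<^bsub>SL n UNIV\<^esub> A = adj_mat A"
  using inv_SL_eqI[OF is_subfield_UNIV assms SL_adj_mat(1,3)[OF is_subfield_UNIV assms]] .

lemma adj_mat_near:
  assumes "A \<in> carrier (SL n UNIV)" "e > 0"
  obtains d where "d > 0" "\<And>B. B \<in> carrier (SL n (UNIV :: 'p padic set)) \<Longrightarrow> mnorm (A - B) < d \<Longrightarrow> mnorm (adj_mat A - adj_mat B) < e"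
proof -
  note A = SL_adj_mat[OF is_subfield_UNIV assms(1)]
  obtain d where d: "d > 0" "\<And>B B'. B \<in> carrier_mat n n \<Longrightarrow> B' \<in> carrier_mat n n \<Longrightarrow> B' * B = 1\<^sub>m n \<Longrightarrow>
     mnorm (A - B) < d \<Longrightarrow> mnorm (adj_mat A - B') < e"
    using mnorm_inverse_continuous[OF SL_carrier_mat[OF assms(1)] SL_carrier_mat[OF A(1)] A(3) assms(2)] by blast
  show ?thesis
  proof (rule that[OF d(1)])
    fix B assume B: "B \<in> carrier (SL n (UNIV :: 'p padic set))" "mnorm (A - B) < d"
    note B' = SL_adj_mat[OF is_subfield_UNIV B(1)]
    show "mnorm (adj_mat A - adj_mat B) < e"
      by (rule d(2)[OF SL_carrier_mat[OF B(1)] SL_carrier_mat[OF B'(1)] B'(2) B(2)])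
  qed
qed

text \<open>The subgroup laws pass to limits from the corresponding laws of the base. For normality
  the base only controls conjugation by elements over \<open>F\<close>, so a conjugating matrix over
  Q_p is first approximated by one over \<open>F\<close>.\<close>

lemma normal_M: "M \<lhd> SL n UNIV"
proof -
  interpret U: group "SL n (UNIV :: 'p padic set)" by (rule group_UNIV)
  have sub: "subgroup M (SL n UNIV)"
  proof
    show "M \<subseteq> carrier (SL n UNIV)" using M_sub by blast
    have "1\<^sub>m n \<in> M"
    proof (rule M_memI)
      fix V and e :: real assume "V \<in> \<V>" "e > 0"
      thus "\<exists>g\<in>V. mnorm (1\<^sub>m n - g) < e"
        using base_one by (intro bexI[of _ "1\<^sub>m n"]) (simp_all only: mnorm_diff_self[OF one_carrier_mat])
    qed simp
    thus "\<one>\<^bsub>SL n UNIV\<^esub> \<in> M" by simp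
  next
    fix x y assume xy: "x \<in> M" "y \<in> M"
    note m = SL_carrier_mat[OF M_sub[OF xy(1)]] SL_carrier_mat[OF M_sub[OF xy(2)]]
    have "x * y \<in> M"
    proof (rule M_memI)
      fix V and e :: real assume V: "V \<in> \<V>" and e: "e > 0"
      obtain W where W: "W \<in> \<V>" "\<And>x y. x \<in> W \<Longrightarrow> y \<in> W \<Longrightarrow> x * y \<in> V" using base_mult[OF V] by blast
      obtain d where d: "d > 0" "\<And>A' B'. A' \<in> carrier_mat n n \<Longrightarrow> B' \<in> carrier_mat n n \<Longrightarrow>
          mnorm (x - A') < d \<Longrightarrow> mnorm (y - B') < d \<Longrightarrow> mnorm (x * y - A' * B') < e"
        using mnorm_mult_continuous[OF m e] by blast
      obtain g where g: "g \<in> W" "mnorm (x - g) < d" using M_approx[OF xy(1) W(1) d(1)] by blast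
      obtain g' where g': "g' \<in> W" "mnorm (y - g') < d" using M_approx[OF xy(2) W(1) d(1)] by blast
      have "mnorm (x * y - g * g') < e"
        by (rule d(2)[OF mem_G_mat(2)[OF W(1) g(1)] mem_G_mat(2)[OF W(1) g'(1)] g(2) g'(2)])
      thus "\<exists>g\<in>V. mnorm (x * y - g) < e" using W(2)[OF g(1) g'(1)] by blast
    qed (use m in simp)
    thus "x \<otimes>\<^bsub>SL n UNIV\<^esub> y \<in> M" by simp
  next
    fix x assume x: "x \<in> M"
    note xU = M_sub[OF x]
    have "adj_mat x \<in> M"
    proof (rule M_memI)
      show "adj_mat x \<in> carrier_mat n n"
        by (rule SL_carrier_mat[OF SL_adj_mat(1)[OF is_subfield_UNIV xU]])
      fix V and e :: real assume V: "V \<in> \<V>" and e: "e > 0"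
      obtain W where W: "W \<in> \<V>" "\<And>x. x \<in> W \<Longrightarrow> inv\<^bsub>G\<^esub> x \<in> V" using base_inv[OF V] by blast
      obtain d where d: "d > 0" "\<And>B. B \<in> carrier (SL n UNIV) \<Longrightarrow> mnorm (x - B) < d \<Longrightarrow> mnorm (adj_mat x - adj_mat B) < e"
        using adj_mat_near[OF xU e] by blast
      obtain g where g: "g \<in> W" "mnorm (x - g) < d" using M_approx[OF x W(1) d(1)] by blast
      have gG: "g \<in> carrier G" using g(1) base_sub[OF W(1)] by blast
      hence "mnorm (adj_mat x - adj_mat g) < e" using d(2) g(2) sub_UNIV by blast
      moreover have "adj_mat g \<in> V" using W(2)[OF g(1)] inv_eq_adj[OF gG] by simp
      ultimately show "\<exists>g\<in>V. mnorm (adj_mat x - g) < e" by blast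
    qed
    thus "inv\<^bsub>SL n UNIV\<^esub> x \<in> M" using inv_UNIV[OF xU] by simp
  qed
  have conj: "h * m * adj_mat h \<in> M" if h: "h \<in> carrier (SL n UNIV)" and m: "m \<in> M" for h m
  proof (rule M_memI)
    note h' = SL_adj_mat[OF is_subfield_UNIV h]
    note mats = SL_carrier_mat[OF h] SL_carrier_mat[OF M_sub[OF m]] SL_carrier_mat[OF h'(1)]
    note hm = mult_carrier_mat[OF mats(1,2)]
    show "h * m * adj_mat h \<in> carrier_mat n n" by (rule mult_carrier_mat[OF hm mats(3)])
    fix V and e :: real assume V: "V \<in> \<V>" and e: "e > 0"
    obtain d1 where d1: "d1 > 0" "\<And>A' B'. A' \<in> carrier_mat n n \<Longrightarrow> B' \<in> carrier_mat n n \<Longrightarrow>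
        mnorm (h * m - A') < d1 \<Longrightarrow> mnorm (adj_mat h - B') < d1 \<Longrightarrow> mnorm (h * m * adj_mat h - A' * B') < e"
      using mnorm_mult_continuous[OF hm mats(3) e] by blast
    obtain d2 where d2: "d2 > 0" "\<And>A' B'. A' \<in> carrier_mat n n \<Longrightarrow> B' \<in> carrier_mat n n \<Longrightarrow>
        mnorm (h - A') < d2 \<Longrightarrow> mnorm (m - B') < d2 \<Longrightarrow> mnorm (h * m - A' * B') < d1"
      using mnorm_mult_continuous[OF mats(1,2) d1(1)] by blast
    obtain d3 where d3: "d3 > 0" "\<And>B. B \<in> carrier (SL n UNIV) \<Longrightarrow> mnorm (h - B) < d3 \<Longrightarrow> mnorm (adj_mat h - adj_mat B) < d1"
      using adj_mat_near[OF h d1(1)] by blast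
    have "min d2 d3 > 0" using d2(1) d3(1) by simp
    \<comment> \<open>The order of choices matters: the neighbourhood \<open>W\<close> that k
      conjugates into \<open>V\<close> depends on k, so k is fixed first, and only then is g taken
      from \<open>W\<close>, within the radius \<open>d2\<close> of m.\<close>
    then obtain k where k: "k \<in> carrier G" "mnorm (h - k) < min d2 d3" using SL_dense[OF F n h] by blast
    note km = mem_G_mat(1)[OF k(1)] and k'm = mem_G_mat(1)[OF SL_adj_mat(1)[OF F k(1)]]
    obtain W where W: "W \<in> \<V>" "\<And>x. x \<in> W \<Longrightarrow> k * x * inv\<^bsub>G\<^esub> k \<in> V" using base_conj[OF V k(1)] by blast
    obtain g where g: "g \<in> W" "mnorm (m - g) < d2" using M_approx[OF m W(1) d2(1)] by blast
    note gm = mem_G_mat(2)[OF W(1) g(1)]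
    have "mnorm (h * m - k * g) < d1" using d2(2)[OF km gm _ g(2)] k(2) by simp
    moreover have "mnorm (adj_mat h - adj_mat k) < d1" using d3(2) k sub_UNIV by auto
    ultimately have "mnorm (h * m * adj_mat h - k * g * adj_mat k) < e"
      by (rule d1(2)[OF mult_carrier_mat[OF km gm] k'm])
    moreover have "k * g * adj_mat k \<in> V" using W(2)[OF g(1)] inv_eq_adj[OF k(1)] by simp
    ultimately show "\<exists>g\<in>V. mnorm (h * m * adj_mat h - g) < e" by blast
  qed
  show ?thesis
    unfolding U.normal_inv_iff
  proof (intro conjI sub ballI)
    fix h m :: "'p padic mat" assume "h \<in> carrier (SL n UNIV)" "m \<in> M"
    thus "h \<otimes>\<^bsub>SL n UNIV\<^esub> m \<otimes>\<^bsub>SL n UNIV\<^esub> inv\<^bsub>SL n UNIV\<^esub> h \<in> M"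
      using conj inv_UNIV by simp
  qed
qed

text \<open>Iwasawa's argument is used twice. A nonscalar limit point makes \<open>M\<close> all of
  SL(n,Q_p); then a transvection over \<open>F\<close> lies in \<open>M\<close>, hence in
  \<open>N\<close>, and being nonscalar it forces \<open>N\<close> to be everything. For n = 1 every
  matrix is scalar.\<close>

lemma N_whole_or_M_scalar: "N = carrier G \<or> (\<forall>m\<in>M. scalar_mat n m)"
proof (rule disjCI)
  assume "\<not> (\<forall>m\<in>M. scalar_mat n m)"
  then obtain m where m: "m \<in> M" "\<not> scalar_mat n m" by blast
  interpret U: SL_normal UNIV n M by (rule SL_normal.intro[OF is_subfield_UNIV normal_M])
  interpret S: SL_normal F n N by (rule SL_normal.intro[OF F normal])
  have all: "M = carrier (SL n UNIV)" by (rule U.SL_normal_eq_carrier[OF m])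
  have "n \<noteq> 1"
  proof
    assume "n = 1"
    hence "scalar_mat n m" using SL_carrier_mat[OF M_sub[OF m(1)]] by (intro scalar_matI) auto
    thus False using m by simp
  qed
  hence n2: "0 < n" "1 < n" using n by auto
  have E: "elem_mat n 0 1 1 \<in> carrier G" by (rule elem_mat_SL[OF F subfield_1[OF F] n2]) simp
  hence "elem_mat n 0 1 1 \<in> N" using M_Int_G all sub_UNIV by blast
  moreover have "\<not> scalar_mat n (elem_mat n 0 1 (1 :: 'p padic))"
  proof
    assume "scalar_mat n (elem_mat n 0 1 (1 :: 'p padic))"
    then obtain c where "elem_mat n 0 1 (1 :: 'p padic) = c \<cdot>\<^sub>m 1\<^sub>m n" by (auto simp: scalar_mat_def)
    hence "elem_mat n 0 1 (1 :: 'p padic) $$ (0, 1) = (c \<cdot>\<^sub>m 1\<^sub>m n) $$ (0, 1)" by simp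
    thus False using n2 by (simp add: index_elem_mat)
  qed
  ultimately show "N = carrier G" by (rule S.SL_normal_eq_carrier)
qed

section \<open>Scalar limit points: a bounded neighbourhood and minimality\<close>

context
  assumes scalar: "\<And>m. m \<in> M \<Longrightarrow> scalar_mat n m"
begin

lemma M_sub_N: "m \<in> M \<Longrightarrow> m \<in> N"
  by (rule M_Int_G[OF _ scalar_SL_subfield[OF F cop n M_sub scalar]])

text \<open>Cluster points are needed for elements of the base subject to a side condition
  \<open>P\<close>: once for the square-zero unipotents of size one, once for elements outside
  \<open>N <#> U\<close>. The traces on \<open>P\<close> again form a directed family.\<close>

lemma base_cluster:
  assumes "\<And>V. V \<in> \<V> \<Longrightarrow> \<exists>g\<in>V. g \<in> P \<and> mnorm g \<le> R"
  obtains m where "m \<in> carrier_mat n n" "\<forall>V\<in>\<V>. \<forall>e>0. \<exists>g\<in>V. g \<in> P \<and> mnorm (m - g) < e"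
proof -
  let ?W = "(\<lambda>V. V \<inter> P) ` \<V>"
  obtain m where m: "m \<in> carrier_mat n n"
    "\<And>V e. V \<in> ?W \<Longrightarrow> e > 0 \<Longrightarrow> \<exists>A\<in>V. A \<in> carrier_mat n n \<and> mnorm A \<le> R \<and> mnorm (m - A) < e"
  proof (rule bounded_matrices_cluster[of ?W n R])
    show "?W \<noteq> {}" using base_nonempty by simp
    show "\<exists>W\<in>?W. W \<subseteq> V \<inter> V'" if VV: "V \<in> ?W" "V' \<in> ?W" for V V'
    proof -
      obtain X X' where X: "X \<in> \<V>" "V = X \<inter> P" "X' \<in> \<V>" "V' = X' \<inter> P" using VV by blast
      obtain Y where "Y \<in> \<V>" "Y \<subseteq> X \<inter> X'" using base_Int[OF X(1,3)] by blast
      thus ?thesis using X by (intro bexI[of _ "Y \<inter> P"]) auto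
    qed
    show "\<exists>A\<in>V. A \<in> carrier_mat n n \<and> mnorm A \<le> R" if VW: "V \<in> ?W" for V
    proof -
      obtain X where X: "X \<in> \<V>" "V = X \<inter> P" using VW by blast
      obtain u where u: "u \<in> X" "u \<in> P" "mnorm u \<le> R" using assms[OF X(1)] by blast
      thus ?thesis using X mem_G_mat(2)[OF X(1) u(1)] by blast
    qed
  qed blast
  have "\<exists>g\<in>V. g \<in> P \<and> mnorm (m - g) < e" if "V \<in> \<V>" "e > 0" for V e
    using m(2)[of "V \<inter> P" e] that by auto
  hence "\<forall>V\<in>\<V>. \<forall>e>0. \<exists>g\<in>V. g \<in> P \<and> mnorm (m - g) < e" by blast
  with m(1) show thesis by (rule that)
qed

lemma base_bounded: "\<exists>V\<in>\<V>. \<exists>R. \<forall>g\<in>V. mnorm g \<le> R"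
proof (rule ccontr)
  assume "\<not> ?thesis"
  hence "\<not> (\<forall>g\<in>V. mnorm g \<le> R)" if "V \<in> \<V>" for V R using that by blast
  hence unbounded: "\<exists>g\<in>V. mnorm g > R" if "V \<in> \<V>" for V R using that by (simp add: not_le)
  \<comment> \<open>Both conditions survive approximation in the ultrametric norm, and together they
    exclude scalar limits.\<close>
  define P where "P = {u \<in> carrier G. mnorm (u - 1\<^sub>m n) = 1 \<and> (u - 1\<^sub>m n) * (u - 1\<^sub>m n) = 0\<^sub>m n n}"
  have nonempty: "\<exists>u\<in>V. u \<in> P" if V: "V \<in> \<V>" for V
  proof -
    \<comment> \<open>The smallness needed to recover u as g^(-1) w g, where w = g u g^(-1): the
      factors g^(-1) and w come from \<open>W2\<close>, their product and g lie in
      \<open>W1\<close>, and the result lies in \<open>V\<close>.\<close>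
    obtain W1 where W1: "W1 \<in> \<V>" "\<And>x y. x \<in> W1 \<Longrightarrow> y \<in> W1 \<Longrightarrow> x * y \<in> V" using base_mult[OF V] by blast
    obtain W2 where W2: "W2 \<in> \<V>" "\<And>x y. x \<in> W2 \<Longrightarrow> y \<in> W2 \<Longrightarrow> x * y \<in> W1" using base_mult[OF W1(1)] by blast
    obtain W3 where W3: "W3 \<in> \<V>" "\<And>x. x \<in> W3 \<Longrightarrow> inv\<^bsub>G\<^esub> x \<in> W2" using base_inv[OF W2(1)] by blast
    obtain W4 where W4: "W4 \<in> \<V>" "W4 \<subseteq> W2 \<inter> W3" using base_Int[OF W2(1) W3(1)] by blast
    obtain W5 where W5: "W5 \<in> \<V>" "W5 \<subseteq> W4 \<inter> W1" using base_Int[OF W4(1) W1(1)] by blast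
    obtain e where e: "e > 0" "\<And>B. B \<in> carrier G \<Longrightarrow> mnorm (1\<^sub>m n - B) < e \<Longrightarrow> B \<in> W5"
      using base_ball[OF W5(1)] by blast
    \<comment> \<open>A norm above 1 permits the contraction, and a norm above 1/e places the
      contracted element within e of the identity.\<close>
    obtain g where g: "g \<in> W5" "mnorm g > max 1 (inverse e)" using unbounded[OF W5(1)] by blast
    have gG: "g \<in> carrier G" using g(1) base_sub[OF W5(1)] by blast
    have g1: "mnorm g > 1" using g(2) by simp
    obtain u where u: "u \<in> carrier G" "mnorm (u - 1\<^sub>m n) = 1" "(u - 1\<^sub>m n) * (u - 1\<^sub>m n) = 0\<^sub>m n n"
      "mnorm (1\<^sub>m n - g * u * adj_mat g) \<le> inverse (mnorm g)"
      by (rule SL_contracted_unipotent[OF F gG g1])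
    let ?w = "g * u * adj_mat g"
    note g' = SL_adj_mat[OF F gG]
    have wG: "?w \<in> carrier G" by (intro SL_mult_closed[OF F] gG u(1) g'(1))
    have "inverse (mnorm g) < inverse (inverse e)"
      using g(2) e(1) by (intro less_imp_inverse_less) auto
    hence "?w \<in> W5" using e u(4) wG by simp
    hence "?w \<in> W2" "g \<in> W2" "inv\<^bsub>G\<^esub> g \<in> W2" "g \<in> W1" using W5(2) W4(2) W3(2) g(1) by auto
    hence "inv\<^bsub>G\<^esub> g * ?w * g \<in> V" by (intro W1(2) W2(2))
    moreover have "inv\<^bsub>G\<^esub> g * ?w * g = u"
    proof -
      have "inv\<^bsub>G\<^esub> g \<otimes>\<^bsub>G\<^esub> (g \<otimes>\<^bsub>G\<^esub> u \<otimes>\<^bsub>G\<^esub> inv\<^bsub>G\<^esub> g) \<otimes>\<^bsub>G\<^esub> g = u"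
        using gG u(1) by (simp only: m_assoc m_closed inv_closed l_inv r_one) (simp only: m_assoc[symmetric] m_closed inv_closed l_inv l_one)
      thus ?thesis by (simp add: inv_eq_adj[OF gG])
    qed
    ultimately show ?thesis using u by (auto simp: P_def)
  qed
  have norm: "\<exists>u\<in>V. u \<in> P \<and> mnorm u \<le> 1" if V: "V \<in> \<V>" for V
  proof -
    obtain u where u: "u \<in> V" "u \<in> P" using nonempty[OF V] by blast
    have um: "u \<in> carrier_mat n n" by (rule mem_G_mat(2)[OF V u(1)])
    have "u = (u - 1\<^sub>m n) + 1\<^sub>m n" using um by (intro eq_matI) auto
    hence "mnorm u \<le> max (mnorm (u - 1\<^sub>m n)) (mnorm (1\<^sub>m n :: 'p padic mat))"
      using mnorm_ultra[of "u - 1\<^sub>m n" n n "1\<^sub>m n"] minus_carrier_mat[of "1\<^sub>m n" n n u] by simp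
    also have "\<dots> \<le> 1" using u(2) mnorm_one_le[of n] by (simp add: P_def)
    finally show ?thesis using u by blast
  qed
  obtain m where m1: "m \<in> carrier_mat n n" and m2: "\<forall>V\<in>\<V>. \<forall>e>0. \<exists>u\<in>V. u \<in> P \<and> mnorm (m - u) < e"
    using base_cluster[of P 1, OF norm] .
  note m = m1 m2[rule_format]
  have "m \<in> M" using m by (intro M_memI[OF m(1)]) blast
  then obtain c where c: "m = c \<cdot>\<^sub>m 1\<^sub>m n" using scalar by (auto simp: scalar_mat_def)
  obtain V where V: "V \<in> \<V>" using base_nonempty by blast
  obtain u where u: "u \<in> V" "u \<in> P" "mnorm (m - u) < 1" using m(2)[OF V, of 1] by auto
  have um: "u \<in> carrier_mat n n" by (rule mem_G_mat(2)[OF V u(1)])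
  have u1: "mnorm (u - 1\<^sub>m n) = 1" "(u - 1\<^sub>m n) * (u - 1\<^sub>m n) = 0\<^sub>m n n" using u(2) by (auto simp: P_def)
  \<comment> \<open>A single u at distance below 1 from m suffices: \<open>?A\<close> inherits norm
    1 from \<open>?B\<close>, while its square differs from 0 by less than 1. For a scalar matrix
    the norm of the square is |c - 1|^2, which is then at least 1.\<close>
  let ?A = "m - 1\<^sub>m n" and ?B = "u - 1\<^sub>m n"
  have AB: "?A \<in> carrier_mat n n" "?B \<in> carrier_mat n n" by (rule minus_carrier_mat; simp)+
  have diff: "?A - ?B = m - u" using m(1) um by (intro eq_matI) auto
  have "mnorm (?B - ?A) < mnorm ?B" using diff u1 u(3) mnorm_diff_commute[OF AB] by simp
  hence A1: "mnorm ?A = 1" using mnorm_eqI[OF AB(2,1)] u1 by simp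
  have "mnorm (?A * ?A - ?B * ?B) \<le> max (mnorm ?A * mnorm (?A - ?B)) (mnorm (?A - ?B) * mnorm ?B)"
    by (rule mnorm_mult_diff[OF AB AB])
  also have "\<dots> < 1" using u(3) by (simp add: A1 u1 diff)
  finally have small: "mnorm (?A * ?A - 0\<^sub>m n n) < 1" by (simp add: u1)
  have A: "?A = (c - 1) \<cdot>\<^sub>m 1\<^sub>m n" unfolding c by (intro eq_matI) auto
  have sq: "?A * ?A - 0\<^sub>m n n = ((c - 1) * (c - 1)) \<cdot>\<^sub>m 1\<^sub>m n" unfolding A by (intro eq_matI) auto
  have "padic_abs x \<le> mnorm (x \<cdot>\<^sub>m 1\<^sub>m n)" for x :: "'p padic"
    using mnorm_ge[of 0 "x \<cdot>\<^sub>m 1\<^sub>m n" 0] n by simp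
  from order_le_less_trans[OF this small[unfolded sq]] have "padic_abs ((c - 1) * (c - 1)) < 1" .
  moreover have "mnorm ?A \<le> padic_abs (c - 1)" unfolding A by (rule mnorm_leI) auto
  hence "1 * 1 \<le> padic_abs (c - 1) * padic_abs (c - 1)" using A1 by (intro mult_mono) auto
  ultimately show False by (simp add: padic_abs_mult)
qed

text \<open>A cluster point m of elements outside \<open>N <#> U\<close> would lie in
  \<open>M\<close>, hence in \<open>N\<close>. For g close to m the element m^(-1) g belongs to
  \<open>U\<close>, so g = m (m^(-1) g) would lie in \<open>N <#> U\<close> after all.\<close>

lemma base_small:
  assumes U: "openin (SL_topology n F) U" "1\<^sub>m n \<in> U"
  shows "\<exists>V\<in>\<V>. V \<subseteq> N <#>\<^bsub>G\<^esub> U"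
proof (rule ccontr)
  assume "\<not> ?thesis"
  hence neg: "\<exists>g\<in>V. g \<notin> N <#>\<^bsub>G\<^esub> U" if "V \<in> \<V>" for V using that by blast
  obtain V0 R where V0: "V0 \<in> \<V>" "\<And>g. g \<in> V0 \<Longrightarrow> mnorm g \<le> R" using base_bounded by blast
  have "\<exists>g\<in>V. g \<in> - (N <#>\<^bsub>G\<^esub> U) \<and> mnorm g \<le> R" if V: "V \<in> \<V>" for V
  proof -
    obtain Y where Y: "Y \<in> \<V>" "Y \<subseteq> V \<inter> V0" using base_Int[OF V V0(1)] by blast
    thus ?thesis using neg[OF Y(1)] V0(2) by blast
  qed
  then obtain m where m: "m \<in> carrier_mat n n"
    "\<forall>V\<in>\<V>. \<forall>e>0. \<exists>g\<in>V. g \<in> - (N <#>\<^bsub>G\<^esub> U) \<and> mnorm (m - g) < e"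
    by (rule base_cluster)
  have near: "\<exists>g\<in>V. g \<notin> N <#>\<^bsub>G\<^esub> U \<and> mnorm (m - g) < e" if "V \<in> \<V>" "e > 0" for V e
    using m(2) that by blast
  have "m \<in> M" using near by (intro M_memI[OF m(1)]) blast
  hence mN: "m \<in> N" by (rule M_sub_N)
  hence mG: "m \<in> carrier G" by (rule subgroup.mem_carrier[OF normal_imp_subgroup[OF normal]])
  have "openin (SL_topology n F) {x \<in> carrier G. inv\<^bsub>G\<^esub> m \<otimes>\<^bsub>G\<^esub> x \<in> U}"
    by (intro openin_mult_left U inv_closed mG)
  moreover have "m \<in> {x \<in> carrier G. inv\<^bsub>G\<^esub> m \<otimes>\<^bsub>G\<^esub> x \<in> U}" using mG l_inv[OF mG] U(2) by simp
  ultimately obtain e where e: "e > 0"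
    "\<forall>B\<in>carrier G. mnorm (m - B) < e \<longrightarrow> B \<in> {x \<in> carrier G. inv\<^bsub>G\<^esub> m \<otimes>\<^bsub>G\<^esub> x \<in> U}"
    unfolding openin_SL_topology by (elim conjE) (drule (1) bspec, elim exE conjE, rule that)
  obtain g where g: "g \<in> V0" "g \<notin> N <#>\<^bsub>G\<^esub> U" "mnorm (m - g) < e" using near[OF V0(1) e(1)] by blast
  have gG: "g \<in> carrier G" using g(1) base_sub[OF V0(1)] by blast
  have "inv\<^bsub>G\<^esub> m \<otimes>\<^bsub>G\<^esub> g \<in> U" using e(2)[rule_format, OF gG g(3)] by simp
  hence "m \<otimes>\<^bsub>G\<^esub> (inv\<^bsub>G\<^esub> m \<otimes>\<^bsub>G\<^esub> g) \<in> N <#>\<^bsub>G\<^esub> U" using mN unfolding set_mult_def by blast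
  thus False using g(2) mult_inv_mult[OF mG gG] by simp
qed

end

lemma base_minimal:
  assumes U: "openin (SL_topology n F) U" "1\<^sub>m n \<in> U"
  shows "\<exists>V\<in>\<V>. V \<subseteq> N <#>\<^bsub>G\<^esub> U"
proof (cases "N = carrier G")
  case True
  obtain V where V: "V \<in> \<V>" using base_nonempty by blast
  have "v \<in> N <#>\<^bsub>G\<^esub> U" if v: "v \<in> V" for v
  proof -
    have "v \<in> N" using v base_sub[OF V] True by blast
    hence "v \<otimes>\<^bsub>G\<^esub> 1\<^sub>m n \<in> N <#>\<^bsub>G\<^esub> U" using U(2) unfolding set_mult_def by blast
    thus ?thesis using mem_G_mat(2)[OF V v] by simp
  qed
  thus ?thesis using V by blast
next
  case False
  hence "\<And>m. m \<in> M \<Longrightarrow> scalar_mat n m" using N_whole_or_M_scalar by blast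
  thus ?thesis using base_small U by blast
qed

end

theorem SL_minimal_modulo:
  fixes F :: "'p::prime_card padic set"
  assumes "is_subfield F" "n > 0" "coprime n (CARD('p) - 1)" "N \<lhd> SL n F"
  shows "minimal_modulo (SL n F) (SL_topology n F) N"
  unfolding minimal_modulo_def
proof (intro allI impI)
  fix \<V> U assume *: "coarser_group_base (SL n F) (SL_topology n F) \<V> N"
    "openin (SL_topology n F) U" "\<one>\<^bsub>SL n F\<^esub> \<in> U"
  interpret SL_coarser F n N \<V> by (rule SL_coarser.intro[OF assms *(1)])
  show "\<exists>V\<in>\<V>. V \<subseteq> N <#>\<^bsub>SL n F\<^esub> U" using base_minimal *(2,3) by simp
qed

section \<open>Roots of unity and non-minimality over the rationals\<close>

text \<open>That q divides m gives the scalar z determinant 1; that q is odd keeps the nontrivial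
  powers of z out of the rationals.\<close>

locale odd_root_of_unity =
  fixes m q :: nat and z :: "'p::prime_card padic"
  assumes m: "m > 0" "q dvd m" and q: "odd q" and z: "z ^ q = 1" "z \<noteq> 1"
begin

definition root_group :: "'p padic mat set" where
  "root_group = range (\<lambda>j. z ^ j \<cdot>\<^sub>m 1\<^sub>m m)"

abbreviation K where "K \<equiv> SL m (UNIV :: 'p padic set)"

abbreviation H where "H \<equiv> SL m (\<rat> :: 'p padic set)"

lemma scalar_mult_left: "B \<in> carrier_mat m m \<Longrightarrow> (c \<cdot>\<^sub>m 1\<^sub>m m) * B = c \<cdot>\<^sub>m (B :: 'p padic mat)"
  using mult_smult_assoc_mat[OF one_carrier_mat, of B m m c] by simp

lemma scalar_mult_right: "B \<in> carrier_mat m m \<Longrightarrow> B * (c \<cdot>\<^sub>m 1\<^sub>m m) = c \<cdot>\<^sub>m (B :: 'p padic mat)"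
  using mult_smult_distrib[OF _ one_carrier_mat, of B m m c] by simp

lemma z_power_m: "z ^ m = 1"
  using m(2) z(1) by (metis dvdE power_mult power_one)

lemma root_group_sub: "root_group \<subseteq> carrier K"
proof
  fix A assume "A \<in> root_group"
  then obtain j where j: "A = z ^ j \<cdot>\<^sub>m 1\<^sub>m m" by (auto simp: root_group_def)
  have "(z ^ j) ^ m = 1" using z_power_m by (metis mult.commute power_mult power_one)
  thus "A \<in> carrier K" by (simp add: j SL_carrier_iff)
qed

lemma normal_root_group: "root_group \<lhd> K"
proof -
  interpret group K by (rule group_SL[OF is_subfield_UNIV])
  have mem: "z ^ j \<cdot>\<^sub>m 1\<^sub>m m \<in> root_group" for j by (auto simp: root_group_def)
  have mult: "(z ^ i \<cdot>\<^sub>m 1\<^sub>m m) * (z ^ j \<cdot>\<^sub>m 1\<^sub>m m) = z ^ (i + j) \<cdot>\<^sub>m 1\<^sub>m m" for i j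
    by (subst scalar_mult_left) (auto simp: power_add intro!: eq_matI)
  have one: "z ^ 0 \<cdot>\<^sub>m 1\<^sub>m m = 1\<^sub>m m" by (auto intro!: eq_matI)
  have "subgroup root_group K"
  proof
    show "root_group \<subseteq> carrier K" by (rule root_group_sub)
    show "\<one>\<^bsub>K\<^esub> \<in> root_group" using mem[of 0] unfolding one by simp
    fix x assume x: "x \<in> root_group"
    then obtain j where j: "x = z ^ j \<cdot>\<^sub>m 1\<^sub>m m" by (auto simp: root_group_def)
    show "x \<otimes>\<^bsub>K\<^esub> y \<in> root_group" if y: "y \<in> root_group" for y
      using y mult mem by (auto simp: root_group_def j)
    \<comment> \<open>Exponents are natural numbers, so the inverse of z^j is written as z^((q-1)
      j).\<close>
    have "q > 0" using q by (cases q) auto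
    hence "j + (q - 1) * j = q * j" by (cases q) auto
    hence "z ^ (j + (q - 1) * j) = z ^ 0" using z(1) by (simp add: power_mult)
    hence "x * (z ^ ((q - 1) * j) \<cdot>\<^sub>m 1\<^sub>m m) = 1\<^sub>m m" by (simp only: j mult one)
    hence "inv\<^bsub>K\<^esub> x = z ^ ((q - 1) * j) \<cdot>\<^sub>m 1\<^sub>m m"
      using inv_SL_eqI[OF is_subfield_UNIV] x mem root_group_sub by blast
    thus "inv\<^bsub>K\<^esub> x \<in> root_group" using mem by simp
  qed
  moreover have "g \<otimes>\<^bsub>K\<^esub> x \<otimes>\<^bsub>K\<^esub> inv\<^bsub>K\<^esub> g \<in> root_group" if g: "g \<in> carrier K" and x: "x \<in> root_group" for g x
  proof -
    obtain j where j: "x = z ^ j \<cdot>\<^sub>m 1\<^sub>m m" using x by (auto simp: root_group_def)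
    have "g \<otimes>\<^bsub>K\<^esub> x = x \<otimes>\<^bsub>K\<^esub> g"
      using scalar_mult_left[OF SL_carrier_mat[OF g]] scalar_mult_right[OF SL_carrier_mat[OF g]] by (simp add: j)
    hence "g \<otimes>\<^bsub>K\<^esub> x \<otimes>\<^bsub>K\<^esub> inv\<^bsub>K\<^esub> g = x \<otimes>\<^bsub>K\<^esub> (g \<otimes>\<^bsub>K\<^esub> inv\<^bsub>K\<^esub> g)"
      using g x root_group_sub m_assoc[of x g "inv\<^bsub>K\<^esub> g"] by auto
    also have "\<dots> = x" unfolding r_inv[OF g] using x root_group_sub by (intro r_one) blast
    finally show ?thesis using x by simp
  qed
  ultimately show ?thesis by (simp only: normal_inv_iff) blast
qed

lemma closedin_root_group: "closedin (SL_topology m UNIV) root_group"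
proof -
  interpret top_group K "SL_topology m UNIV"
    using hausdorff_SL[OF is_subfield_UNIV] by (simp add: top_group_iff)
  have "z ^ j = z ^ (j mod q)" for j
    using z(1) by (metis mult_div_mod_eq power_add power_mult power_one mult_1)
  hence "root_group \<subseteq> (\<lambda>j. z ^ j \<cdot>\<^sub>m 1\<^sub>m m) ` {..<q}"
    using q by (auto simp: root_group_def intro!: image_eqI[of _ _ "_ mod q"] mod_less_divisor odd_pos)
  hence "finite root_group" by (rule finite_subset) simp
  thus ?thesis using closedin_Hausdorff_finite[OF Hausdorff] root_group_sub by simp
qed

text \<open>A rational s with s^q = 1 and q odd equals 1. This makes the quotient map injective on
  the rational matrices.\<close>

lemma root_group_Int_Rats:
  assumes "A \<in> root_group" "A \<in> carrier H"
  shows "A = 1\<^sub>m m"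
proof -
  obtain j where j: "A = z ^ j \<cdot>\<^sub>m 1\<^sub>m m" using assms(1) by (auto simp: root_group_def)
  have "A $$ (0, 0) \<in> \<rat>" using assms(2) m(1) by (simp add: SL_carrier_iff)
  hence "z ^ j \<in> \<rat>" using m(1) by (simp add: j)
  then obtain s where s: "z ^ j = of_rat s" by (auto elim: Rats_cases)
  have "of_rat (s ^ q) = (z ^ j) ^ q" by (simp add: s of_rat_power)
  also have "\<dots> = (z ^ q) ^ j" by (simp only: power_mult[symmetric] mult.commute)
  finally have "of_rat (s ^ q) = (of_rat 1 :: 'p padic)" using z(1) by simp
  hence sq: "s ^ q = 1" by (simp only: of_rat_eq_iff)
  have "s > 0"
  proof (rule ccontr)
    assume "\<not> s > 0"
    hence "s ^ q \<le> 0" using q by (simp add: power_le_zero_eq odd_pos)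
    thus False using sq by simp
  qed
  hence "s = 1" using power_eq_imp_eq_base[of s q 1] sq odd_pos[OF q] by simp
  thus ?thesis by (simp add: j s) (auto intro!: eq_matI)
qed

text \<open>If the induced topology were the original one, the ball of radius |1 - z| around the
  identity would be the trace of an open set of the quotient. That set contains the classes of all
  rational matrices close enough to the scalar z, yet these lie outside the ball.\<close>

theorem SL_Rats_not_minimal: "\<not> minimal_topological_group H (SL_topology m \<rat>)"
proof
  assume min: "minimal_topological_group H (SL_topology m \<rat>)"
  let ?f = "\<lambda>A. root_group #>\<^bsub>K\<^esub> A"
  let ?Q = "coset_topology K (SL_topology m UNIV) root_group"
  let ?T = "pullback_topology (carrier H) ?f ?Q"
  interpret K: top_group K "SL_topology m UNIV"
    using hausdorff_SL[OF is_subfield_UNIV] by (simp add: top_group_iff)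
  interpret Q: top_group_quotient K "SL_topology m UNIV" "K Mod root_group" ?f
    by (rule K.coset_quotient[OF normal_root_group closedin_root_group])
  interpret QT: top_group "K Mod root_group" ?Q using Q.hausdorff_quotient by (simp add: top_group_iff)
  have H_sub: "carrier H \<subseteq> carrier K" by (rule SL_mono) simp
  have groupH: "group H" by (rule group_SL[OF is_subfield_Rats])
  have hom: "?f \<in> hom H (K Mod root_group)"
  proof (rule homI)
    fix x y assume xy: "x \<in> carrier H" "y \<in> carrier H"
    thus "?f x \<in> carrier (K Mod root_group)" using H_sub Q.hom_closed by blast
    have "?f (x \<otimes>\<^bsub>K\<^esub> y) = ?f x \<otimes>\<^bsub>K Mod root_group\<^esub> ?f y" using xy H_sub by (intro Q.hom_mult) auto
    thus "?f (x \<otimes>\<^bsub>H\<^esub> y) = ?f x \<otimes>\<^bsub>K Mod root_group\<^esub> ?f y" by simp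
  qed
  have ker: "x \<in> root_group" if "x \<in> carrier K" "?f x = \<one>\<^bsub>K Mod root_group\<^esub>" for x
    using that K.coset_quotient(2)[OF normal_root_group closedin_root_group] unfolding kernel_def by blast
  have "inj_on ?f (carrier H)"
  proof -
    interpret f: group_hom H "K Mod root_group" ?f
      using hom groupH Q.H.group_axioms by (simp add: group_hom_def group_hom_axioms_def)
    show ?thesis unfolding f.inj_on_one_iff using ker root_group_Int_Rats H_sub by auto
  qed
  hence haus: "hausdorff_topological_group H ?T"
    by (rule QT.hausdorff_pullback[OF groupH hom])
  have pre: "openin (SL_topology m UNIV) {x \<in> carrier K. ?f x \<in> W}" if "openin ?Q W" for W
    using that Q.openin_QT by blast
  have coarser: "openin (SL_topology m \<rat>) U" if U: "openin ?T U" for U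
  proof -
    obtain W where W: "openin ?Q W" "U = ?f -` W \<inter> carrier H" using U by (auto simp: openin_pullback_topology)
    show ?thesis
      unfolding openin_SL_topology
    proof (intro conjI ballI)
      show "U \<subseteq> carrier H" using W by blast
      fix A assume "A \<in> U"
      hence "A \<in> {x \<in> carrier K. ?f x \<in> W}" using W(2) H_sub by blast
      then obtain e where e: "e > 0" "\<forall>B\<in>carrier K. mnorm (A - B) < e \<longrightarrow> B \<in> {x \<in> carrier K. ?f x \<in> W}"
        using pre[OF W(1)] unfolding openin_SL_topology by (elim conjE) (drule (1) bspec, elim exE conjE, rule that)
      have "\<forall>B\<in>carrier H. mnorm (A - B) < e \<longrightarrow> B \<in> U" using e(2) W(2) H_sub by auto
      thus "\<exists>e>0. \<forall>B\<in>carrier H. mnorm (A - B) < e \<longrightarrow> B \<in> U" using e(1) by blast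
    qed
  qed
  have "?T = SL_topology m \<rat>"
    using min haus coarser unfolding minimal_topological_group_def by blast
  define e where "e = padic_abs (1 - z)"
  have "e \<noteq> 0" using z(2) by (simp add: e_def)
  hence e: "e > 0" using padic_abs_nonneg[of "1 - z"] unfolding e_def by linarith
  have "openin (SL_topology m \<rat>) {B \<in> carrier H. mnorm (1\<^sub>m m - B) < e}"
    by (rule openin_SL_ball) simp
  then obtain W where W: "openin ?Q W" "{B \<in> carrier H. mnorm (1\<^sub>m m - B) < e} = ?f -` W \<inter> carrier H"
    unfolding \<open>?T = SL_topology m \<rat>\<close>[symmetric] openin_pullback_topology by blast
  have "1\<^sub>m m \<in> {B \<in> carrier H. mnorm (1\<^sub>m m - B) < e}"
    using e by (simp only: mem_Collect_eq mnorm_diff_self[OF one_carrier_mat] SL_one_closed[OF is_subfield_Rats])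
  hence 1: "?f (1\<^sub>m m) \<in> W" unfolding W(2) by simp
  let ?z = "z \<cdot>\<^sub>m 1\<^sub>m m"
  have "z ^ 1 \<cdot>\<^sub>m 1\<^sub>m m \<in> root_group" unfolding root_group_def by (rule rangeI)
  hence zZ: "?z \<in> root_group" by simp
  hence zK: "?z \<in> carrier K" using root_group_sub by blast
  have "?f ?z = ?f \<one>\<^bsub>K\<^esub>"
    using K.coset_join2[OF zK normal_imp_subgroup[OF normal_root_group] zZ]
      K.coset_join2[OF K.one_closed normal_imp_subgroup[OF normal_root_group] subgroup.one_closed[OF normal_imp_subgroup[OF normal_root_group]]]
    by simp
  hence "?z \<in> {x \<in> carrier K. ?f x \<in> W}" using 1 zK by simp
  then obtain d where d: "d > 0" "\<forall>B\<in>carrier K. mnorm (?z - B) < d \<longrightarrow> B \<in> {x \<in> carrier K. ?f x \<in> W}"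
    using pre[OF W(1)] unfolding openin_SL_topology by (elim conjE) (drule (1) bspec, elim exE conjE, rule that)
  \<comment> \<open>The radius d puts the class of \<open>A\<close> into \<open>W\<close>; the
    radius e keeps \<open>A\<close> at distance |1 - z| or more from the identity.\<close>
  have "min d e > 0" using d e by simp
  then obtain A where A: "A \<in> carrier H" "mnorm (?z - A) < min d e"
    using SL_dense[OF is_subfield_Rats m(1) zK] by blast
  have AK: "A \<in> carrier K" using A(1) H_sub by blast
  have "mnorm (?z - A) < d" using A(2) by simp
  hence "?f A \<in> W" using d(2)[rule_format, OF AK] by simp
  hence "A \<in> {B \<in> carrier H. mnorm (1\<^sub>m m - B) < e}" unfolding W(2) using A(1) by simp
  hence A1: "mnorm (1\<^sub>m m - A) < e" by simp
  have Am: "A \<in> carrier_mat m m" by (rule SL_carrier_mat[OF A(1)])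
  note zm = SL_carrier_mat[OF zK]
  have "mnorm (1\<^sub>m m - ?z) \<le> max (mnorm (1\<^sub>m m - A)) (mnorm (A - ?z))"
    by (rule mnorm_diff_triangle[OF one_carrier_mat Am zm])
  also have "\<dots> < e" using A1 A(2) mnorm_diff_commute[OF Am zm] by simp
  finally have "mnorm (1\<^sub>m m - ?z) < e" .
  moreover have "padic_abs ((1\<^sub>m m - ?z) $$ (0, 0)) \<le> mnorm (1\<^sub>m m - ?z)"
    using m(1) by (intro mnorm_ge) auto
  ultimately show False using m(1) by (simp add: e_def)
qed

end

lemma ex_odd_divisor:
  assumes "m > 0" "\<nexists>k. m = 2 ^ k"
  obtains q :: nat where "odd q" "q > 1" "q dvd m"
proof -
  obtain q where q: "m = 2 ^ multiplicity 2 m * q" "\<not> 2 dvd q"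
    using multiplicity_decompose'[of m 2] assms(1) by auto
  have "q \<noteq> 1" using q(1) assms(2) by (metis mult.right_neutral)
  moreover have "q \<noteq> 0" using q(2) by (cases q) auto
  ultimately have "q > 1" by linarith
  thus ?thesis using that[of q] q by (metis dvd_triv_right)
qed

theorem corollary5p4:
  fixes p :: nat and F :: "'p::prime_card padic set"
  assumes "p = CARD('p)" and "is_subfield F"
  shows "(\<forall>n>0. coprime n (p - 1) \<longrightarrow>
            totally_minimal_topological_group (SL n F) (SL_topology n F) \<and>
            totally_minimal_topological_group (PSL n F) (PSL_topology n F)) \<and>
         ((\<nexists>k. p - 1 = 2 ^ k) \<longrightarrow>
            \<not> minimal_topological_group (SL (p - 1) (\<rat> :: 'p padic set))
                (SL_topology (p - 1) (\<rat> :: 'p padic set)))"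
proof (intro conjI allI impI)
  fix n :: nat assume n: "n > 0" "coprime n (p - 1)"
  interpret top_group "SL n F" "SL_topology n F"
    using hausdorff_SL[OF assms(2)] by (simp add: top_group_iff)
  have min: "minimal_modulo (SL n F) (SL_topology n F) N" if "N \<lhd> SL n F" for N
    using SL_minimal_modulo[OF assms(2) n(1) _ that] n(2) assms(1) by simp
  show "totally_minimal_topological_group (SL n F) (SL_topology n F)"
    by (rule totally_minimalI[OF min])
  show "totally_minimal_topological_group (PSL n F) (PSL_topology n F)"
    unfolding PSL_def PSL_topology_def
    by (rule totally_minimal_quotient[OF min normal_center closedin_center])
next
  assume "\<nexists>k. p - 1 = 2 ^ k"
  moreover have "p - 1 > 0" using prime_gt_1_nat[OF prime_card[where 'a='p]] assms(1) by simp
  ultimately obtain q where q: "odd q" "q > 1" "q dvd p - 1" using ex_odd_divisor by blast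
  obtain z :: "'p padic" where "z ^ q = 1" "z \<noteq> 1"
    using padic_root_of_unity_exists q assms(1) by blast
  thus "\<not> minimal_topological_group (SL (p - 1) (\<rat> :: 'p padic set)) (SL_topology (p - 1) (\<rat> :: 'p padic set))"
    using odd_root_of_unity.SL_Rats_not_minimal[of "p - 1" q z] q \<open>p - 1 > 0\<close>
    by (simp add: odd_root_of_unity_def)
qed

end
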